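(* Let $A$ be a contractible differential graded commutative Frobenius algebra whose scalar product is odd, symmetric and nondegenerate, and let $L\subset A$ be a maximally isotropic subspace with $A=L\oplus d(A)$. Let $$I:C_\bullet(\mathfrak{g}_{2n|m},\mathfrak{osp}_{2n|m})\to\mathcal{G}_\bullet,\qquad F_A^L:\mathcal{G}_\bullet\to\mathbb{R},\qquad S_A^L:C_\bullet(\mathfrak{g}_{2n|m},\mathfrak{osp}_{2n|m})\to\mathbb{R}$$ be the maps defined in the context. Then $$S_A^L=F_A^L\circ I.$$
   Context: Conventions. All vector spaces are $\mathbb{Z}/2$-graded (super) over $\mathbb{R}$, and $A$ and $V$ are finite-dimensional; $|x|$ is the parity of $x$, and $(-1)^x$ means $(-1)^{|x|}$. The Koszul sign rule is used. $S(W^* )=\bigoplus_n S^n(W^* )$, $S^n(W^* )=[(W^* )^{\otimes n}]_{S_n}$, is the algebra of polynomial superfunctions on $W$. Tensors are regarded as functionals via $(f_1\otimes\cdots\otimes f_n)(w_1\otimes\cdots\otimes w_n)=f_1(w_1)\cdots f_n(w_n)$, and $A^*\otimes W^*=(A\otimes W)^*$ via $(f\otimes g)(a\otimes w)=f(a)g(w)$. Let $\pi_n:[(W^* )^{\otimes n}]^{S_n}\to S^n(W^* )$ be $\frac1{n!}$ times the quotient map. Lie algebras. $V$ is the superspace with coordinates $p_1,\dots,p_n,q_1,\dots,q_n$ (even), $x_1,\dots,x_m$ (odd), a basis of $V^*$, and even symplectic form $\omega=\sum dp_idq_i+\frac12\sum dx_idx_i$. The associated skew-symmetric form is $\langle-,-\rangle_V=\Upsilon(\omega)$,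 where $\Upsilon(dx\,dy)=(-1)^x[x\otimes y-(-1)^{xy}y\otimes x]$. For a function $a$ let $\alpha$ be its Hamiltonian vector field, $i_\alpha(\omega)=da$ (here $i_\alpha$ is the derivation of forms of parity $|\alpha|+1$ with $i_\alpha(y)=0$, $i_\alpha(dy)=\alpha(y)$, and $dy$ has parity $|y|+1$). $\mathfrak{g}_{2n|m}:=\bigoplus_{i\ge2}S^i(V^* )$ with bracket $\{a,b\}:=(-1)^a\alpha(b)$; $\tilde{\mathfrak g}_{2n|m}:=\bigoplus_{i\ge3}S^i(V^* )$; $\mathfrak{osp}_{2n|m}:=S^2(V^* )$. $\Lambda(\mathfrak l)$ is the quotient of $T(\mathfrak l)$ by $g\otimes h=-(-1)^{|g||h|}h\otimes g$, and $C_\bullet(\mathfrak{g}_{2n|m},\mathfrak{osp}_{2n|m})$ is (as a space) the coinvariants $\Lambda(\tilde{\mathfrak g}_{2n|m})_{\mathfrak{osp}_{2n|m}}$ for the adjoint action. Inverse forms. For a nondegenerate form $\langle-,-\rangle$ on $W$ put $D_l(u)=[x\mapsto\langle u,x\rangle]$, $D_r(u)=[x\mapsto\langle x,u\rangle]$; for an even form, the inverse form on $W^*$ is determined by $\langle D_l(u),D_r(v)\rangle^{-1}=\langle u,v\rangle$. Chord diagrams. A chord diagram $c\in\mathscr{C}(k)$ is a partition of $\{1,\dots,2k\}$ into two-element sets $\{i_1,j_1\},\dots,\{i_k,j_k\}$, with $i_r<j_r$. For a space $U$ with an even bilinear form, $$\beta_c^U(x_1\otimes\cdots\otimes x_{2k})=(-1)^{p_c(x)}\langle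 x_{i_1},x_{j_1}\rangle\cdots\langle x_{i_k},x_{j_k}\rangle,$$ with $(-1)^{p_c(x)}$ the Koszul sign of the permutation $x_1,\dots,x_{2k}\mapsto x_{i_1},x_{j_1},\dots,x_{i_k},x_{j_k}$. Graphs. A graph is a finite set of half-edges with a partition into vertices (all of cardinality $\ge3$) and a partition into edges (two-element sets), together with an orientation: an ordering of the vertices and an orientation of each edge, modulo even permutations (each transposition of two vertices, and each reversal of an edge, reverses the orientation). Isomorphisms are bijections of half-edges preserving all this structure. $\mathcal{G}_\bullet$ is the vector space spanned by isomorphism classes of graphs modulo $\Gamma^\dagger=-\Gamma$, with $\Gamma^\dagger$ being $\Gamma$ with the opposite orientation. For $c\in\mathscr{C}(k)$ and $k_1+\cdots+k_l=2k$, $\Gamma_{k_1,\dots,k_l}(c)$ has half-edges $h_1,\dots,h_{2k}$; its vertices, in order, are $\{h_1,\dots,h_{k_1}\},\{h_{k_1+1},\dots,h_{k_1+k_2}\},\dots$; its edges are $(h_{i_r},h_{j_r})$, oriented from $h_{i_r}$ to $h_{j_r}$. The map $I$. For $x=(x_{11}\cdots x_{1k_1})\otimes\cdots\otimes(x_{l1}\cdots x_{lk_l})$ representing a chain, $x_{ij}\in V^*$, $k_1+\cdots+k_l=2k$, put $I(x)=\sum_{c\in\mathscr{C}(k)}\beta_c^{V^*}(x)\,\Gamma_{k_1,\dots,k_l}(c)$, where $V^*$ carries the inverse form of $\langle-,-\rangle_V$ ($I$ is zero if $\sum k_i$ is odd). Frobenius algebra. $A$ is a $\mathbb{Z}/2$-graded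 (super)commutative associative algebra with an odd differential $d$ (a derivation with $d^2=0$) and a scalar product with $\langle ab,c\rangle_A=\langle a,bc\rangle_A$ and $\langle d(a),b\rangle_A+(-1)^a\langle a,d(b)\rangle_A=0$. Contractible means that $(A,d)$ has zero homology. A subspace is isotropic if $\langle-,-\rangle_A$ vanishes on it, and maximally isotropic if it is isotropic of maximal dimension. Put $\langle a_1,a_2\rangle_d:=(-1)^{a_1}\langle a_1,d(a_2)\rangle_A$, an even skew-symmetric form whose restriction to $L$ is nondegenerate; let $\langle-,-\rangle_d^{-1}$ be the inverse form on $L^*$. Let $\tilde m_k\in(A^* )^{\otimes k+1}$ be the odd symmetric tensor $\tilde m_k(a_1,\dots,a_{k+1}):=\langle a_1\cdots a_k,a_{k+1}\rangle_A$. The map $F_A^L$. For $\Gamma=\Gamma_{k_1,\dots,k_l}(c)$, put $F_A^L(\Gamma):=\beta_c^{L^*}(\tilde m_{k_1-1}\otimes\cdots\otimes\tilde m_{k_l-1})$, where the tensors are restricted to $L$ and $L^*$ carries the form $\langle-,-\rangle_d^{-1}$. The map $S_A^L$. On $A\otimes V$ let $\langle a_1\otimes w_1,a_2\otimes w_2\rangle_{\tilde d}:=(-1)^{w_1a_2}\langle a_1,a_2\rangle_d\langle w_1,w_2\rangle_V$, and $\tilde\sigma:=\pi_2(\langle-,-\rangle_{\tilde d})\in S^2(A^*\otimes V^* )$; its restriction to $L\otimes V$ is nondegenerate. The odd map $\Psi_A:S^{k+1}(V^* )\to S^{k+1}(A^*\otimes V^* )$ is induced by $x\mapsto\tilde m_k\otimes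 x\in(A^* )^{\otimes k+1}\otimes(V^* )^{\otimes k+1}=(A^*\otimes V^* )^{\otimes k+1}$ (Koszul reshuffling). Then $$S_A^L(h_1\wedge\cdots\wedge h_l):=(-1)^{p(h)}\frac{\int_{L\otimes V}\Psi_A(h_1)\cdots\Psi_A(h_l)\,e^{-\tilde\sigma}}{\int_{L\otimes V}e^{-\tilde\sigma}},$$ where $(-1)^{p(h)}$ is the Koszul sign from moving the odd maps $\Psi_A$ past the $h_i$, i.e. $p(h)=\sum_i(l-i)|h_i|$; this is $\mathfrak{osp}_{2n|m}$-invariant and so is defined on $C_\bullet(\mathfrak{g}_{2n|m},\mathfrak{osp}_{2n|m})$. Integrals. Functions are restricted to $X=L\otimes V\cong\mathbb{R}^{N|M}$ (the ratio is independent of linear coordinates). Odd variables are integrated by Berezin integration. The remaining Gaussian integral over $\mathbb{R}^N$ is defined by Wick rotation: choosing coordinates in which the even part of the exponent is $-\frac12(\sum_{i\le k}x_i^2-\sum_{i>k}x_i^2)$, the integral of $f(x)$ times the exponential is $g(\sqrt{-1})$, where $g$ is the analytic continuation to nonzero complex $t$ of $g(t)=\int_{\mathbb{R}^N}f(x)e^{-\frac12[\sum_{i\le k}x_i^2+\sum_{i>k}(tx_i)^2]}dx$ from $t>0$. *)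

theory Defs
  imports "HOL-Analysis.Analysis" "HOL-Analysis.Finite_Function_Topology"
begin

section \<open>Free vector spaces, words and quotients\<close>

text \<open>
  The free real vector space on a type of generators is the type of finitely supported real functions;
  free tensor algebras are free vector spaces on lists (a word is the tensor product of its letters).
  Parities are natural numbers, only their residue modulo 2 matters.
\<close>

abbreviation gen :: "'b \<Rightarrow> 'b \<Rightarrow>\<^sub>0 real"
  where "gen b \<equiv> Poly_Mapping.single b 1"

definition lin_ext :: "('b \<Rightarrow> 'c::real_vector) \<Rightarrow> ('b \<Rightarrow>\<^sub>0 real) \<Rightarrow> 'c"
  where "lin_ext f v = (\<Sum>b\<in>Poly_Mapping.keys v. Poly_Mapping.lookup v b *\<^sub>R f b)"

definition coset :: "'v::real_vector set \<Rightarrow> 'v \<Rightarrow> 'v set"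
  where "coset R x = {y. y - x \<in> R}"

definition wpar :: "('l \<Rightarrow> nat) \<Rightarrow> 'l list \<Rightarrow> nat"
  where "wpar par w = sum_list (map par w)"

definition sym_rels :: "('l \<Rightarrow> nat) \<Rightarrow> ('l list \<Rightarrow>\<^sub>0 real) set"
  where "sym_rels par =
    {gen (u @ [a, b] @ v) - (-1) ^ (par a * par b) *\<^sub>R gen (u @ [b, a] @ v) | u a b v. True}"

text \<open>
  The derivation of parity \<open>e\<close> of the tensor algebra with values \<open>\<delta>\<close> on letters. It induces the
  derivation of the free supercommutative algebra, the quotient by the span of \<^const>\<open>sym_rels\<close>.
\<close>

definition word_deriv ::
  "('l \<Rightarrow> nat) \<Rightarrow> nat \<Rightarrow> ('l \<Rightarrow> 'l list \<Rightarrow>\<^sub>0 real) \<Rightarrow> 'l list \<Rightarrow> ('l list \<Rightarrow>\<^sub>0 real)"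
  where "word_deriv par e \<delta> w =
    (\<Sum>i<length w. (-1) ^ (e * wpar par (take i w)) *\<^sub>R
       lin_ext (\<lambda>u. gen (take i w @ u @ drop (Suc i) w)) (\<delta> (w ! i)))"

definition derivation ::
  "('l \<Rightarrow> nat) \<Rightarrow> nat \<Rightarrow> ('l \<Rightarrow> 'l list \<Rightarrow>\<^sub>0 real) \<Rightarrow> ('l list \<Rightarrow>\<^sub>0 real) \<Rightarrow> ('l list \<Rightarrow>\<^sub>0 real)"
  where "derivation par e \<delta> = lin_ext (word_deriv par e \<delta>)"


section \<open>The symplectic superspace and its functions and forms\<close>

text \<open>The coordinates \<open>p\<^sub>i\<close>, \<open>q\<^sub>i\<close> (even) and \<open>x\<^sub>i\<close> (odd), with indices starting from 0.\<close>

datatype coord = P nat | Q nat | X nat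

fun cpar :: "coord \<Rightarrow> nat" where
  "cpar (P i) = 0"
| "cpar (Q i) = 0"
| "cpar (X i) = 1"

definition coords :: "nat \<Rightarrow> nat \<Rightarrow> coord set"
  where "coords n m = P ` {..<n} \<union> Q ` {..<n} \<union> X ` {..<m}"

datatype form_letter = Fn coord | Df coord

fun fpar :: "form_letter \<Rightarrow> nat" where
  "fpar (Fn y) = cpar y"
| "fpar (Df y) = cpar y + 1"

definition fn_form :: "(coord list \<Rightarrow>\<^sub>0 real) \<Rightarrow> (form_letter list \<Rightarrow>\<^sub>0 real)"
  where "fn_form = lin_ext (\<lambda>w. gen (map Fn w))"

definition de_rham :: "(form_letter list \<Rightarrow>\<^sub>0 real) \<Rightarrow> (form_letter list \<Rightarrow>\<^sub>0 real)"
  where "de_rham = derivation fpar 1 (\<lambda>l. case l of Fn y \<Rightarrow> gen [Df y] | Df y \<Rightarrow> 0)"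

definition contraction ::
  "nat \<Rightarrow> (coord \<Rightarrow> coord list \<Rightarrow>\<^sub>0 real) \<Rightarrow> (form_letter list \<Rightarrow>\<^sub>0 real) \<Rightarrow> (form_letter list \<Rightarrow>\<^sub>0 real)"
  where "contraction p \<alpha> =
    derivation fpar (p + 1) (\<lambda>l. case l of Fn y \<Rightarrow> 0 | Df y \<Rightarrow> fn_form (\<alpha> y))"

definition omega :: "nat \<Rightarrow> nat \<Rightarrow> (form_letter list \<Rightarrow>\<^sub>0 real)"
  where "omega n m =
    (\<Sum>i<n. gen [Df (P i), Df (Q i)]) + (1/2) *\<^sub>R (\<Sum>i<m. gen [Df (X i), Df (X i)])"

definition homog :: "nat \<Rightarrow> nat \<Rightarrow> nat \<Rightarrow> (coord list \<Rightarrow>\<^sub>0 real) \<Rightarrow> bool"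
  where "homog n m p a \<longleftrightarrow>
    (\<forall>w\<in>Poly_Mapping.keys a. set w \<subseteq> coords n m \<and> even (wpar cpar w + p))"

text \<open>
  \<open>\<alpha>\<close> represents (by its values on the coordinates) the Hamiltonian vector field of the function
  represented by \<open>a\<close>, of parity \<open>p\<close>. Equality of forms is equality modulo \<^const>\<open>sym_rels\<close>.
\<close>

definition hamiltonian_field ::
  "nat \<Rightarrow> nat \<Rightarrow> nat \<Rightarrow> (coord list \<Rightarrow>\<^sub>0 real) \<Rightarrow> (coord \<Rightarrow> coord list \<Rightarrow>\<^sub>0 real) \<Rightarrow> bool"
  where "hamiltonian_field n m p a \<alpha> \<longleftrightarrow>
    (\<forall>y\<in>coords n m. homog n m (p + cpar y) (\<alpha> y)) \<and>
    contraction p \<alpha> (omega n m) - de_rham (fn_form a) \<in> span (sym_rels fpar)"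

text \<open>The superspace \<open>V\<close> itself, with the basis \<open>gen y\<close> dual to the coordinates.\<close>

definition V_space :: "nat \<Rightarrow> nat \<Rightarrow> (coord \<Rightarrow>\<^sub>0 real) set"
  where "V_space n m = {v. Poly_Mapping.keys v \<subseteq> coords n m}"

fun upsilon_word :: "form_letter list \<Rightarrow> (coord list \<Rightarrow>\<^sub>0 real)" where
  "upsilon_word [Df y, Df z] =
    (-1) ^ cpar y *\<^sub>R (gen [y, z] - (-1) ^ (cpar y * cpar z) *\<^sub>R gen [z, y])"
| "upsilon_word _ = 0"

fun eval2 :: "(coord \<Rightarrow>\<^sub>0 real) \<Rightarrow> (coord \<Rightarrow>\<^sub>0 real) \<Rightarrow> coord list \<Rightarrow> real" where
  "eval2 v w [y, z] = Poly_Mapping.lookup v y * Poly_Mapping.lookup w z"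
| "eval2 v w _ = 0"

definition form_V :: "nat \<Rightarrow> nat \<Rightarrow> (coord \<Rightarrow>\<^sub>0 real) \<Rightarrow> (coord \<Rightarrow>\<^sub>0 real) \<Rightarrow> real"
  where "form_V n m v w = lin_ext (eval2 v w) (lin_ext upsilon_word (omega n m))"

text \<open>
  The inverse of a nondegenerate even form \<open>B\<close> on a subspace \<open>W\<close>. Functionals on \<open>W\<close> are given
  by functions on the ambient type, of which only the values on \<open>W\<close> matter.
\<close>

definition inverse_form ::
  "'w set \<Rightarrow> ('w \<Rightarrow> 'w \<Rightarrow> real) \<Rightarrow> ('w \<Rightarrow> real) \<Rightarrow> ('w \<Rightarrow> real) \<Rightarrow> real"
  where "inverse_form W B f g =
    (THE r. \<exists>u\<in>W. \<exists>v\<in>W. (\<forall>x\<in>W. f x = B u x) \<and> (\<forall>x\<in>W. g x = B x v) \<and> r = B u v)"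

definition form_V_dual :: "nat \<Rightarrow> nat \<Rightarrow> coord \<Rightarrow> coord \<Rightarrow> real"
  where "form_V_dual n m y z =
    inverse_form (V_space n m) (form_V n m)
      (\<lambda>v. Poly_Mapping.lookup v y) (\<lambda>v. Poly_Mapping.lookup v z)"


section \<open>The relative Chevalley-Eilenberg chains\<close>

text \<open>
  A list of words, each of length at least 3, stands for the wedge product of the monomials given
  by the words. The chain space is the free vector space on such lists modulo the relations of the
  symmetric powers \<open>S\<^sup>i(V\<^sup>*)\<close>, those of the exterior algebra, and the coinvariance relations
  \<open>g \<cdot> x = 0\<close> for homogeneous \<open>g \<in> S\<^sup>2(V\<^sup>*)\<close>.
\<close>

definition chain_words :: "nat \<Rightarrow> nat \<Rightarrow> coord list list set"
  where "chain_words n m = {hs. \<forall>h\<in>set hs. 3 \<le> length h \<and> set h \<subseteq> coords n m}"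

text \<open>
  The adjoint action, extended to tensors by the Koszul rule, of a function of parity \<open>p\<close> with
  Hamiltonian vector field \<open>\<alpha>\<close>: on each factor it is \<open>b \<mapsto> (-1)\<^sup>p \<alpha>(b)\<close>.
\<close>

definition adj_action ::
  "nat \<Rightarrow> (coord \<Rightarrow> coord list \<Rightarrow>\<^sub>0 real) \<Rightarrow> coord list list \<Rightarrow> (coord list list \<Rightarrow>\<^sub>0 real)"
  where "adj_action p \<alpha> hs =
    (\<Sum>i<length hs. (-1) ^ (p * wpar cpar (concat (take i hs))) *\<^sub>R
       lin_ext (\<lambda>u. gen (take i hs @ [u] @ drop (Suc i) hs))
         ((-1) ^ p *\<^sub>R derivation cpar p \<alpha> (gen (hs ! i))))"

definition chain_rels :: "nat \<Rightarrow> nat \<Rightarrow> (coord list list \<Rightarrow>\<^sub>0 real) set"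
  where "chain_rels n m =
    {gen (hs @ [u @ [a, b] @ v] @ hs') - (-1) ^ (cpar a * cpar b) *\<^sub>R gen (hs @ [u @ [b, a] @ v] @ hs')
      | hs u a b v hs'. hs @ [u @ [a, b] @ v] @ hs' \<in> chain_words n m} \<union>
    {gen (hs @ [g, h] @ hs') + (-1) ^ (wpar cpar g * wpar cpar h) *\<^sub>R gen (hs @ [h, g] @ hs')
      | hs g h hs'. hs @ [g, h] @ hs' \<in> chain_words n m} \<union>
    {adj_action p \<alpha> hs
      | p a \<alpha> hs. homog n m p a \<and> (\<forall>w\<in>Poly_Mapping.keys a. length w = 2) \<and>
          hamiltonian_field n m p a \<alpha> \<and> hs \<in> chain_words n m}"

definition chain_space :: "nat \<Rightarrow> nat \<Rightarrow> (coord list list \<Rightarrow>\<^sub>0 real) set set"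
  where "chain_space n m =
    {coset (span (chain_rels n m)) x | x. Poly_Mapping.keys x \<subseteq> chain_words n m}"


section \<open>Chord diagrams\<close>

text \<open>Positions in a tensor, and half-edges, are counted from 0.\<close>

definition chord_diagrams :: "nat \<Rightarrow> nat set set set"
  where "chord_diagrams k = {c. partition_on {..<2 * k} c \<and> (\<forall>e\<in>c. card e = 2)}"

text \<open>The list \<open>i\<^sub>1, j\<^sub>1, \<dots>, i\<^sub>k, j\<^sub>k\<close>, with \<open>i\<^sub>r < j\<^sub>r\<close> and \<open>i\<^sub>1 < i\<^sub>2 < \<dots>\<close>.\<close>

definition chord_list :: "nat set set \<Rightarrow> nat list"
  where "chord_list c =
    concat (map (\<lambda>i. [i, THE j. i < j \<and> {i, j} \<in> c])
      (sorted_list_of_set {i. \<exists>j. i < j \<and> {i, j} \<in> c}))"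

text \<open>
  The Koszul sign of \<open>x\<^sub>0, x\<^sub>1, \<dots> \<mapsto> x\<^bsub>js!0\<^esub>, x\<^bsub>js!1\<^esub>, \<dots>\<close>, where \<open>ps\<close> lists the parities of the \<open>x\<^sub>i\<close>.
\<close>

definition koszul_sign :: "nat list \<Rightarrow> nat list \<Rightarrow> real"
  where "koszul_sign ps js =
    (\<Prod>(s, t)\<in>{(s, t). s < t \<and> t < length js \<and> js ! t < js ! s}. (-1) ^ (ps ! (js ! s) * ps ! (js ! t)))"

definition beta :: "nat set set \<Rightarrow> ('u \<Rightarrow> nat) \<Rightarrow> ('u \<Rightarrow> 'u \<Rightarrow> real) \<Rightarrow> 'u list \<Rightarrow> real"
  where "beta c par B xs =
    koszul_sign (map par xs) (chord_list c) * (\<Prod>e\<in>c. B (xs ! Min e) (xs ! Max e))"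


section \<open>The graph complex\<close>

text \<open>
  A graph with a representative of its orientation: the list of vertices records an ordering of
  them, the ordered pairs record an orientation of each edge.
\<close>

datatype ograph = OGraph (half_edges: "nat set") (vertices: "nat set list") (edges: "(nat \<times> nat) set")

definition is_graph :: "ograph \<Rightarrow> bool"
  where "is_graph \<Gamma> \<longleftrightarrow>
    finite (half_edges \<Gamma>) \<and>
    distinct (vertices \<Gamma>) \<and> partition_on (half_edges \<Gamma>) (set (vertices \<Gamma>)) \<and>
    (\<forall>v\<in>set (vertices \<Gamma>). 3 \<le> card v) \<and>
    inj_on (\<lambda>(a, b). {a, b}) (edges \<Gamma>) \<and> (\<forall>(a, b)\<in>edges \<Gamma>. a \<noteq> b) \<and>
    partition_on (half_edges \<Gamma>) ((\<lambda>(a, b). {a, b}) ` edges \<Gamma>)"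

definition relabel :: "(nat \<Rightarrow> nat) \<Rightarrow> ograph \<Rightarrow> ograph"
  where "relabel f \<Gamma> =
    OGraph (f ` half_edges \<Gamma>) (map (\<lambda>v. f ` v) (vertices \<Gamma>)) (map_prod f f ` edges \<Gamma>)"

text \<open>
  Isomorphic graphs are identified. The two orientations of a graph are opposite; a transposition
  of two vertices and a reversal of an edge each reverse the orientation.
\<close>

definition graph_rels :: "(ograph \<Rightarrow>\<^sub>0 real) set"
  where "graph_rels =
    {gen \<Gamma> - gen (relabel f \<Gamma>) | \<Gamma> f. is_graph \<Gamma> \<and> inj_on f (half_edges \<Gamma>)} \<union>
    {gen (OGraph H (us @ [v] @ vs @ [w] @ ws) E) + gen (OGraph H (us @ [w] @ vs @ [v] @ ws) E)
      | H us v vs w ws E. is_graph (OGraph H (us @ [v] @ vs @ [w] @ ws) E)} \<union>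
    {gen (OGraph H vs (insert (a, b) E)) + gen (OGraph H vs (insert (b, a) E))
      | H vs a b E. (a, b) \<notin> E \<and> is_graph (OGraph H vs (insert (a, b) E))}"

definition graph_space :: "(ograph \<Rightarrow>\<^sub>0 real) set set"
  where "graph_space = {coset (span graph_rels) y | y. Poly_Mapping.keys y \<subseteq> Collect is_graph}"

fun blocks :: "nat list \<Rightarrow> 'b list \<Rightarrow> 'b list list" where
  "blocks [] xs = []"
| "blocks (k # ks) xs = take k xs # blocks ks (drop k xs)"

definition chord_graph :: "nat list \<Rightarrow> nat set set \<Rightarrow> ograph"
  where "chord_graph ks c =
    OGraph {..<sum_list ks} (map set (blocks ks [0..<sum_list ks])) {(i, j). i < j \<and> {i, j} \<in> c}"


section \<open>The map I\<close>

definition I_word :: "nat \<Rightarrow> nat \<Rightarrow> coord list list \<Rightarrow> (ograph \<Rightarrow>\<^sub>0 real)"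
  where "I_word n m hs =
    (if even (length (concat hs)) then
       \<Sum>c\<in>chord_diagrams (length (concat hs) div 2).
         beta c cpar (form_V_dual n m) (concat hs) *\<^sub>R gen (chord_graph (map length hs) c)
     else 0)"

text \<open>
  On the quotient, \<open>I\<close> sends a class to the class of the images of its representatives (since \<open>I\<close>
  is compatible with the relations, all the cosets in this union coincide).
\<close>

definition I_map :: "nat \<Rightarrow> nat \<Rightarrow> (coord list list \<Rightarrow>\<^sub>0 real) set \<Rightarrow> (ograph \<Rightarrow>\<^sub>0 real) set"
  where "I_map n m C = (\<Union>x\<in>C. coset (span graph_rels) (lin_ext (I_word n m) x))"


section \<open>Differential graded commutative Frobenius algebras\<close>

text \<open>The underlying superspace is the whole type, with given even and odd parts.\<close>

record 'a dg_alg =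
  even_part :: "'a set"
  odd_part :: "'a set"
  mul :: "'a \<Rightarrow> 'a \<Rightarrow> 'a"
  dif :: "'a \<Rightarrow> 'a"
  sp :: "'a \<Rightarrow> 'a \<Rightarrow> real"

definition hom_part :: "('a, 'x) dg_alg_scheme \<Rightarrow> nat \<Rightarrow> 'a set"
  where "hom_part A p = (if even p then even_part A else odd_part A)"

definition graded_subspace :: "('a::real_vector, 'x) dg_alg_scheme \<Rightarrow> 'a set \<Rightarrow> bool"
  where "graded_subspace A W \<longleftrightarrow>
    subspace W \<and> (\<forall>w\<in>W. \<exists>x\<in>W \<inter> even_part A. \<exists>y\<in>W \<inter> odd_part A. w = x + y)"

definition bilin :: "('a::real_vector \<Rightarrow> 'a \<Rightarrow> 'b::real_vector) \<Rightarrow> bool"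
  where "bilin f \<longleftrightarrow> (\<forall>a. linear (f a)) \<and> (\<forall>b. linear (\<lambda>a. f a b))"

definition dg_comm_frobenius :: "('a::real_vector, 'x) dg_alg_scheme \<Rightarrow> bool"
  where "dg_comm_frobenius A \<longleftrightarrow>
    (\<exists>B::'a set. finite B \<and> span B = UNIV) \<and>
    subspace (even_part A) \<and> subspace (odd_part A) \<and> even_part A \<inter> odd_part A = {0} \<and>
    graded_subspace A UNIV \<and>
    bilin (mul A) \<and>
    (\<forall>p q. \<forall>a\<in>hom_part A p. \<forall>b\<in>hom_part A q. mul A a b \<in> hom_part A (p + q)) \<and>
    (\<forall>a b c. mul A (mul A a b) c = mul A a (mul A b c)) \<and>
    (\<forall>p q. \<forall>a\<in>hom_part A p. \<forall>b\<in>hom_part A q. mul A a b = (-1) ^ (p * q) *\<^sub>R mul A b a) \<and>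
    linear (dif A) \<and>
    (\<forall>p. \<forall>a\<in>hom_part A p. dif A a \<in> hom_part A (p + 1)) \<and>
    (\<forall>a. dif A (dif A a) = 0) \<and>
    (\<forall>p. \<forall>a\<in>hom_part A p. \<forall>b.
       dif A (mul A a b) = mul A (dif A a) b + (-1) ^ p *\<^sub>R mul A a (dif A b)) \<and>
    bilin (sp A) \<and>
    (\<forall>a b c. sp A (mul A a b) c = sp A a (mul A b c)) \<and>
    (\<forall>p. \<forall>a\<in>hom_part A p. \<forall>b. sp A (dif A a) b + (-1) ^ p * sp A a (dif A b) = 0)"

definition sp_odd :: "('a, 'x) dg_alg_scheme \<Rightarrow> bool"
  where "sp_odd A \<longleftrightarrow>
    (\<forall>p q. \<forall>a\<in>hom_part A p. \<forall>b\<in>hom_part A q. even (p + q) \<longrightarrow> sp A a b = 0)"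

definition sp_symmetric :: "('a, 'x) dg_alg_scheme \<Rightarrow> bool"
  where "sp_symmetric A \<longleftrightarrow>
    (\<forall>p q. \<forall>a\<in>hom_part A p. \<forall>b\<in>hom_part A q. sp A a b = (-1) ^ (p * q) * sp A b a)"

definition sp_nondegenerate :: "('a::real_vector, 'x) dg_alg_scheme \<Rightarrow> bool"
  where "sp_nondegenerate A \<longleftrightarrow>
    (\<forall>a. (\<forall>b. sp A a b = 0) \<longrightarrow> a = 0) \<and> (\<forall>b. (\<forall>a. sp A a b = 0) \<longrightarrow> b = 0)"

definition contractible_alg :: "('a::real_vector, 'x) dg_alg_scheme \<Rightarrow> bool"
  where "contractible_alg A \<longleftrightarrow> {a. dif A a = 0} = range (dif A)"

definition isotropic :: "('a, 'x) dg_alg_scheme \<Rightarrow> 'a set \<Rightarrow> bool"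
  where "isotropic A W \<longleftrightarrow> (\<forall>a\<in>W. \<forall>b\<in>W. sp A a b = 0)"

text \<open>Subspaces of superspaces are graded.\<close>

definition maximally_isotropic :: "('a::real_vector, 'x) dg_alg_scheme \<Rightarrow> 'a set \<Rightarrow> bool"
  where "maximally_isotropic A L \<longleftrightarrow>
    graded_subspace A L \<and> isotropic A L \<and>
    (\<forall>M. graded_subspace A M \<and> isotropic A M \<longrightarrow> dim M \<le> dim L)"

definition complements_boundaries :: "('a::real_vector, 'x) dg_alg_scheme \<Rightarrow> 'a set \<Rightarrow> bool"
  where "complements_boundaries A L \<longleftrightarrow>
    L \<inter> range (dif A) = {0} \<and> (\<forall>a. \<exists>x\<in>L. \<exists>y\<in>range (dif A). a = x + y)"

text \<open>
  The linear map \<open>a \<mapsto> (-1)\<^bsup>k |a|\<^esup> a\<close>; with its help formulas containing signs in the parities of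
  elements of \<open>A\<close> are stated for all elements and not only for the homogeneous ones.
\<close>

definition par_sign :: "('a::real_vector, 'x) dg_alg_scheme \<Rightarrow> nat \<Rightarrow> 'a \<Rightarrow> 'a"
  where "par_sign A k a =
    (THE b. \<exists>x\<in>even_part A. \<exists>y\<in>odd_part A. a = x + y \<and> b = x + (-1) ^ k *\<^sub>R y)"

definition form_d :: "('a::real_vector, 'x) dg_alg_scheme \<Rightarrow> 'a \<Rightarrow> 'a \<Rightarrow> real"
  where "form_d A a b = sp A (par_sign A 1 a) (dif A b)"

fun mul_list :: "('a::real_vector, 'x) dg_alg_scheme \<Rightarrow> 'a list \<Rightarrow> 'a" where
  "mul_list A [] = 0"  \<comment> \<open>junk: \<open>A\<close> need not have a unit, and the empty product is never used\<close>
| "mul_list A [a] = a"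
| "mul_list A (a # b # as) = mul A a (mul_list A (b # as))"

definition m_tilde :: "('a::real_vector, 'x) dg_alg_scheme \<Rightarrow> 'a list \<Rightarrow> real"
  where "m_tilde A as = sp A (mul_list A (butlast as)) (last as)"

definition m_tilde_tensor :: "('a::real_vector, 'x) dg_alg_scheme \<Rightarrow> nat list \<Rightarrow> 'a list \<Rightarrow> real"
  where "m_tilde_tensor A ks as = prod_list (map (m_tilde A) (blocks ks as))"


section \<open>The map F\<close>

definition hom_basis :: "('a::real_vector, 'x) dg_alg_scheme \<Rightarrow> 'a set \<Rightarrow> 'a set \<Rightarrow> bool"
  where "hom_basis A L E \<longleftrightarrow> independent E \<and> span E = L \<and> E \<subseteq> even_part A \<union> odd_part A"

definition elem_par :: "('a, 'x) dg_alg_scheme \<Rightarrow> 'a \<Rightarrow> nat"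
  where "elem_par A e = (if e \<in> even_part A then 0 else 1)"

text \<open>
  \<open>\<beta>\<^sub>c\<close> on a tensor in \<open>(L\<^sup>*)\<^bsup>\<otimes>r\<^esup>\<close> given as a multilinear functional \<open>T\<close> of \<open>r\<close> arguments: expand
  \<open>T = \<Sum> T(e\<^sub>1, \<dots>, e\<^sub>r) e\<^sub>1\<^sup>* \<otimes> \<dots> \<otimes> e\<^sub>r\<^sup>*\<close> in a homogeneous basis of \<open>L\<close>. The parity of \<open>e\<^sup>*\<close> is that of \<open>e\<close>.
\<close>

definition beta_L_dual ::
  "('a::real_vector, 'x) dg_alg_scheme \<Rightarrow> 'a set \<Rightarrow> nat set set \<Rightarrow> nat \<Rightarrow> ('a list \<Rightarrow> real) \<Rightarrow> real"
  where "beta_L_dual A L c r T =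
    (let E = (SOME E. hom_basis A L E);
         dual = (\<lambda>e x. representation E x e)
     in \<Sum>es\<in>{es. set es \<subseteq> E \<and> length es = r}.
          T es * beta c (elem_par A) (\<lambda>e f. inverse_form L (form_d A) (dual e) (dual f)) es)"

text \<open>
  \<open>F\<close> is the linear functional on \<^const>\<open>graph_space\<close>, that is, a linear functional vanishing on the
  relations, with prescribed values on the graphs \<open>\<Gamma>\<^bsub>k\<^sub>1,\<dots>,k\<^sub>l\<^esub>(c)\<close>; these span the graph space, so it is
  unique there.
\<close>

definition F_functional ::
  "('a::real_vector, 'x) dg_alg_scheme \<Rightarrow> 'a set \<Rightarrow> ((ograph \<Rightarrow>\<^sub>0 real) \<Rightarrow> real) \<Rightarrow> bool"
  where "F_functional A L \<phi> \<longleftrightarrow>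
    linear \<phi> \<and> (\<forall>r\<in>graph_rels. \<phi> r = 0) \<and>
    (\<forall>ks k c. (\<forall>i\<in>set ks. 3 \<le> i) \<and> sum_list ks = 2 * k \<and> c \<in> chord_diagrams k \<longrightarrow>
       \<phi> (gen (chord_graph ks c)) = beta_L_dual A L c (2 * k) (m_tilde_tensor A ks))"

definition F_map :: "('a::real_vector, 'x) dg_alg_scheme \<Rightarrow> 'a set \<Rightarrow> (ograph \<Rightarrow>\<^sub>0 real) set \<Rightarrow> real"
  where "F_map A L Y = the_elem ((SOME \<phi>. F_functional A L \<phi>) ` Y)"


section \<open>Superfunctions on a superspace with coordinates\<close>

text \<open>
  An element of the Grassmann algebra on odd generators \<open>\<xi>\<^sub>i\<close> is given by the coefficients of the
  monomials \<open>\<xi>\<^sub>K\<close>, \<open>K\<close> a finite set of indices, in which the generators are in increasing order.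
  A superfunction is a function of the even coordinates with values in the Grassmann algebra.
\<close>

type_synonym grassmann = "nat set \<Rightarrow> real"

type_synonym superfun = "(nat \<Rightarrow> real) \<Rightarrow> grassmann"

definition gr_const :: "real \<Rightarrow> grassmann"
  where "gr_const r = (\<lambda>K. if K = {} then r else 0)"

definition gr_mul :: "grassmann \<Rightarrow> grassmann \<Rightarrow> grassmann"
  where "gr_mul f g = (\<lambda>K. \<Sum>I\<in>Pow K.
    (-1) ^ card {(i, j). i \<in> I \<and> j \<in> K - I \<and> j < i} * f I * g (K - I))"

definition gr_prod :: "grassmann list \<Rightarrow> grassmann"
  where "gr_prod fs = foldr gr_mul fs (gr_const 1)"

text \<open>
  The coordinates on the superspace of dimension \<open>N|M\<close> are the even ones with indices \<open>0, \<dots>, N-1\<close> and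
  the odd ones with indices \<open>N, \<dots>, N+M-1\<close>.
\<close>

definition coordinate :: "nat \<Rightarrow> nat \<Rightarrow> superfun"
  where "coordinate N i x = (if i < N then gr_const (x i) else (\<lambda>K. if K = {i} then 1 else 0))"

text \<open>
  The polynomial superfunction defined by a tensor of degree \<open>r\<close>, given as a multilinear functional \<open>T\<close>,
  in the linear coordinates \<open>z\<^sub>i\<close> dual to the basis \<open>b\<close>:
  \<open>T = \<Sum> T(b\<^sub>i\<^sub>1, \<dots>, b\<^sub>i\<^sub>r) z\<^sub>i\<^sub>1 \<otimes> \<dots> \<otimes> z\<^sub>i\<^sub>r\<close> is mapped to \<open>S\<^sup>r\<close>.
\<close>

definition tensor_superfun :: "nat \<Rightarrow> nat \<Rightarrow> (nat \<Rightarrow> 'w) \<Rightarrow> nat \<Rightarrow> ('w list \<Rightarrow> real) \<Rightarrow> superfun"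
  where "tensor_superfun N M b r T x = (\<lambda>K.
    \<Sum>is\<in>{is. set is \<subseteq> {..<N + M} \<and> length is = r}.
      T (map b is) * gr_prod (map (\<lambda>i. coordinate N i x) is) K)"

text \<open>The exponential of an element without constant term in \<open>M\<close> odd generators, which is nilpotent.\<close>

definition gr_exp :: "nat \<Rightarrow> grassmann \<Rightarrow> grassmann"
  where "gr_exp M s = (\<lambda>K. \<Sum>j\<le>M. gr_prod (replicate j s) K / fact j)"

text \<open>
  The Wick rotated integral of \<open>f\<close> times the exponential of
  \<open>-(\<Sum>\<^sub>i\<^sub><\<^sub>k x\<^sub>i\<^sup>2 - \<Sum>\<^sub>k\<^sub>\<le>\<^sub>i\<^sub><\<^sub>N x\<^sub>i\<^sup>2)/2\<close>.
\<close>

definition wick_integral :: "nat \<Rightarrow> nat \<Rightarrow> ((nat \<Rightarrow> real) \<Rightarrow> real) \<Rightarrow> complex"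
  where "wick_integral N k f =
    (THE z. \<exists>g. g holomorphic_on (- {0}) \<and>
       (\<forall>t>0. g (complex_of_real t) = complex_of_real
          (\<integral>x. f x * exp (- ((\<Sum>i<k. (x i)\<^sup>2) + (\<Sum>i\<in>{k..<N}. (t * x i)\<^sup>2)) / 2)
             \<partial>(\<Pi>\<^sub>M i\<in>{..<N}. lborel))) \<and>
       z = g \<i>)"


section \<open>The map S\<close>

text \<open>
  An element \<open>\<Sum>\<^sub>y a\<^sub>y \<otimes> gen y\<close> of \<open>L \<otimes> V\<close> is represented by the finitely supported function
  \<open>y \<mapsto> a\<^sub>y\<close>; in particular \<open>a \<otimes> gen y\<close> is \<open>Poly_Mapping.single y a\<close>.
\<close>

definition LV_space :: "'a set \<Rightarrow> nat \<Rightarrow> nat \<Rightarrow> (coord \<Rightarrow>\<^sub>0 'a::real_vector) set"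
  where "LV_space L n m =
    {w. Poly_Mapping.keys w \<subseteq> coords n m \<and> (\<forall>y. Poly_Mapping.lookup w y \<in> L)}"

definition LV_part ::
  "('a::real_vector, 'x) dg_alg_scheme \<Rightarrow> 'a set \<Rightarrow> nat \<Rightarrow> nat \<Rightarrow> nat \<Rightarrow> (coord \<Rightarrow>\<^sub>0 'a) set"
  where "LV_part A L n m p =
    {w \<in> LV_space L n m. \<forall>y. Poly_Mapping.lookup w y \<in> hom_part A (p + cpar y)}"

definition form_dV ::
  "('a::real_vector, 'x) dg_alg_scheme \<Rightarrow> nat \<Rightarrow> nat \<Rightarrow> (coord \<Rightarrow>\<^sub>0 'a) \<Rightarrow> (coord \<Rightarrow>\<^sub>0 'a) \<Rightarrow> real"
  where "form_dV A n m u w =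
    (\<Sum>y\<in>coords n m. \<Sum>z\<in>coords n m.
       form_d A (Poly_Mapping.lookup u y) (par_sign A (cpar y) (Poly_Mapping.lookup w z)) *
       form_V n m (gen y) (gen z))"

text \<open>
  \<open>\<Psi>\<^sub>A(y\<^sub>0 \<cdots> y\<^sub>k)\<close> as a multilinear functional. On \<open>(a\<^sub>0 \<otimes> v\<^sub>0), \<dots>, (a\<^sub>k \<otimes> v\<^sub>k)\<close> its value is
  \<open>m\<^sub>k(a\<^sub>0, \<dots>, a\<^sub>k) y\<^sub>0(v\<^sub>0) \<cdots> y\<^sub>k(v\<^sub>k)\<close> times \<open>(-1)\<^bsup>|y\<^sub>i| |a\<^sub>j|\<^esup>\<close> for all \<open>i < j\<close>, the sign of moving the
  \<open>j\<close>-th factor in \<open>A\<^sup>*\<close> to the left of \<open>y\<^sub>j\<close>.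
\<close>

definition psi ::
  "('a::real_vector, 'x) dg_alg_scheme \<Rightarrow> coord list \<Rightarrow> (coord \<Rightarrow>\<^sub>0 'a) list \<Rightarrow> real"
  where "psi A h ws =
    m_tilde A (map (\<lambda>j. par_sign A (wpar cpar (take j h)) (Poly_Mapping.lookup (ws ! j) (h ! j)))
      [0..<length h])"

definition sigma_superfun ::
  "('a::real_vector, 'x) dg_alg_scheme \<Rightarrow> nat \<Rightarrow> nat \<Rightarrow> nat \<Rightarrow> nat \<Rightarrow> (nat \<Rightarrow> coord \<Rightarrow>\<^sub>0 'a) \<Rightarrow> superfun"
  where "sigma_superfun A n m N M b x = (\<lambda>K.
    1 / fact 2 * tensor_superfun N M b 2 (\<lambda>ws. form_dV A n m (ws ! 0) (ws ! 1)) x K)"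

text \<open>
  Linear coordinates on \<open>L \<otimes> V\<close>, dual to a homogeneous basis \<open>b\<close>, in which the even part of
  \<open>\<sigma>\<close> is \<open>(\<Sum>\<^sub>i\<^sub><\<^sub>k x\<^sub>i\<^sup>2 - \<Sum>\<^sub>k\<^sub>\<le>\<^sub>i\<^sub><\<^sub>N x\<^sub>i\<^sup>2)/2\<close>.
\<close>

definition adapted_coordinates ::
  "('a::real_vector, 'x) dg_alg_scheme \<Rightarrow> 'a set \<Rightarrow> nat \<Rightarrow> nat \<Rightarrow>
    nat \<times> nat \<times> nat \<times> (nat \<Rightarrow> coord \<Rightarrow>\<^sub>0 'a) \<Rightarrow> bool"
  where "adapted_coordinates A L n m = (\<lambda>(N, M, k, b).
    inj_on b {..<N + M} \<and> independent (b ` {..<N + M}) \<and> span (b ` {..<N + M}) = LV_space L n m \<and>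
    b ` {..<N} \<subseteq> LV_part A L n m 0 \<and> b ` {N..<N + M} \<subseteq> LV_part A L n m 1 \<and>
    k \<le> N \<and>
    (\<forall>x. sigma_superfun A n m N M b x {} = ((\<Sum>i<k. (x i)\<^sup>2) - (\<Sum>i\<in>{k..<N}. (x i)\<^sup>2)) / 2))"

text \<open>
  The integral of \<open>f e\<^bsup>-\<sigma>\<^esup>\<close>: the Berezin integral over the odd coordinates takes the coefficient
  of the product of all of them (its sign depends on the ordering of the coordinates and cancels in
  ratios), and the exponential of the even part of \<open>-\<sigma>\<close> is included in \<^const>\<open>wick_integral\<close>.
\<close>

definition gauss_integral ::
  "('a::real_vector, 'x) dg_alg_scheme \<Rightarrow> nat \<Rightarrow> nat \<Rightarrow>
    nat \<times> nat \<times> nat \<times> (nat \<Rightarrow> coord \<Rightarrow>\<^sub>0 'a) \<Rightarrow> superfun \<Rightarrow> complex"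
  where "gauss_integral A n m = (\<lambda>(N, M, k, b) f.
    wick_integral N k (\<lambda>x.
      gr_mul (f x) (gr_exp M (\<lambda>K. if K = {} then 0 else - sigma_superfun A n m N M b x K)) {N..<N + M}))"

definition psi_product ::
  "('a::real_vector, 'x) dg_alg_scheme \<Rightarrow> nat \<times> nat \<times> nat \<times> (nat \<Rightarrow> coord \<Rightarrow>\<^sub>0 'a) \<Rightarrow>
    coord list list \<Rightarrow> superfun"
  where "psi_product A = (\<lambda>(N, M, k, b) hs x.
    gr_prod (map (\<lambda>h. tensor_superfun N M b (length h) (psi A h) x) hs))"

text \<open>
  The ratio of the two integrals is real, but as a Wick rotated integral it is a complex number; the
  value is the corresponding element of \<open>\<real>\<close>.
\<close>

definition S_word ::
  "('a::real_vector, 'x) dg_alg_scheme \<Rightarrow> 'a set \<Rightarrow> nat \<Rightarrow> nat \<Rightarrow> coord list list \<Rightarrow> real"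
  where "S_word A L n m hs =
    (let z = (SOME z. adapted_coordinates A L n m z);
         l = length hs
     in THE r. complex_of_real r =
          (-1) ^ (\<Sum>i<l. (l - Suc i) * wpar cpar (hs ! i)) *
          (gauss_integral A n m z (psi_product A z hs) / gauss_integral A n m z (\<lambda>x. gr_const 1)))"

text \<open>The common value on all representatives of a chain.\<close>

definition S_map ::
  "('a::real_vector, 'x) dg_alg_scheme \<Rightarrow> 'a set \<Rightarrow> nat \<Rightarrow> nat \<Rightarrow> (coord list list \<Rightarrow>\<^sub>0 real) set \<Rightarrow> real"
  where "S_map A L n m C = the_elem (lin_ext (S_word A L n m) ` C)"

end

theory Submission
  imports Defs "HOL-Probability.Distributions" "HOL-Complex_Analysis.Conformal_Mappings"
begin

text \<open>
  Both sides are computed on words. For the even coordinates the moments of a Wick rotated Gaussian,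
  and for the odd ones the vanishing of the Berezin integral of a derivative, show that the
  normalised integral \<open>\<langle>z\<^sub>0 z\<^sub>1 \<cdots> z\<^sub>r\<rangle>\<close> is the signed sum over \<open>s\<close> of the inverse form of \<open>z\<^sub>0, z\<^sub>s\<close> times the
  integral of the remaining factors. This recursion also characterises the sum of \<open>\<beta>\<^sub>c\<close> over all chord diagrams \<open>c\<close>.
  On \<open>L\<^sup>* \<otimes> V\<^sup>*\<close> the functional \<open>\<beta>\<^sub>c\<close> is the product of those of \<open>L\<^sup>*\<close> and \<open>V\<^sup>*\<close> up to the sign of the
  reshuffling, which cancels the signs in \<open>\<Psi>\<^sub>A\<close>; what remains is \<open>F\<close> applied to \<open>I\<close>, word by word.

  So neither \<open>S\<close> nor \<open>I\<close> has to be shown to respect the relations of the chain space: it suffices that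
  these relations only involve admissible words and that the functional \<open>F\<close> exists. The latter is a state
  sum over the half-edges: the inverse form on \<open>L\<^sup>*\<close> is skew-symmetric, which gives the sign of an edge
  reversal, and the vertex tensors are symmetric and odd, which gives the sign of a transposition of vertices.
\<close>

section \<open>Free vector spaces\<close>

text \<open>The two sides arrange their signs differently: the integral reads its letters from left
  to right, a chord diagram lists chords by their smaller ends, and a graph has no order on its
  half-edges at all. Signs are therefore attached to pairs of enumerations of one set; they compose,
  and each comparison reduces to adjacent swaps. Evenness of both inverse forms makes this
  consistent: only chords joining letters of equal parity contribute, so the sign of moving one end
  of a chord may be computed with the parity of the other end, and whole chords move without sign.
  Wick rotation accounts for the signature: at the imaginary unit, the power of t in the denominator
  of a moment splits into a factor common to all monomials, which cancels in the ratio, and one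
  factor \<open>wick_eps\<close> for each pair of equal letters, which is the inverse of the form in
  that coordinate. Both maps are defined as the only element of a set of values, so what is proved
  at the end is the equality of two such sets.\<close>

lemma lin_ext_superset:
  assumes "finite S" "Poly_Mapping.keys v \<subseteq> S"
  shows "lin_ext f v = (\<Sum>b\<in>S. Poly_Mapping.lookup v b *\<^sub>R f b)"
  unfolding lin_ext_def
  by (rule sum.mono_neutral_left) (use assms in \<open>auto simp: in_keys_iff\<close>)

lemma lookup_scaleR [simp]: "Poly_Mapping.lookup (r *\<^sub>R v) b = r *\<^sub>R Poly_Mapping.lookup v b"
proof -
  \<comment> \<open>Scaling is the abstraction of a pointwise scaled function, whose support must be
    known to be finite before a coefficient can be read off.\<close>
  have "finite {b. r *\<^sub>R Poly_Mapping.lookup v b \<noteq> 0}"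
    by (rule finite_subset[of _ "Poly_Mapping.keys v"]) (auto simp: in_keys_iff)
  then show ?thesis
    unfolding scaleR_poly_mapping_def by simp
qed

lemma keys_scaleR: "Poly_Mapping.keys (r *\<^sub>R v) \<subseteq> Poly_Mapping.keys v"
  by (auto simp: in_keys_iff)

lemma linear_lin_ext: "linear (lin_ext f)"
proof
  fix v w :: "'a \<Rightarrow>\<^sub>0 real" and r :: real
  let ?S = "Poly_Mapping.keys v \<union> Poly_Mapping.keys w"
  show "lin_ext f (v + w) = lin_ext f v + lin_ext f w"
    by (subst (1 2 3) lin_ext_superset[of ?S])
      (auto simp: lookup_add scaleR_add_left sum.distrib dest: subsetD[OF Poly_Mapping.keys_add])
  show "lin_ext f (r *\<^sub>R v) = r *\<^sub>R lin_ext f v"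
    using keys_scaleR[of r v]
    by (subst (1 2) lin_ext_superset[of "Poly_Mapping.keys v"]) (auto simp: scaleR_sum_right)
qed

lemma lin_ext_gen [simp]: "lin_ext f (gen b) = f b"
  by (simp add: lin_ext_def)

section \<open>Signs of reorderings\<close>

lemma neg_one_power_cong:
  assumes "even (i + j)"
  shows "(-1::'a::ring_1) ^ i = (-1) ^ j"
  using assms by (cases "even i") auto

section \<open>Permutations as products of adjacent transpositions\<close>

inductive adjacent_swap :: "'h list \<Rightarrow> 'h list \<Rightarrow> bool" where
  "adjacent_swap (u @ a # b # v) (u @ b # a # v)"

lemma adjacent_swap_Cons: "adjacent_swap us vs \<Longrightarrow> adjacent_swap (x # us) (x # vs)"
  by (auto elim!: adjacent_swap.cases) (metis adjacent_swap.intros append_Cons)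

lemma adjacent_swap_mset: "adjacent_swap us vs \<Longrightarrow> mset us = mset vs"
  by (auto elim!: adjacent_swap.cases)

lemma adjacent_swaps_Cons: "adjacent_swap\<^sup>*\<^sup>* us vs \<Longrightarrow> adjacent_swap\<^sup>*\<^sup>* (x # us) (x # vs)"
  by (induction rule: rtranclp_induct) (auto intro: adjacent_swap_Cons rtranclp.rtrancl_into_rtrancl)

lemma adjacent_swaps_front: "adjacent_swap\<^sup>*\<^sup>* (x # us @ vs) (us @ x # vs)"
proof (induction us)
  case (Cons y us)
  have "adjacent_swap (x # y # us @ vs) (y # x # us @ vs)"
    using adjacent_swap.intros[of "[]" x y "us @ vs"] by simp
  moreover have "adjacent_swap\<^sup>*\<^sup>* (y # x # us @ vs) (y # us @ x # vs)"
    by (rule adjacent_swaps_Cons) (rule Cons)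
  ultimately show ?case by simp
qed simp

lemma mset_eq_adjacent_swaps:
  assumes "mset us = mset vs"
  shows "adjacent_swap\<^sup>*\<^sup>* us vs"
  using assms
proof (induction us arbitrary: vs)
  case (Cons x us)
  then have "x \<in> set vs"
    by (metis list.set_intros(1) mset_eq_setD)
  then obtain vs1 vs2 where vs: "vs = vs1 @ x # vs2"
    by (meson split_list)
  then have "mset us = mset (vs1 @ vs2)"
    using Cons.prems by simp
  then have "adjacent_swap\<^sup>*\<^sup>* (x # us) (x # vs1 @ vs2)"
    by (intro adjacent_swaps_Cons Cons.IH)
  also have "adjacent_swap\<^sup>*\<^sup>* (x # vs1 @ vs2) vs"
    unfolding vs by (rule adjacent_swaps_front)
  finally show ?case .
qed auto

text \<open>Adjacent transpositions generate all permutations, so three cases suffice for a relation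
  between enumerations of one set. The distinctness and set conditions handed to \<open>swap\<close>
  and \<open>trans\<close> are what the sign lemmas need about the intermediate lists.\<close>

lemma reorder_induct [consumes 3, case_names refl swap trans]:
  assumes "distinct us" "distinct vs" "set us = set vs"
  assumes refl: "R us us"
    and swap: "\<And>u a b v. distinct (u @ a # b # v) \<Longrightarrow> set (u @ a # b # v) = set us \<Longrightarrow> R (u @ a # b # v) (u @ b # a # v)"
    and trans: "\<And>xs ys zs. distinct xs \<Longrightarrow> set xs = set us \<Longrightarrow> distinct ys \<Longrightarrow> set ys = set us \<Longrightarrow>
      distinct zs \<Longrightarrow> set zs = set us \<Longrightarrow> R xs ys \<Longrightarrow> R ys zs \<Longrightarrow> R xs zs"
  shows "R us vs"
proof -
  have "mset us = mset vs"
    using assms(1-3) by (metis set_eq_iff_mset_eq_distinct)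
  then have "adjacent_swap\<^sup>*\<^sup>* us vs"
    by (rule mset_eq_adjacent_swaps)
  then have "R us vs \<and> distinct vs \<and> set vs = set us"
  proof (induction rule: rtranclp_induct)
    case base
    then show ?case using refl assms(1) by simp
  next
    case (step ys zs)
    obtain u a b v where ys: "ys = u @ a # b # v" and zs: "zs = u @ b # a # v"
      using step(2) by (auto elim!: adjacent_swap.cases)
    have d: "distinct zs" "set zs = set us"
      using step ys zs by auto
    moreover have "R ys zs"
      unfolding ys zs by (rule swap) (use step ys in auto)
    ultimately show ?case
      using trans[of us ys zs] assms(1) step by simp
  qed
  then show ?thesis by simp
qed

section \<open>Koszul signs counted by inverted pairs\<close>

fun precedes :: "'h list \<Rightarrow> 'h \<Rightarrow> 'h \<Rightarrow> bool" where
  "precedes [] a b = False"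
| "precedes (x # xs) a b = (x = a \<and> b \<in> set xs \<or> precedes xs a b)"

lemma precedes_append:
  "precedes (us @ vs) a b \<longleftrightarrow> precedes us a b \<or> precedes vs a b \<or> a \<in> set us \<and> b \<in> set vs"
  by (induction us) auto

lemma precedes_in_set: "precedes us a b \<Longrightarrow> a \<in> set us \<and> b \<in> set us"
  by (induction us) auto

lemma precedes_asym: "distinct us \<Longrightarrow> precedes us a b \<Longrightarrow> \<not> precedes us b a"
  by (induction us) (auto dest: precedes_in_set)

lemma precedes_total: "a \<in> set us \<Longrightarrow> b \<in> set us \<Longrightarrow> a \<noteq> b \<Longrightarrow> precedes us a b \<or> precedes us b a"
  by (induction us) auto

lemma precedes_map:
  assumes "inj_on f (set us)" "a \<in> set us" "b \<in> set us"
  shows "precedes (map f us) (f a) (f b) \<longleftrightarrow> precedes us a b"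
  using assms
proof (induction us)
  case (Cons x xs)
  have "precedes (map f xs) (f a) (f b) \<longleftrightarrow> precedes xs a b"
  proof (cases "a \<in> set xs \<and> b \<in> set xs")
    case True
    then show ?thesis using Cons by auto
  next
    case False
    then have "\<not> precedes xs a b" by (auto dest: precedes_in_set)
    moreover have "f a \<notin> f ` set xs \<or> f b \<notin> f ` set xs"
      using False Cons.prems by (auto simp: inj_on_def)
    then have "\<not> precedes (map f xs) (f a) (f b)"
      by (auto dest: precedes_in_set)
    ultimately show ?thesis by simp
  qed
  moreover have "f x = f a \<longleftrightarrow> x = a" "f b \<in> f ` set xs \<longleftrightarrow> b \<in> set xs"
    using Cons.prems by (auto simp: inj_on_def)
  ultimately show ?case by auto
qed simp

lemma precedes_nth: "precedes us a b \<longleftrightarrow> (\<exists>s t. s < t \<and> t < length us \<and> us ! s = a \<and> us ! t = b)"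
proof (induction us)
  case (Cons x us)
  show ?case (is "_ \<longleftrightarrow> ?R")
  proof
    assume "precedes (x # us) a b"
    then consider "x = a" "b \<in> set us" | "precedes us a b" by auto
    then show ?R
    proof cases
      case 1
      then obtain t where "t < length us" "us ! t = b" by (auto simp: in_set_conv_nth)
      then show ?thesis using 1 by (intro exI[of _ 0] exI[of _ "Suc t"]) auto
    next
      case 2
      then obtain s t where "s < t" "t < length us" "us ! s = a" "us ! t = b"
        using Cons by auto
      then show ?thesis by (intro exI[of _ "Suc s"] exI[of _ "Suc t"]) auto
    qed
  next
    assume ?R
    then obtain s t where *: "s < t" "t < length (x # us)" "(x # us) ! s = a" "(x # us) ! t = b"
      by blast
    then obtain t' where t': "t = Suc t'" by (cases t) auto
    show "precedes (x # us) a b"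
    proof (cases s)
      case 0
      then show ?thesis using * t' by auto
    next
      case (Suc s')
      then show ?thesis using * t' Cons by auto
    qed
  qed
qed simp

definition two_subsets :: "'h set \<Rightarrow> 'h set set"
  where "two_subsets H = {S. S \<subseteq> H \<and> card S = 2}"

lemma finite_two_subsets: "finite H \<Longrightarrow> finite (two_subsets H)"
  by (auto simp: two_subsets_def intro: finite_subset[of _ "Pow H"])

definition inverted :: "'h list \<Rightarrow> 'h list \<Rightarrow> 'h set \<Rightarrow> bool"
  where "inverted us vs S \<longleftrightarrow> (\<exists>a b. S = {a, b} \<and> precedes us a b \<and> precedes vs b a)"

text \<open>
  The Koszul sign of passing from one enumeration of a finite set to another, where the elements
  carry parities \<open>p\<close>. No order on the set enters, unlike in \<^const>\<open>koszul_sign\<close>.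
\<close>

definition reorder_sign :: "('h \<Rightarrow> nat) \<Rightarrow> 'h list \<Rightarrow> 'h list \<Rightarrow> real"
  where "reorder_sign p us vs =
    (\<Prod>S\<in>two_subsets (set us). if inverted us vs S then (-1) ^ (\<Prod>a\<in>S. p a) else 1)"

lemma inverted_pair:
  assumes "distinct us" "distinct vs" "a \<noteq> b"
  shows "inverted us vs {a, b} \<longleftrightarrow> (precedes us a b \<and> precedes vs b a) \<or> (precedes us b a \<and> precedes vs a b)"
  using assms by (auto simp: inverted_def doubleton_eq_iff)

text \<open>A pair is inverted between the outer lists exactly when one and only one of the two
  steps inverts it, and a pair inverted twice contributes a square, which is 1.\<close>

lemma reorder_sign_trans:
  assumes "distinct us" "distinct vs" "distinct ws" "set us = set vs" "set vs = set ws"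
  shows "reorder_sign p us vs * reorder_sign p vs ws = reorder_sign p us ws"
proof -
  have "(if inverted us vs S then (-1) ^ (\<Prod>a\<in>S. p a) else 1) * (if inverted vs ws S then (-1) ^ (\<Prod>a\<in>S. p a) else 1)
     = (if inverted us ws S then (-1::real) ^ (\<Prod>a\<in>S. p a) else 1)" if S_in: "S \<in> two_subsets (set us)" for S
  proof -
    obtain a b where S: "S = {a, b}" "a \<noteq> b" and ab: "a \<in> set us" "b \<in> set us"
      using S_in by (auto simp: two_subsets_def card_2_iff)
    have "precedes us a b \<or> precedes us b a" "precedes vs a b \<or> precedes vs b a" "precedes ws a b \<or> precedes ws b a"
      by (rule precedes_total; use S(2) ab assms(4,5) in simp)+
    moreover have "\<not> (precedes us a b \<and> precedes us b a)" "\<not> (precedes vs a b \<and> precedes vs b a)"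
      "\<not> (precedes ws a b \<and> precedes ws b a)"
      using precedes_asym[OF assms(1), of a b] precedes_asym[OF assms(2), of a b]
        precedes_asym[OF assms(3), of a b] by simp_all
    ultimately have "inverted us ws S \<longleftrightarrow> (inverted us vs S \<noteq> inverted vs ws S)"
      unfolding S(1) inverted_pair[OF assms(1,2) S(2)] inverted_pair[OF assms(2,3) S(2)]
        inverted_pair[OF assms(1,3) S(2)] by argo
    moreover have "(-1::real) ^ (\<Prod>a\<in>S. p a) * (-1) ^ (\<Prod>a\<in>S. p a) = 1"
      by (simp flip: power_mult_distrib)
    ultimately show ?thesis by auto
  qed
  then show ?thesis
    unfolding reorder_sign_def using assms by (simp flip: prod.distrib)
qed

lemma reorder_sign_refl:
  assumes "distinct us"
  shows "reorder_sign p us us = 1"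
proof -
  have "\<not> inverted us us S" for S
    unfolding inverted_def using assms by (metis precedes_asym)
  then show ?thesis by (simp add: reorder_sign_def)
qed

lemma reorder_sign_square: "reorder_sign p us vs * reorder_sign p us vs = 1"
proof -
  have "reorder_sign p us vs * reorder_sign p us vs = (\<Prod>S\<in>two_subsets (set us). 1)"
    unfolding reorder_sign_def prod.distrib[symmetric]
    by (rule prod.cong) (auto simp flip: power_mult_distrib)
  then show ?thesis by simp
qed

lemma reorder_sign_commute:
  assumes "distinct us" "distinct vs" "set us = set vs"
  shows "reorder_sign p vs us = reorder_sign p us vs"
proof -
  have "reorder_sign p us vs * reorder_sign p vs us = 1"
    using reorder_sign_trans[of us vs us p] reorder_sign_refl assms by metis
  then show ?thesis
    by (metis mult.assoc mult.right_neutral mult.left_neutral reorder_sign_square)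
qed

lemma reorder_sign_cong:
  assumes "\<And>h. h \<in> set us \<Longrightarrow> p h = q h"
  shows "reorder_sign p us vs = reorder_sign q us vs"
proof -
  have "prod p S = prod q S" if "S \<in> two_subsets (set us)" for S
    using that assms by (intro prod.cong) (auto simp: two_subsets_def)
  then show ?thesis
    unfolding reorder_sign_def by (intro prod.cong) auto
qed

text \<open>Only pairs and their relative positions enter the sign, so it is natural under renaming;
  this becomes the isomorphism invariance of the graph value.\<close>

lemma reorder_sign_map:
  assumes inj: "inj_on f (set us)" and vs: "set vs = set us"
  shows "reorder_sign p (map f us) (map f vs) = reorder_sign (p \<circ> f) us vs"
proof -
  have bij: "bij_betw ((`) f) (two_subsets (set us)) (two_subsets (set (map f us)))"
    unfolding bij_betw_def
  proof
    show "inj_on ((`) f) (two_subsets (set us))"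
      by (rule inj_on_subset[OF inj_on_image_Pow[OF inj]]) (auto simp: two_subsets_def)
    have "card (f ` S) = card S" if "S \<subseteq> set us" for S
      by (rule card_image) (use inj that in \<open>auto intro: inj_on_subset\<close>)
    then show "(`) f ` two_subsets (set us) = two_subsets (set (map f us))"
      by (auto simp: two_subsets_def image_iff subset_image_iff)
  qed
  have inv: "inverted (map f us) (map f vs) (f ` S) \<longleftrightarrow> inverted us vs S" if S_in: "S \<in> two_subsets (set us)" for S
  proof -
    obtain a b where S: "S = {a, b}" "a \<noteq> b" and ab: "a \<in> set us" "b \<in> set us"
      using S_in by (auto simp: two_subsets_def card_2_iff)
    have *: "inverted (map f us) (map f vs) {f a, f b} \<longleftrightarrow> precedes (map f us) (f a) (f b) \<and> precedes (map f vs) (f b) (f a)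
         \<or> precedes (map f us) (f b) (f a) \<and> precedes (map f vs) (f a) (f b)"
      by (auto simp: inverted_def doubleton_eq_iff)
    have **: "inverted us vs {a, b} \<longleftrightarrow> precedes us a b \<and> precedes vs b a \<or> precedes us b a \<and> precedes vs a b"
      by (auto simp: inverted_def doubleton_eq_iff)
    have "inverted (map f us) (map f vs) {f a, f b} \<longleftrightarrow> inverted us vs {a, b}"
      unfolding * ** using inj vs ab by (simp add: precedes_map)
    then show ?thesis using S by simp
  qed
  have "prod p (f ` S) = prod (p \<circ> f) S" if "S \<in> two_subsets (set us)" for S
    using that inj by (intro prod.reindex) (auto simp: two_subsets_def intro: inj_on_subset)
  then show ?thesis
    unfolding reorder_sign_def prod.reindex_bij_betw[OF bij, symmetric]
    by (intro prod.cong) (auto simp: inv)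
qed

text \<open>An adjacent transposition inverts only the pair that it exchanges.\<close>

lemma reorder_sign_swap:
  assumes "distinct (u @ a # b # v)"
  shows "reorder_sign p (u @ a # b # v) (u @ b # a # v) = (-1) ^ (p a * p b)"
proof -
  let ?us = "u @ a # b # v" and ?vs = "u @ b # a # v"
  have inv: "inverted ?us ?vs S \<longleftrightarrow> S = {a, b}" if "S \<in> two_subsets (set ?us)" for S
  proof
    assume "inverted ?us ?vs S"
    then obtain x y where S: "S = {x, y}" and xy: "precedes ?us x y" "precedes ?vs y x"
      by (auto simp: inverted_def)
    show "S = {a, b}"
    proof (rule ccontr)
      assume "S \<noteq> {a, b}"
      then have "precedes ?vs x y"
        using xy(1) assms S by (auto simp: precedes_append dest: precedes_in_set)
      then show False
        using xy(2) assms precedes_asym[of ?vs x y] by auto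
    qed
  next
    show "S = {a, b} \<Longrightarrow> inverted ?us ?vs S"
      using assms by (auto simp: inverted_def precedes_append)
  qed
  have "{a, b} \<in> two_subsets (set ?us)"
    using assms by (auto simp: two_subsets_def)
  then have "{S \<in> two_subsets (set ?us). inverted ?us ?vs S} = {{a, b}}"
    using inv by blast
  moreover have "reorder_sign p ?us ?vs = (\<Prod>S\<in>{S \<in> two_subsets (set ?us). inverted ?us ?vs S}. (-1) ^ (\<Prod>a\<in>S. p a))"
    unfolding reorder_sign_def by (subst prod.inter_filter) (auto simp: finite_two_subsets)
  ultimately have "reorder_sign p ?us ?vs = (\<Prod>S\<in>{{a, b}}. (-1) ^ (\<Prod>a\<in>S. p a))"
    by simp
  also have "\<dots> = (-1) ^ (p a * p b)"
    using assms by simp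
  finally show ?thesis .
qed

text \<open>Pairs with an element outside the middle segment keep their relative position. The
  change of the middle is decomposed into adjacent swaps, each of which has the same sign with and
  without the context.\<close>

lemma reorder_sign_append:
  assumes "distinct (u @ x @ v)" "distinct y" "set x = set y"
  shows "reorder_sign p (u @ x @ v) (u @ y @ v) = reorder_sign p x y"
  using assms(1)
proof -
  have "distinct x" "distinct y" "set x = set y" using assms by auto
  then show ?thesis using assms(1)
  proof (induction rule: reorder_induct)
    case refl
    then show ?case by (simp add: reorder_sign_refl)
  next
    case (swap u' a b v')
    then show ?case
      using reorder_sign_swap[of "u @ u'" a b "v' @ v" p] reorder_sign_swap[of u' a b v' p]
      by auto
  next
    case (trans xs ys zs)
    have "reorder_sign p (u @ xs @ v) (u @ zs @ v)
       = reorder_sign p (u @ xs @ v) (u @ ys @ v) * reorder_sign p (u @ ys @ v) (u @ zs @ v)"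
      by (rule reorder_sign_trans[symmetric]) (use trans in auto)
    also have "\<dots> = reorder_sign p xs ys * reorder_sign p ys zs"
      using trans by auto
    also have "\<dots> = reorder_sign p xs zs"
      by (rule reorder_sign_trans) (use trans in auto)
    finally show ?case .
  qed
qed

lemma reorder_sign_move:
  assumes "distinct (u @ a # y @ v)"
  shows "reorder_sign p (u @ a # y @ v) (u @ y @ a # v) = (-1) ^ (p a * wpar p y)"
  using assms
proof (induction y arbitrary: u)
  case Nil
  then show ?case by (simp add: reorder_sign_refl wpar_def)
next
  case (Cons b y)
  have "reorder_sign p (u @ a # (b # y) @ v) (u @ (b # y) @ a # v)
     = reorder_sign p (u @ a # b # (y @ v)) (u @ b # a # (y @ v))
     * reorder_sign p (u @ b # a # y @ v) (u @ b # y @ a # v)"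
    by (subst reorder_sign_trans) (use Cons.prems in auto)
  also have "\<dots> = (-1) ^ (p a * p b) * (-1) ^ (p a * wpar p y)"
    using reorder_sign_swap[of u a b "y @ v" p] Cons.IH[of "u @ [b]"] Cons.prems by auto
  finally show ?case
    by (simp add: wpar_def distrib_left power_add)
qed

lemma reorder_sign_block_swap:
  assumes "distinct (u @ x @ y @ v)"
  shows "reorder_sign p (u @ x @ y @ v) (u @ y @ x @ v) = (-1) ^ (wpar p x * wpar p y)"
  using assms
proof (induction x arbitrary: v rule: rev_induct)
  case Nil
  then show ?case by (simp add: reorder_sign_refl wpar_def)
next
  case (snoc a x)
  have "reorder_sign p (u @ (x @ [a]) @ y @ v) (u @ y @ (x @ [a]) @ v)
     = reorder_sign p ((u @ x) @ a # y @ v) ((u @ x) @ y @ a # v)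
     * reorder_sign p (u @ x @ y @ (a # v)) (u @ y @ x @ (a # v))"
    by (simp, rule reorder_sign_trans[symmetric]) (use snoc.prems in auto)
  also have "\<dots> = (-1) ^ (p a * wpar p y) * (-1) ^ (wpar p x * wpar p y)"
    using reorder_sign_move[of "u @ x" a y v p] snoc.IH[of "a # v"] snoc.prems by auto
  finally show ?case
    by (simp add: wpar_def distrib_right power_add)
qed

text \<open>An inversion of \<open>js\<close>, given as a pair of positions, corresponds to the
  two-element set of its entries; the smaller entry comes first in the natural enumeration and
  second in \<open>js\<close>.\<close>

lemma koszul_sign_eq_reorder_sign:
  assumes "distinct js" "set js = {..<n}"
  shows "koszul_sign ps js = reorder_sign (\<lambda>i. ps ! i) [0..<n] js"
proof -
  let ?I = "{(s, t). s < t \<and> t < length js \<and> js ! t < js ! s}"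
  let ?D = "{S \<in> two_subsets (set [0..<n]). inverted [0..<n] js S}"
  let ?f = "\<lambda>(s, t). {js ! s, js ! t}"
  have upt: "precedes [0..<n] a b \<longleftrightarrow> a < b \<and> b < n" for a b
    by (auto simp: precedes_nth) (rule exI[of _ a], rule exI[of _ b], simp)
  have lt: "s < length js \<Longrightarrow> js ! s < n" for s
    using assms(2) nth_mem by blast
  have inj: "inj_on ?f ?I"
    using assms(1) by (auto simp: inj_on_def doubleton_eq_iff nth_eq_iff_index_eq)
  have "?f ` ?I = ?D"
  proof (intro equalityI subsetI)
    fix S assume "S \<in> ?f ` ?I"
    then obtain s t where st: "s < t" "t < length js" "js ! t < js ! s" "S = {js ! s, js ! t}"
      by auto
    have "precedes [0..<n] (js ! t) (js ! s)"
      unfolding upt using st lt[of s] by simp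
    moreover have "precedes js (js ! s) (js ! t)"
      using st by (auto simp: precedes_nth)
    ultimately have "inverted [0..<n] js S"
      unfolding inverted_def st(4) by blast
    moreover have "S \<in> two_subsets (set [0..<n])"
      using st lt[of s] lt[of t] by (auto simp: two_subsets_def)
    ultimately show "S \<in> ?D" by simp
  next
    fix S assume "S \<in> ?D"
    then obtain a b where S: "S = {a, b}" "a < b" and "precedes js b a"
      by (auto simp: inverted_def upt)
    then obtain s t where "s < t" "t < length js" "js ! s = b" "js ! t = a"
      by (auto simp: precedes_nth)
    then show "S \<in> ?f ` ?I"
      using S by (intro image_eqI[of _ _ "(s, t)"]) auto
  qed
  then have bij: "bij_betw ?f ?I ?D"
    using inj by (simp add: bij_betw_def)
  have "koszul_sign ps js = (\<Prod>S\<in>?D. (-1) ^ (\<Prod>a\<in>S. ps ! a))"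
    unfolding koszul_sign_def prod.reindex_bij_betw[OF bij, symmetric]
    using assms(1) by (intro prod.cong) auto
  also have "\<dots> = reorder_sign (\<lambda>i. ps ! i) [0..<n] js"
    unfolding reorder_sign_def
    by (subst prod.inter_filter) (auto simp: finite_two_subsets)
  finally show ?thesis .
qed

text \<open>
  The sign of \<open>e\<^sub>1 \<cdots> e\<^sub>r y\<^sub>1 \<cdots> y\<^sub>r \<mapsto> e\<^sub>1 y\<^sub>1 \<cdots> e\<^sub>r y\<^sub>r\<close>, where \<open>p\<close> and \<open>q\<close> are the parities of the
  \<open>e\<close>'s and the \<open>y\<close>'s.
\<close>

fun cross_sign :: "('h \<Rightarrow> nat) \<Rightarrow> ('h \<Rightarrow> nat) \<Rightarrow> 'h list \<Rightarrow> real" where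
  "cross_sign q p [] = 1"
| "cross_sign q p (h # us) = (-1) ^ (q h * wpar p us) * cross_sign q p us"

lemma wpar_append [simp]: "wpar p (us @ vs) = wpar p us + wpar p vs"
  by (simp add: wpar_def)

lemma wpar_Nil [simp]: "wpar p [] = 0"
  by (simp add: wpar_def)

lemma wpar_Cons [simp]: "wpar p (a # us) = p a + wpar p us"
  by (simp add: wpar_def)

lemma wpar_map [simp]: "wpar p (map f us) = wpar (p \<circ> f) us"
  by (simp add: wpar_def)

lemma cross_sign_append:
  "cross_sign q p (us @ vs) = cross_sign q p us * (-1) ^ (wpar q us * wpar p vs) * cross_sign q p vs"
  by (induction us) (auto simp: power_add distrib_left distrib_right)

lemma cross_sign_square: "cross_sign q p us * cross_sign q p us = 1"
proof (induction us)
  case (Cons a us)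
  have "cross_sign q p (a # us) * cross_sign q p (a # us)
      = ((-1) ^ (q a * wpar p us) * (-1) ^ (q a * wpar p us)) * (cross_sign q p us * cross_sign q p us)"
    by (simp only: cross_sign.simps mult_ac)
  then show ?case using Cons by (simp flip: power_mult_distrib)
qed simp

lemma neg_one_power_square: "(-1::real) ^ i * (-1) ^ i = 1"
  by (simp flip: power_mult_distrib)

text \<open>For adjacent letters, the product of p a + q a and p b + q b consists of the exponents
  for p and for q and of two mixed terms. The mixed terms are the change of
  \<open>cross_sign\<close> under the swap, and a general reordering is a chain of such
  swaps.\<close>

lemma reorder_sign_add:
  assumes "distinct us" "distinct vs" "set us = set vs"
  shows "reorder_sign (\<lambda>h. p h + q h) us vs =
    cross_sign q p us * cross_sign q p vs * reorder_sign p us vs * reorder_sign q us vs"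
  using assms
proof (induction rule: reorder_induct)
  case refl
  then show ?case using assms by (simp add: reorder_sign_refl cross_sign_square)
next
  case (swap u a b v)
  \<comment> \<open>\<open>c\<close> collects the factors of \<open>cross_sign\<close> that are the
    same before and after the swap; being a sign, it squares to 1.\<close>
  define c where "c = cross_sign q p u * (-1) ^ (wpar q u * wpar p (a # b # v)) * cross_sign q p v *
    (-1) ^ (q a * wpar p v) * (-1) ^ (q b * wpar p v)"
  have mult: "x * y * (x * y) = 1" if "x * x = 1" "y * y = 1" for x y :: real
  proof -
    have "x * y * (x * y) = (x * x) * (y * y)" by (simp only: mult_ac)
    then show ?thesis using that by simp
  qed
  have c: "c * c = 1"
    unfolding c_def by (intro mult cross_sign_square neg_one_power_square)
  have "cross_sign q p (u @ a # b # v) = c * (-1) ^ (q a * p b)"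
    by (simp add: cross_sign_append power_add distrib_left c_def)
  moreover have "cross_sign q p (u @ b # a # v) = c * (-1) ^ (q b * p a)"
    by (simp add: cross_sign_append power_add distrib_left c_def)
  ultimately have *: "cross_sign q p (u @ a # b # v) * cross_sign q p (u @ b # a # v)
     = (c * c) * ((-1) ^ (q a * p b) * (-1) ^ (q b * p a))"
    by (simp only: mult_ac)
  show ?case
    unfolding * c reorder_sign_swap[OF swap(1)]
    by (simp flip: power_add) (rule neg_one_power_cong, simp add: algebra_simps)
next
  case (trans xs ys zs)
  have "reorder_sign (\<lambda>h. p h + q h) xs zs = reorder_sign (\<lambda>h. p h + q h) xs ys * reorder_sign (\<lambda>h. p h + q h) ys zs"
    by (rule reorder_sign_trans[symmetric]) (use trans in auto)
  also have "\<dots> = cross_sign q p xs * cross_sign q p zs * (cross_sign q p ys * cross_sign q p ys) *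
      (reorder_sign p xs ys * reorder_sign p ys zs) * (reorder_sign q xs ys * reorder_sign q ys zs)"
    unfolding trans.IH by (simp only: mult_ac)
  also have "reorder_sign p xs ys * reorder_sign p ys zs = reorder_sign p xs zs"
    by (rule reorder_sign_trans) (use trans in auto)
  also have "reorder_sign q xs ys * reorder_sign q ys zs = reorder_sign q xs zs"
    by (rule reorder_sign_trans) (use trans in auto)
  finally show ?case by (simp add: cross_sign_square)
qed

section \<open>Contractions\<close>

text \<open>In closed form: the sum over s of \<open>k\<close> a_1 ... \<open>k\<close> a_(s-1)
  \<open>C\<close> a_s times \<open>G\<close> of the list without a_s. A letter standing in front is
  paired with each letter of the list, with one factor for every letter that is passed.\<close>

fun contract :: "('b \<Rightarrow> real) \<Rightarrow> ('b \<Rightarrow> real) \<Rightarrow> ('b list \<Rightarrow> real) \<Rightarrow> 'b list \<Rightarrow> real" where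
  "contract C k G [] = 0"
| "contract C k G (a # as) = C a * G as + k a * contract C k (\<lambda>as. G (a # as)) as"

text \<open>Only lists shorter than \<open>bs\<close> reach \<open>G\<close>, so a claim about
  \<open>G\<close> may be assumed inductively on the length.\<close>

lemma contract_cong:
  assumes "\<And>as. length as < length bs \<Longrightarrow> set as \<subseteq> set bs \<Longrightarrow> G as = H as"
    and "\<And>a. a \<in> set bs \<Longrightarrow> C a = D a" and "\<And>a. a \<in> set bs \<Longrightarrow> k a = l a"
  shows "contract C k G bs = contract D l H bs"
  using assms
proof (induction bs arbitrary: G H)
  case (Cons b bs)
  have "contract C k (\<lambda>as. G (b # as)) bs = contract D l (\<lambda>as. H (b # as)) bs"
  proof (rule Cons.IH)
    show "G (b # as) = H (b # as)" if "length as < length bs" "set as \<subseteq> set bs" for as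
      by (rule Cons.prems(1)) (use that in auto)
  qed (simp_all add: Cons.prems(2,3))
  moreover have "G bs = H bs" "C b = D b" "k b = l b"
    by (simp_all add: Cons.prems subset_insertI)
  ultimately show ?case by simp
qed simp

lemma contract_zero: "contract C k (\<lambda>_. 0) bs = 0"
  by (induction bs) auto

lemma contract_sum: "contract C k (\<lambda>as. \<Sum>i\<in>I. c i * G i as) bs = (\<Sum>i\<in>I. c i * contract C k (G i) bs)"
  by (induction bs arbitrary: G)
    (auto simp: sum_distrib_left sum.distrib algebra_simps)

lemma contract_mult: "contract C k (\<lambda>as. c * G as) bs = c * contract C k G bs"
  by (induction bs arbitrary: G) (auto simp: algebra_simps)

section \<open>Berezin integrals of Gaussian type\<close>

text \<open>The sign of moving a generator with index \<open>i\<close> from the front of an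
  increasing monomial to its place, past the generators of smaller index.\<close>

definition sign_below :: "nat set \<Rightarrow> nat \<Rightarrow> real"
  where "sign_below K i = (-1) ^ card {j \<in> K. j < i}"

lemma sign_below_insert:
  assumes "finite K" "i \<notin> K"
  shows "sign_below (insert i K) j = (if i < j then - sign_below K j else sign_below K j)"
proof (cases "i < j")
  case True
  then have "{l \<in> insert i K. l < j} = insert i {l \<in> K. l < j}" by auto
  then show ?thesis using assms True by (simp add: sign_below_def)
next
  case False
  then have "{l \<in> insert i K. l < j} = {l \<in> K. l < j}" by auto
  then show ?thesis using False by (simp add: sign_below_def)
qed

lemma sign_below_remove:
  assumes "finite K" "i \<in> K"
  shows "sign_below (K - {i}) j = (if i < j then - sign_below K j else sign_below K j)"
proof -
  have "sign_below K j = sign_below (insert i (K - {i})) j"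
    using assms by (simp add: insert_absorb)
  then show ?thesis
    using assms by (subst (asm) sign_below_insert) auto
qed

lemma sign_below_square: "sign_below K i * sign_below K i = 1"
  by (simp add: sign_below_def flip: power_mult_distrib)

lemma sign_below_Un:
  assumes "finite I" "finite J" "I \<inter> J = {}"
  shows "sign_below (I \<union> J) i = sign_below I i * sign_below J i"
proof -
  have "{j \<in> I \<union> J. j < i} = {j \<in> I. j < i} \<union> {j \<in> J. j < i}" by auto
  moreover have "card \<dots> = card {j \<in> I. j < i} + card {j \<in> J. j < i}"
    using assms by (intro card_Un_disjoint) auto
  ultimately show ?thesis by (simp add: sign_below_def power_add)
qed

text \<open>The type allows nonzero coefficients on infinite index sets, while every product
  vanishes there because \<open>Pow K\<close> is then infinite; multiplication by 1 is the identity
  only on these elements.\<close>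

definition gr_finitary :: "grassmann \<Rightarrow> bool"
  where "gr_finitary g \<longleftrightarrow> (\<forall>K. infinite K \<longrightarrow> g K = 0)"

definition gr_left :: "nat \<Rightarrow> grassmann \<Rightarrow> grassmann"
  where "gr_left i g = (\<lambda>K. if finite K \<and> i \<in> K then sign_below K i * g (K - {i}) else 0)"

definition gr_deriv :: "nat \<Rightarrow> grassmann \<Rightarrow> grassmann"
  where "gr_deriv i g = (\<lambda>K. if finite K \<and> i \<notin> K then sign_below K i * g (insert i K) else 0)"

lemma gr_left_anticommute: "gr_left i (gr_left j g) K = - gr_left j (gr_left i g) K"
proof (cases "finite K \<and> i \<in> K \<and> j \<in> K \<and> i \<noteq> j")
  case True
  then have "K - {i} - {j} = K - {j} - {i}" by auto
  with True show ?thesis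
    by (auto simp: gr_left_def sign_below_remove)
qed (auto simp: gr_left_def)

text \<open>The canonical anticommutation relation between multiplication by a generator and
  differentiation. For i = j exactly one of the two orders survives at a given index set, according
  to whether it contains the generator.\<close>

lemma gr_deriv_left:
  assumes "gr_finitary g"
  shows "gr_deriv i (gr_left j g) K = (if i = j then g K else 0) - gr_left j (gr_deriv i g) K"
proof (cases "finite K")
  case True
  show ?thesis
  proof (cases "i = j")
    case True
    with \<open>finite K\<close> show ?thesis
      by (cases "i \<in> K")
        (auto simp: gr_deriv_def gr_left_def sign_below_remove sign_below_insert insert_absorb
          sign_below_square simp flip: mult.assoc)
  next
    case False
    then have "insert i K - {j} = insert i (K - {j})" by auto
    with False \<open>finite K\<close> show ?thesis
      by (auto simp: gr_deriv_def gr_left_def sign_below_remove sign_below_insert)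
  qed
next
  case False
  then show ?thesis using assms by (simp add: gr_deriv_def gr_left_def gr_finitary_def)
qed

lemma gr_mul_infinite: "infinite K \<Longrightarrow> gr_mul f g K = 0"
  by (simp add: gr_mul_def finite_Pow_iff)

lemma gr_mul_sign:
  assumes "finite K" "I \<subseteq> K"
  shows "(-1) ^ card {(i, j). i \<in> I \<and> j \<in> K - I \<and> j < i} = (\<Prod>i\<in>I. sign_below (K - I) i)"
proof -
  have "{(i, j). i \<in> I \<and> j \<in> K - I \<and> j < i} = (SIGMA i:I. {j \<in> K - I. j < i})" by auto
  moreover have "finite I" using assms finite_subset by auto
  ultimately show ?thesis
    using assms by (simp add: sign_below_def power_sum)
qed

lemma gr_mul_finite:
  assumes "finite K"
  shows "gr_mul f g K = (\<Sum>I\<in>Pow K. (\<Prod>i\<in>I. sign_below (K - I) i) * f I * g (K - I))"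
  unfolding gr_mul_def by (rule sum.cong) (use assms in \<open>simp_all only: gr_mul_sign Pow_iff\<close>)

text \<open>Associativity with a generator on the left. Only the index sets containing
  \<open>i\<close> contribute to the left side; removing \<open>i\<close> from them matches the
  terms of the right side, and the sign splits between the two factors.\<close>

lemma gr_mul_left: "gr_mul (gr_left i f) g = gr_left i (gr_mul f g)"
proof
  fix K
  consider "infinite K" | "finite K" "i \<notin> K" | "finite K" "i \<in> K" by auto
  then show "gr_mul (gr_left i f) g K = gr_left i (gr_mul f g) K"
  proof cases
    case 1
    then show ?thesis by (simp add: gr_mul_infinite gr_left_def)
  next
    case 2
    then have "gr_mul (gr_left i f) g K = 0"
      unfolding gr_mul_finite[OF 2(1)] by (intro sum.neutral) (auto simp: gr_left_def)
    then show ?thesis using 2 by (simp add: gr_left_def)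
  next
    case 3
    let ?t = "\<lambda>I. (\<Prod>j\<in>I. sign_below (K - I) j) * gr_left i f I * g (K - I)"
    have "gr_mul (gr_left i f) g K = (\<Sum>I\<in>insert i ` Pow (K - {i}). ?t I)"
      unfolding gr_mul_finite[OF 3(1)]
    proof (rule sum.mono_neutral_right)
      show "\<forall>I\<in>Pow K - insert i ` Pow (K - {i}). ?t I = 0"
      proof
        fix I assume I: "I \<in> Pow K - insert i ` Pow (K - {i})"
        have "i \<notin> I"
        proof
          assume "i \<in> I"
          then have "I = insert i (I - {i})" "I - {i} \<in> Pow (K - {i})" using I by auto
          then show False using I by blast
        qed
        then show "?t I = 0" by (simp add: gr_left_def)
      qed
    qed (use 3 in auto)
    also have "\<dots> = (\<Sum>J\<in>Pow (K - {i}). ?t (insert i J))"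
      by (subst sum.reindex) (auto simp: inj_on_def)
    also have "\<dots> = (\<Sum>J\<in>Pow (K - {i}). sign_below K i *
        ((\<Prod>j\<in>J. sign_below (K - {i} - J) j) * f J * g (K - {i} - J)))"
    proof (rule sum.cong)
      fix J assume J: "J \<in> Pow (K - {i})"
      then have J': "finite J" "i \<notin> J" "J \<subseteq> K - {i}" using 3 finite_subset by auto
      have *: "K - insert i J = K - {i} - J" "insert i J - {i} = J" using J' by auto
      have K: "J \<union> (K - {i} - J) = K - {i}" using J' by auto
      \<comment> \<open>The generator passes the smaller indices of both factors, those in
        \<open>J\<close> and those in its complement.\<close>
      have "sign_below K i = sign_below (K - {i}) i"
        using 3 by (simp add: sign_below_remove)
      also have "\<dots> = sign_below J i * sign_below (K - {i} - J) i"
        using 3 J' sign_below_Un[of J "K - {i} - J" i] unfolding K by auto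
      finally show "?t (insert i J) = sign_below K i *
          ((\<Prod>j\<in>J. sign_below (K - {i} - J) j) * f J * g (K - {i} - J))"
        using J' by (simp add: * gr_left_def sign_below_insert mult_ac)
    qed simp
    also have "\<dots> = gr_left i (gr_mul f g) K"
      using 3 by (simp add: gr_left_def gr_mul_finite sum_distrib_left)
    finally show ?thesis .
  qed
qed

lemma gr_mul_const_left:
  "gr_finitary g \<Longrightarrow> gr_mul (gr_const r) g = (\<lambda>K. r * g K)"
proof
  fix K assume g: "gr_finitary g"
  show "gr_mul (gr_const r) g K = r * g K"
  proof (cases "finite K")
    case True
    have "gr_mul (gr_const r) g K = (\<Sum>I\<in>Pow K. if I = {} then r * g K else 0)"
      unfolding gr_mul_finite[OF True] by (rule sum.cong) (auto simp: gr_const_def)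
    then show ?thesis using True by simp
  qed (use g in \<open>auto simp: gr_mul_infinite gr_finitary_def\<close>)
qed

lemma gr_finitary_mul [simp]: "gr_finitary (gr_mul f g)"
  by (simp add: gr_finitary_def gr_mul_infinite)

lemma gr_finitary_const [simp]: "gr_finitary (gr_const r)"
  by (auto simp: gr_finitary_def gr_const_def)

lemma gr_finitary_left [simp]: "gr_finitary (gr_left i g)"
  by (auto simp: gr_finitary_def gr_left_def)

lemma gr_finitary_sum: "(\<And>a. a \<in> S \<Longrightarrow> gr_finitary (F a)) \<Longrightarrow> gr_finitary (\<lambda>K. \<Sum>a\<in>S. c a * F a K)"
  by (simp add: gr_finitary_def)

lemma gr_mul_sum_left: "gr_mul (\<lambda>K. \<Sum>a\<in>S. c a * F a K) g = (\<lambda>K. \<Sum>a\<in>S. c a * gr_mul (F a) g K)"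
  unfolding gr_mul_def
  by (rule ext, unfold sum_distrib_left sum_distrib_right, subst sum.swap) (simp add: mult_ac)

lemma gr_mul_sum_right: "gr_mul f (\<lambda>K. \<Sum>a\<in>S. c a * F a K) = (\<lambda>K. \<Sum>a\<in>S. c a * gr_mul f (F a) K)"
  unfolding gr_mul_def
  by (rule ext, unfold sum_distrib_left sum_distrib_right, subst sum.swap) (simp add: mult_ac)

lemma gr_mul_scale_left: "gr_mul (\<lambda>K. r * f K) g = (\<lambda>K. r * gr_mul f g K)"
  unfolding gr_mul_def by (simp add: sum_distrib_left mult_ac)

lemma gr_mul_scale_right: "gr_mul f (\<lambda>K. r * g K) = (\<lambda>K. r * gr_mul f g K)"
  unfolding gr_mul_def by (simp add: sum_distrib_left mult_ac)

lemma gr_left_sum: "gr_left i (\<lambda>K. \<Sum>a\<in>S. c a * F a K) = (\<lambda>K. \<Sum>a\<in>S. c a * gr_left i (F a) K)"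
  by (auto simp: gr_left_def fun_eq_iff sum_distrib_left mult_ac intro!: sum.cong)

lemma gr_left_scale: "gr_left i (\<lambda>K. r * g K) = (\<lambda>K. r * gr_left i g K)"
  by (auto simp: gr_left_def fun_eq_iff)

lemma gr_deriv_sum: "gr_deriv i (\<lambda>K. \<Sum>a\<in>S. c a * F a K) = (\<lambda>K. \<Sum>a\<in>S. c a * gr_deriv i (F a) K)"
  by (auto simp: gr_deriv_def fun_eq_iff sum_distrib_left mult_ac intro!: sum.cong)

section \<open>Linear and quadratic forms in the odd generators, and directional derivatives\<close>

definition gr_lin :: "nat set \<Rightarrow> (nat \<Rightarrow> real) \<Rightarrow> grassmann \<Rightarrow> grassmann"
  where "gr_lin J c g = (\<lambda>K. \<Sum>j\<in>J. c j * gr_left j g K)"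

definition gr_dir :: "nat set \<Rightarrow> (nat \<Rightarrow> real) \<Rightarrow> grassmann \<Rightarrow> grassmann"
  where "gr_dir J u g = (\<lambda>K. \<Sum>j\<in>J. u j * gr_deriv j g K)"

lemma gr_finitary_lin [simp]: "gr_finitary (gr_lin J c g)"
  unfolding gr_lin_def by (rule gr_finitary_sum) simp

lemma gr_lin_sum: "gr_lin J c (\<lambda>K. \<Sum>a\<in>S. d a * F a K) = (\<lambda>K. \<Sum>a\<in>S. d a * gr_lin J c (F a) K)"
  unfolding gr_lin_def gr_left_sum sum_distrib_left
  by (rule ext, subst sum.swap) (simp add: mult_ac)

lemma gr_lin_scale: "gr_lin J c (\<lambda>K. r * g K) = (\<lambda>K. r * gr_lin J c g K)"
  by (simp add: gr_lin_def gr_left_scale sum_distrib_left mult_ac)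

lemma gr_mul_lin: "gr_mul (gr_lin J c f) g = gr_lin J c (gr_mul f g)"
  unfolding gr_lin_def gr_mul_sum_left gr_mul_left ..

lemma gr_lin_anticommute: "gr_lin J c (gr_lin J d g) K = - gr_lin J d (gr_lin J c g) K"
proof -
  have "gr_lin J c (gr_lin J d g) K = (\<Sum>i\<in>J. \<Sum>j\<in>J. c i * (d j * gr_left i (gr_left j g) K))"
    by (simp add: gr_lin_def gr_left_sum sum_distrib_left)
  also have "\<dots> = (\<Sum>j\<in>J. \<Sum>i\<in>J. - (d j * (c i * gr_left j (gr_left i g) K)))"
    by (subst sum.swap, intro sum.cong refl) (subst gr_left_anticommute, simp)
  also have "\<dots> = - gr_lin J d (gr_lin J c g) K"
    by (simp add: gr_lin_def gr_left_sum sum_distrib_left sum_negf)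
  finally show ?thesis .
qed

lemma gr_dir_lin:
  assumes "finite J" "gr_finitary g"
  shows "gr_dir J u (gr_lin J c g) K = (\<Sum>j\<in>J. u j * c j) * g K - gr_lin J c (gr_dir J u g) K"
proof -
  have "gr_dir J u (gr_lin J c g) K
      = (\<Sum>i\<in>J. \<Sum>j\<in>J. u i * (c j * ((if i = j then g K else 0) - gr_left j (gr_deriv i g) K)))"
    by (simp add: gr_dir_def gr_lin_def gr_deriv_sum sum_distrib_left gr_deriv_left assms(2))
  also have "\<dots> = (\<Sum>i\<in>J. \<Sum>j\<in>J. u i * (c j * (if i = j then g K else 0)))
      - (\<Sum>i\<in>J. \<Sum>j\<in>J. u i * (c j * gr_left j (gr_deriv i g) K))"
    by (simp only: right_diff_distrib sum_subtractf)
  also have "(\<Sum>i\<in>J. \<Sum>j\<in>J. u i * (c j * (if i = j then g K else 0))) = (\<Sum>j\<in>J. u j * c j) * g K"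
    using assms(1) by (simp add: sum_distrib_right mult.assoc if_distrib[of "\<lambda>x. _ * x"] cong: if_cong)
  also have "(\<Sum>i\<in>J. \<Sum>j\<in>J. u i * (c j * gr_left j (gr_deriv i g) K)) = gr_lin J c (gr_dir J u g) K"
    by (subst sum.swap) (simp add: gr_lin_def gr_dir_def gr_left_sum sum_distrib_left mult_ac)
  finally show ?thesis .
qed

lemma gr_dir_top: "gr_dir J u g J = 0"
  by (simp add: gr_dir_def gr_deriv_def)

lemma gr_dir_const: "gr_dir J u (gr_const r) = (\<lambda>K. 0)"
  by (auto simp: gr_dir_def gr_deriv_def gr_const_def fun_eq_iff intro!: sum.neutral)

text \<open>Multiplication by the part of the exponent in the odd coordinates; the minus sign and
  the half are those of the Gaussian weight.\<close>

definition gr_quadratic :: "nat set \<Rightarrow> (nat \<Rightarrow> nat \<Rightarrow> real) \<Rightarrow> grassmann \<Rightarrow> grassmann"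
  where "gr_quadratic J b g = (\<lambda>K. \<Sum>i\<in>J. - (1 / 2) * gr_left i (gr_lin J (b i) g) K)"

lemma gr_finitary_quadratic [simp]: "gr_finitary (gr_quadratic J b g)"
  unfolding gr_quadratic_def by (rule gr_finitary_sum) simp

lemma gr_mul_quadratic: "gr_mul (gr_quadratic J b f) g = gr_quadratic J b (gr_mul f g)"
  unfolding gr_quadratic_def gr_mul_sum_left gr_mul_left gr_mul_lin ..

lemma gr_quadratic_scale: "gr_quadratic J b (\<lambda>K. r * g K) = (\<lambda>K. r * gr_quadratic J b g K)"
  unfolding gr_quadratic_def gr_lin_scale gr_left_scale by (simp add: sum_distrib_left mult_ac)

lemma gr_left_eq_lin:
  assumes "finite J" "i \<in> J"
  shows "gr_left i g = gr_lin J (\<lambda>j. if j = i then 1 else 0) g"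
  using assms by (auto simp: gr_lin_def fun_eq_iff if_distrib[of "\<lambda>x. x * _"] cong: if_cong)

text \<open>A quadratic form is even: a linear form anticommutes with each of its two factors, and
  the two signs cancel.\<close>

lemma gr_lin_quadratic: 
  assumes "finite J"
  shows "gr_lin J c (gr_quadratic J b g) = gr_quadratic J b (gr_lin J c g)"
proof
  fix K
  have swap: "gr_lin J c (gr_left i h) = (\<lambda>K. (-1) * gr_left i (gr_lin J c h) K)" if "i \<in> J" for i h
    unfolding gr_left_eq_lin[OF assms that] by (rule ext) (simp add: gr_lin_anticommute[of J c])
  have swap2: "gr_lin J c (gr_lin J d h) = (\<lambda>K. (-1) * gr_lin J d (gr_lin J c h) K)" for d h
    by (rule ext) (simp add: gr_lin_anticommute[of J c])
  have "gr_lin J c (gr_quadratic J b g) K = (\<Sum>i\<in>J. - (1 / 2) * gr_lin J c (gr_left i (gr_lin J (b i) g)) K)"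
    unfolding gr_quadratic_def gr_lin_sum ..
  also have "\<dots> = gr_quadratic J b (gr_lin J c g) K"
    unfolding gr_quadratic_def
  proof (rule sum.cong[OF refl])
    fix i assume i: "i \<in> J"
    show "- (1 / 2) * gr_lin J c (gr_left i (gr_lin J (b i) g)) K
        = - (1 / 2) * gr_left i (gr_lin J (b i) (gr_lin J c g)) K"
      unfolding swap[OF i] swap2 gr_left_scale by simp
  qed
  finally show "gr_lin J c (gr_quadratic J b g) K = gr_quadratic J b (gr_lin J c g) K" .
qed

text \<open>The derivative hits the first or the second factor. Each hit gives half of the linear
  form on the right, and skewness of \<open>b\<close> makes the two halves add up instead of
  cancelling.\<close>

lemma gr_dir_quadratic:
  assumes J: "finite J" and g: "gr_finitary g"
    and skew: "\<And>i j. i \<in> J \<Longrightarrow> j \<in> J \<Longrightarrow> b j i = - b i j"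
  shows "gr_dir J u (gr_quadratic J b g) K =
    gr_quadratic J b (gr_dir J u g) K - gr_lin J (\<lambda>j. \<Sum>i\<in>J. u i * b i j) g K"
proof -
  have dir: "gr_dir J u (gr_left i h) = (\<lambda>K. u i * h K - gr_left i (gr_dir J u h) K)"
    if "i \<in> J" "gr_finitary h" for i h
  proof
    fix K
    have "(\<Sum>j\<in>J. u j * (if j = i then 1 else 0)) = u i"
      using J that by (simp add: if_distrib[of "\<lambda>x. _ * x"] cong: if_cong)
    then show "gr_dir J u (gr_left i h) K = u i * h K - gr_left i (gr_dir J u h) K"
      using gr_dir_lin[OF J that(2)] by (simp add: gr_left_eq_lin[OF J that(1)])
  qed
  have lin: "gr_dir J u (gr_lin J c g) = (\<lambda>K. (\<Sum>j\<in>J. u j * c j) * g K - gr_lin J c (gr_dir J u g) K)" for c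
    using gr_dir_lin[OF J g] by (intro ext) simp
  have sub: "gr_left i (\<lambda>K. r * h K - h' K) K = r * gr_left i h K - gr_left i h' K" for i r h h' K
    by (simp add: gr_left_def algebra_simps)
  have split: "(\<Sum>i\<in>J. - (1 / 2) * (x i - (y i - z i)))
      = (\<Sum>i\<in>J. - (1 / 2) * z i) - (1 / 2) * (\<Sum>i\<in>J. x i) + (1 / 2) * (\<Sum>i\<in>J. y i)"
    for x y z :: "nat \<Rightarrow> real"
    unfolding sum_distrib_left sum_subtractf[symmetric] sum.distrib[symmetric]
    by (rule sum.cong) (simp_all add: algebra_simps)
  have "gr_dir J u (gr_quadratic J b g) K
     = (\<Sum>i\<in>J. - (1 / 2) * gr_dir J u (gr_left i (gr_lin J (b i) g)) K)"
    unfolding gr_quadratic_def gr_dir_def gr_deriv_sum sum_distrib_left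
    by (subst sum.swap) (simp add: mult_ac)
  also have "\<dots> = (\<Sum>i\<in>J. - (1 / 2) * (u i * gr_lin J (b i) g K
      - ((\<Sum>j\<in>J. u j * b i j) * gr_left i g K - gr_left i (gr_lin J (b i) (gr_dir J u g)) K)))"
    by (intro sum.cong refl) (simp only: dir gr_finitary_lin lin sub)
  also have "\<dots> = gr_quadratic J b (gr_dir J u g) K
     - (1 / 2) * (\<Sum>i\<in>J. u i * gr_lin J (b i) g K) + (1 / 2) * (\<Sum>i\<in>J. (\<Sum>j\<in>J. u j * b i j) * gr_left i g K)"
    unfolding gr_quadratic_def by (rule split)
  also have "(\<Sum>i\<in>J. u i * gr_lin J (b i) g K) = gr_lin J (\<lambda>j. \<Sum>i\<in>J. u i * b i j) g K"
    unfolding gr_lin_def sum_distrib_left sum_distrib_right by (subst sum.swap) (simp add: mult_ac)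
  also have "(\<Sum>i\<in>J. (\<Sum>j\<in>J. u j * b i j) * gr_left i g K) = - gr_lin J (\<lambda>j. \<Sum>i\<in>J. u i * b i j) g K"
    unfolding gr_lin_def sum_negf[symmetric]
  proof (rule sum.cong[OF refl])
    fix i assume i: "i \<in> J"
    have "(\<Sum>j\<in>J. u j * b i j) = (\<Sum>j\<in>J. - (u j * b j i))"
      by (rule sum.cong) (use skew[OF _ i] in simp_all)
    then show "(\<Sum>j\<in>J. u j * b i j) * gr_left i g K = - ((\<Sum>j\<in>J. u j * b j i) * gr_left i g K)"
      by (simp add: sum_negf)
  qed
  finally show ?thesis by simp
qed

section \<open>Degrees, nilpotency and the exponential of a quadratic form\<close>

definition gr_degree :: "nat set \<Rightarrow> nat \<Rightarrow> grassmann \<Rightarrow> bool"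
  where "gr_degree J d g \<longleftrightarrow> (\<forall>K. g K \<noteq> 0 \<longrightarrow> K \<subseteq> J \<and> card K = d)"

lemma gr_degree_left: "i \<in> J \<Longrightarrow> gr_degree J d g \<Longrightarrow> gr_degree J (Suc d) (gr_left i g)"
  unfolding gr_degree_def
proof (intro allI impI)
  fix K assume i: "i \<in> J" and g: "\<forall>K. g K \<noteq> 0 \<longrightarrow> K \<subseteq> J \<and> card K = d" and "gr_left i g K \<noteq> 0"
  then have K: "finite K" "i \<in> K" "g (K - {i}) \<noteq> 0"
    by (auto simp: gr_left_def split: if_splits)
  then have "K - {i} \<subseteq> J" "card (K - {i}) = d" using g by auto
  then show "K \<subseteq> J \<and> card K = Suc d"
    using K i card_Suc_Diff1[of K i] by auto
qed

lemma gr_degree_sum: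
  assumes "\<And>a. a \<in> S \<Longrightarrow> gr_degree J d (F a)"
  shows "gr_degree J d (\<lambda>K. \<Sum>a\<in>S. c a * F a K)"
  unfolding gr_degree_def
proof (intro allI impI)
  fix K assume "(\<Sum>a\<in>S. c a * F a K) \<noteq> 0"
  then obtain a where "a \<in> S" "c a * F a K \<noteq> 0"
    by (meson sum.neutral)
  then show "K \<subseteq> J \<and> card K = d"
    using assms[of a] by (auto simp: gr_degree_def)
qed

lemma gr_degree_lin: "gr_degree J d g \<Longrightarrow> gr_degree J (Suc d) (gr_lin J c g)"
  unfolding gr_lin_def by (rule gr_degree_sum) (rule gr_degree_left)

lemma gr_degree_quadratic: "gr_degree J d g \<Longrightarrow> gr_degree J (Suc (Suc d)) (gr_quadratic J b g)"
  unfolding gr_quadratic_def by (rule gr_degree_sum) (auto intro: gr_degree_left gr_degree_lin)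

lemma gr_degree_const: "gr_degree J 0 (gr_const r)"
  by (auto simp: gr_degree_def gr_const_def)

lemma gr_degree_top: "finite J \<Longrightarrow> gr_degree J d g \<Longrightarrow> card J < d \<Longrightarrow> g = (\<lambda>K. 0)"
  unfolding gr_degree_def by (rule ext) (metis card_mono not_le)

text \<open>Powers of the exponent become iterates of the operator \<open>gr_quadratic\<close> on 1,
  so the exponential can be differentiated by commutation rules for operators.\<close>

lemma gr_exp_quadratic:
  "gr_exp M (gr_quadratic J b (gr_const 1)) = (\<lambda>K. \<Sum>j\<le>M. 1 / fact j * (gr_quadratic J b ^^ j) (gr_const 1) K)"
proof -
  have "gr_prod (replicate j (gr_quadratic J b (gr_const 1))) = (gr_quadratic J b ^^ j) (gr_const 1)" for j
  proof (induction j)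
    case (Suc j)
    have fin: "gr_finitary ((gr_quadratic J b ^^ j) (gr_const 1))"
      by (cases j) auto
    show ?case using Suc fin by (simp add: gr_prod_def gr_mul_quadratic gr_mul_const_left)
  qed (simp add: gr_prod_def)
  then show ?thesis by (simp add: gr_exp_def fun_eq_iff)
qed

lemma gr_exp_quadratic_finitary: "gr_finitary (gr_exp M (gr_quadratic J b (gr_const 1)))"
  unfolding gr_exp_quadratic
proof (rule gr_finitary_sum)
  show "gr_finitary ((gr_quadratic J b ^^ j) (gr_const 1))" for j
    by (cases j) auto
qed

lemma gr_exp_quadratic_empty: "gr_exp M (gr_quadratic J b (gr_const 1)) {} = 1"
proof -
  have "(gr_quadratic J b ^^ j) (gr_const 1) {} = (if j = 0 then 1 else 0)" for j
    by (cases j) (auto simp: gr_const_def gr_quadratic_def gr_left_def)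
  then show ?thesis
    by (simp add: gr_exp_quadratic if_distrib[of "\<lambda>x. x / _"] cong: if_cong)
qed

lemma gr_dir_sum: "gr_dir J u (\<lambda>K. \<Sum>a\<in>S. d a * F a K) = (\<lambda>K. \<Sum>a\<in>S. d a * gr_dir J u (F a) K)"
  unfolding gr_dir_def gr_deriv_sum sum_distrib_left
  by (rule ext, subst sum.swap) (simp add: mult_ac)

text \<open>As for an ordinary exponential, the derivative of the term of index j + 1 is the term of
  index j times a linear form. The sum stops at \<open>M\<close>, so one term is missing on the
  right; it vanishes for degree reasons.\<close>

lemma gr_dir_exp:
  fixes b :: "nat \<Rightarrow> nat \<Rightarrow> real"
  assumes J: "finite J" "card J = M"
    and skew: "\<And>i j. i \<in> J \<Longrightarrow> j \<in> J \<Longrightarrow> b j i = - b i j"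
  defines "e \<equiv> gr_exp M (gr_quadratic J b (gr_const 1))"
  shows "gr_dir J u e = (\<lambda>K. - gr_lin J (\<lambda>j. \<Sum>i\<in>J. u i * b i j) e K)"
proof
  fix K
  let ?S = "gr_quadratic J b" and ?l = "gr_lin J (\<lambda>j. \<Sum>i\<in>J. u i * b i j)"
  let ?p = "\<lambda>j. (?S ^^ j) (gr_const 1)"
  have fin: "gr_finitary (?p j)" for j
    by (cases j) auto
  have comm: "?l (?p j) = (?S ^^ j) (?l (gr_const 1))" for j
    by (induction j) (simp_all add: gr_lin_quadratic[OF J(1)])
  have der: "gr_dir J u (?p (Suc j)) = (\<lambda>K. - real (Suc j) * ?l (?p j) K)" for j
  proof (induction j)
    case 0
    show ?case
      using gr_dir_quadratic[where b = b and u = u, OF J(1) fin[of 0] skew]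
      by (auto simp: gr_dir_const gr_quadratic_scale[of J b 0, simplified] fun_eq_iff)
  next
    case (Suc j)
    have "gr_dir J u (?p (Suc (Suc j))) = (\<lambda>K. ?S (gr_dir J u (?p (Suc j))) K - ?l (?p (Suc j)) K)"
      using gr_dir_quadratic[where b = b and u = u, OF J(1) fin[of "Suc j"] skew] by (auto simp: fun_eq_iff)
    also have "\<dots> = (\<lambda>K. - real (Suc j) * ?S (?l (?p j)) K - ?l (?p (Suc j)) K)"
      unfolding Suc gr_quadratic_scale ..
    also have "?S (?l (?p j)) = ?l (?p (Suc j))"
      by (simp add: gr_lin_quadratic[OF J(1)])
    finally show ?case by (simp add: algebra_simps)
  qed
  \<comment> \<open>The degree 2M + 1 exceeds the number M of generators.\<close>
  have top: "?l (?p M) = (\<lambda>K. 0)"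
  proof (rule gr_degree_top[OF J(1)])
    have "gr_degree J (2 * j) (?p j)" for j
      by (induction j) (auto intro: gr_degree_const gr_degree_quadratic)
    then show "gr_degree J (Suc (2 * M)) (?l (?p M))"
      by (rule gr_degree_lin)
  qed (use J in simp)
  have "gr_dir J u e K = (\<Sum>j\<le>M. 1 / fact j * gr_dir J u (?p j) K)"
    unfolding e_def gr_exp_quadratic gr_dir_sum ..
  also have "\<dots> = (\<Sum>j<M. 1 / fact (Suc j) * gr_dir J u (?p (Suc j)) K)"
    by (subst sum.atMost_shift) (simp add: gr_dir_const)
  also have "\<dots> = (\<Sum>j<M. - (1 / fact j * ?l (?p j) K))"
  proof (intro sum.cong refl)
    fix j
    have "1 / fact (Suc j) * real (Suc j) = (1 / fact j :: real)"
      by (simp del: of_nat_Suc)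
    then have "1 / fact (Suc j) * (- real (Suc j) * x) = - (1 / fact j * x)" for x :: real
      by (metis (no_types, lifting) mult.assoc mult_minus_left mult_minus_right)
    then show "1 / fact (Suc j) * gr_dir J u (?p (Suc j)) K = - (1 / fact j * ?l (?p j) K)"
      unfolding der by simp
  qed
  also have "\<dots> = - (\<Sum>j\<le>M. 1 / fact j * ?l (?p j) K)"
    by (simp add: sum_negf lessThan_Suc_atMost[symmetric] top)
  also have "\<dots> = - ?l e K"
    unfolding e_def gr_exp_quadratic gr_lin_sum ..
  finally show "gr_dir J u e K = - ?l e K" .
qed

text \<open>Moving a derivative through linear forms leaves one contraction per form, with
  alternating signs. A functional \<open>T\<close> is carried along because the induction step hands
  it on composed with multiplication by the first form; its hypothesis has the shape in which the
  anticommutation relation leaves its result.\<close>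

lemma gr_dir_foldr_lin:
  assumes J: "finite J" and h: "gr_finitary h"
    and T: "\<And>r g g'. T (\<lambda>K. r * g K - g' K) = r * T g - (T g' :: real)"
  shows "T (gr_dir J u (foldr (gr_lin J) cs h)) =
    contract (\<lambda>c. \<Sum>j\<in>J. u j * c j) (\<lambda>_. - 1) (\<lambda>as. T (foldr (gr_lin J) as h)) cs +
    (-1) ^ length cs * T (foldr (gr_lin J) cs (gr_dir J u h))"
  using T
proof (induction cs arbitrary: T)
  case (Cons c cs)
  have fin: "gr_finitary (foldr (gr_lin J) as h)" for as
    using h by (cases as) auto
  have lin: "gr_lin J c (\<lambda>K. r * g K - g' K) = (\<lambda>K. r * gr_lin J c g K - gr_lin J c g' K)" for r g g'
    by (auto simp: gr_lin_def gr_left_def fun_eq_iff algebra_simps sum_distrib_left sum_subtractf[symmetric]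
        intro!: sum.cong)
  have "T (gr_dir J u (foldr (gr_lin J) (c # cs) h))
     = T (\<lambda>K. (\<Sum>j\<in>J. u j * c j) * foldr (gr_lin J) cs h K - gr_lin J c (gr_dir J u (foldr (gr_lin J) cs h)) K)"
    by (intro arg_cong[of _ _ T] ext) (simp only: foldr.simps comp_apply gr_dir_lin[OF J fin])
  also have "\<dots> = (\<Sum>j\<in>J. u j * c j) * T (foldr (gr_lin J) cs h) - T (gr_lin J c (gr_dir J u (foldr (gr_lin J) cs h)))"
    by (rule Cons.prems)
  also have "T (gr_lin J c (gr_dir J u (foldr (gr_lin J) cs h))) =
    contract (\<lambda>c. \<Sum>j\<in>J. u j * c j) (\<lambda>_. - 1) (\<lambda>as. T (gr_lin J c (foldr (gr_lin J) as h))) cs +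
    (-1) ^ length cs * T (gr_lin J c (foldr (gr_lin J) cs (gr_dir J u h)))"
    by (rule Cons.IH) (simp add: lin Cons.prems)
  finally show ?case by simp
qed simp

section \<open>The Berezin integral as a top coefficient\<close>

definition berezin :: "nat set \<Rightarrow> grassmann \<Rightarrow> (nat \<Rightarrow> real) list \<Rightarrow> real"
  where "berezin J e cs = foldr (gr_lin J) cs e J"

text \<open>The top coefficient of a derivative vanishes: this is integration by parts.\<close>

lemma berezin_Cons:
  fixes b :: "nat \<Rightarrow> nat \<Rightarrow> real"
  assumes J: "finite J" "card J = M"
    and skew: "\<And>i j. i \<in> J \<Longrightarrow> j \<in> J \<Longrightarrow> b j i = - b i j"
    and u: "\<And>j. j \<in> J \<Longrightarrow> a j = (\<Sum>i\<in>J. u i * b i j)"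
  defines "e \<equiv> gr_exp M (gr_quadratic J b (gr_const 1))"
  shows "berezin J e (a # cs) = contract (\<lambda>c. \<Sum>j\<in>J. u j * c j) (\<lambda>_. - 1) (berezin J e) cs"
proof -
  let ?l = "gr_lin J (\<lambda>j. \<Sum>i\<in>J. u i * b i j)"
  have fin: "gr_finitary e" unfolding e_def by (rule gr_exp_quadratic_finitary)
  have a: "gr_lin J a = ?l"
    using u by (auto simp: gr_lin_def fun_eq_iff)
  \<comment> \<open>Brings the linear form produced by differentiating the exponential to the front,
    where it is the letter \<open>a\<close>; the sign cancels the one that the derivative collected
    on its way.\<close>
  have comm: "foldr (gr_lin J) cs (?l g) = (\<lambda>K. (-1) ^ length cs * ?l (foldr (gr_lin J) cs g) K)" for g
  proof (induction cs)
    case (Cons c cs)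
    have "foldr (gr_lin J) (c # cs) (?l g) = (\<lambda>K. (-1) ^ length cs * gr_lin J c (?l (foldr (gr_lin J) cs g)) K)"
      using Cons by (simp add: gr_lin_scale)
    then show ?case
      by (simp add: fun_eq_iff gr_lin_anticommute[of J c])
  qed simp
  have "0 = gr_dir J u (foldr (gr_lin J) cs e) J"
    by (simp add: gr_dir_top)
  also have "\<dots> = contract (\<lambda>c. \<Sum>j\<in>J. u j * c j) (\<lambda>_. - 1) (\<lambda>as. foldr (gr_lin J) as e J) cs +
      (-1) ^ length cs * foldr (gr_lin J) cs (gr_dir J u e) J"
    by (rule gr_dir_foldr_lin[OF J(1) fin]) simp
  also have "gr_dir J u e = (\<lambda>K. - 1 * ?l e K)"
    unfolding e_def by (subst gr_dir_exp[where b = b, OF J skew]) auto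
  also have "foldr (gr_lin J) cs (\<lambda>K. - 1 * ?l e K) = (\<lambda>K. - 1 * foldr (gr_lin J) cs (?l e) K)"
    by (induction cs) (simp_all only: foldr.simps id_apply comp_apply gr_lin_scale)
  also have "(-1) ^ length cs * (- 1 * foldr (gr_lin J) cs (?l e) J) = - berezin J e (a # cs)"
    by (simp add: comm berezin_def a flip: mult.assoc power_mult_distrib)
  finally show ?thesis
    unfolding berezin_def by linarith
qed

text \<open>If the integral without insertions were zero, the recursion of
  \<open>berezin_Cons\<close> would give zero for every list of linear forms. Inserting all
  generators, however, moves the constant coefficient 1 of the exponential to the top.\<close>

lemma berezin_Nil_nonzero:
  fixes b :: "nat \<Rightarrow> nat \<Rightarrow> real"
  assumes J: "finite J" "card J = M"
    and skew: "\<And>i j. i \<in> J \<Longrightarrow> j \<in> J \<Longrightarrow> b j i = - b i j"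
    and nondeg: "\<And>a. \<exists>u. \<forall>j\<in>J. a j = (\<Sum>i\<in>J. u i * b i j)"
  defines "e \<equiv> gr_exp M (gr_quadratic J b (gr_const 1))"
  shows "berezin J e [] \<noteq> 0"
proof
  assume zero: "berezin J e [] = 0"
  have all: "berezin J e cs = 0" for cs
  proof (induction "length cs" arbitrary: cs rule: less_induct)
    case less
    show ?case
    proof (cases cs)
      case Nil
      then show ?thesis using zero by simp
    next
      case (Cons a as)
      obtain u where u: "\<And>j. j \<in> J \<Longrightarrow> a j = (\<Sum>i\<in>J. u i * b i j)"
        using nondeg[of a] by blast
      have "berezin J e cs = contract (\<lambda>c. \<Sum>j\<in>J. u j * c j) (\<lambda>_. - 1) (berezin J e) as"
        unfolding Cons e_def by (rule berezin_Cons[where b = b, OF J skew u])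
      also have "\<dots> = contract (\<lambda>c. \<Sum>j\<in>J. u j * c j) (\<lambda>_. - 1) (\<lambda>_. 0) as"
        by (rule contract_cong) (use less Cons in auto)
      finally show ?thesis by (simp add: contract_zero)
    qed
  qed
  \<comment> \<open>Each generator adds its index to the index set, so up to sign the top
    coefficient of the product is the constant coefficient of \<open>g\<close>.\<close>
  have top: "\<bar>foldr gr_left js g (set js)\<bar> = \<bar>g {}\<bar>" if "distinct js" for js g
    using that
  proof (induction js)
    case (Cons j js)
    have "\<bar>sign_below K j\<bar> = 1" for K by (simp add: sign_below_def power_abs)
    then show ?case using Cons by (simp add: gr_left_def abs_mult)
  qed simp
  let ?js = "sorted_list_of_set J"
  have "foldr gr_left js g = foldr (gr_lin J) (map (\<lambda>i j. if j = i then 1 else 0) js) g" if "set js \<subseteq> J" for js g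
    using that by (induction js) (simp_all add: gr_left_eq_lin[OF J(1)])
  then have "berezin J e (map (\<lambda>i j. if j = i then 1 else 0) ?js) = foldr gr_left ?js e (set ?js)"
    using J(1) by (simp add: berezin_def)
  then have "\<bar>e {}\<bar> = 0"
    using top[of ?js e] all by simp
  then show False
    unfolding e_def by (simp add: gr_exp_quadratic_empty)
qed

section \<open>Wick rotated Gaussian integrals\<close>

text \<open>Besides the continuation and its value at the imaginary unit this records integrability,
  without which linear combinations of integrals could not be formed. The integral is real, hence
  the real part together with membership in the reals.\<close>

definition has_wick :: "nat \<Rightarrow> nat \<Rightarrow> ((nat \<Rightarrow> real) \<Rightarrow> real) \<Rightarrow> complex \<Rightarrow> bool"
  where "has_wick N k f z \<longleftrightarrow> (\<exists>g. g holomorphic_on (- {0}) \<and>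
    (\<forall>t>0. has_bochner_integral (\<Pi>\<^sub>M i\<in>{..<N}. lborel)
        (\<lambda>x. f x * exp (- ((\<Sum>i<k. (x i)\<^sup>2) + (\<Sum>i\<in>{k..<N}. (t * x i)\<^sup>2)) / 2)) (Re (g (complex_of_real t))) \<and>
      g (complex_of_real t) \<in> \<real>) \<and>
    z = g \<i>)"

text \<open>Two analytic continuations agree on the positive reals, which accumulate at 1 in the
  connected punctured plane, so they agree at the imaginary unit.\<close>

lemma wick_integral_eq:
  assumes "has_wick N k f z"
  shows "wick_integral N k f = z"
  unfolding wick_integral_def
proof (rule the_equality)
  obtain g where g: "g holomorphic_on (- {0})" "z = g \<i>" and
    t: "\<forall>t>0. has_bochner_integral (\<Pi>\<^sub>M i\<in>{..<N}. lborel)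
        (\<lambda>x. f x * exp (- ((\<Sum>i<k. (x i)\<^sup>2) + (\<Sum>i\<in>{k..<N}. (t * x i)\<^sup>2)) / 2)) (Re (g (complex_of_real t))) \<and>
      g (complex_of_real t) \<in> \<real>"
    using assms unfolding has_wick_def by blast
  have g_eq: "g (complex_of_real t) = complex_of_real
      (\<integral>x. f x * exp (- ((\<Sum>i<k. (x i)\<^sup>2) + (\<Sum>i\<in>{k..<N}. (t * x i)\<^sup>2)) / 2) \<partial>(\<Pi>\<^sub>M i\<in>{..<N}. lborel))"
    if "t > 0" for t
  proof -
    have "(\<integral>x. f x * exp (- ((\<Sum>i<k. (x i)\<^sup>2) + (\<Sum>i\<in>{k..<N}. (t * x i)\<^sup>2)) / 2) \<partial>(\<Pi>\<^sub>M i\<in>{..<N}. lborel))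
        = Re (g (complex_of_real t))"
      using t that by (blast intro: has_bochner_integral_integral_eq)
    then show ?thesis using t that by simp
  qed
  then show "\<exists>g. g holomorphic_on (- {0}) \<and>
     (\<forall>t>0. g (complex_of_real t) = complex_of_real
      (\<integral>x. f x * exp (- ((\<Sum>i<k. (x i)\<^sup>2) + (\<Sum>i\<in>{k..<N}. (t * x i)\<^sup>2)) / 2) \<partial>(\<Pi>\<^sub>M i\<in>{..<N}. lborel))) \<and>
     z = g \<i>"
    using g by blast
  fix z' assume "\<exists>g. g holomorphic_on (- {0}) \<and>
     (\<forall>t>0. g (complex_of_real t) = complex_of_real
      (\<integral>x. f x * exp (- ((\<Sum>i<k. (x i)\<^sup>2) + (\<Sum>i\<in>{k..<N}. (t * x i)\<^sup>2)) / 2) \<partial>(\<Pi>\<^sub>M i\<in>{..<N}. lborel))) \<and>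
     z' = g \<i>"
  then obtain g' where g': "g' holomorphic_on (- {0})" "z' = g' \<i>"
    and eq': "\<And>t. t > 0 \<Longrightarrow> g' (complex_of_real t) = complex_of_real
      (\<integral>x. f x * exp (- ((\<Sum>i<k. (x i)\<^sup>2) + (\<Sum>i\<in>{k..<N}. (t * x i)\<^sup>2)) / 2) \<partial>(\<Pi>\<^sub>M i\<in>{..<N}. lborel))"
    by blast
  let ?U = "complex_of_real ` {0<..}"
  have "(1::real) islimpt {0<..}"
    by (rule interior_limit_point) (simp add: interior_open)
  moreover have "(\<lambda>n. complex_of_real (1 + 1 / real (Suc n))) \<longlonglongrightarrow> complex_of_real (1 + 0)"
    by (intro tendsto_of_real tendsto_add tendsto_const LIMSEQ_inverse_real_of_nat[unfolded inverse_eq_divide])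
  then have lim: "(1::complex) islimpt ?U"
    unfolding islimpt_sequential
    by (intro exI[of _ "\<lambda>n. complex_of_real (1 + 1 / real (Suc n))"])
      (auto simp: add_pos_pos image_iff simp del: of_real_add of_real_divide of_nat_Suc
        intro!: exI[of _ "1 + 1 / real (Suc _)"])
  have "g' \<i> - g \<i> = 0"
  proof (rule analytic_continuation[where f = "\<lambda>w. g' w - g w" and S = "- {0}" and U = ?U and \<xi> = 1])
    show "(\<lambda>w. g' w - g w) holomorphic_on - {0}"
      by (intro holomorphic_intros g g')
    show "connected (- {0::complex})"
      by (rule connected_punctured_universe) simp
    show "g' w - g w = 0" if "w \<in> ?U" for w
      using that g_eq eq' by auto
  qed (use lim in auto)
  then show "z' = z" using g g' by simp
qed

lemma has_wick_sum:
  assumes "finite S" "\<And>a. a \<in> S \<Longrightarrow> has_wick N k (f a) (z a)"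
  shows "has_wick N k (\<lambda>x. \<Sum>a\<in>S. c a * f a x) (\<Sum>a\<in>S. complex_of_real (c a) * z a)"
proof -
  let ?e = "\<lambda>t x. exp (- ((\<Sum>i<k. (x i)\<^sup>2) + (\<Sum>i\<in>{k..<N}. (t * x i)\<^sup>2)) / 2)"
  have "\<forall>a\<in>S. \<exists>g. g holomorphic_on (- {0}) \<and>
    (\<forall>t>0. has_bochner_integral (\<Pi>\<^sub>M i\<in>{..<N}. lborel) (\<lambda>x. f a x * ?e t x) (Re (g (complex_of_real t))) \<and>
      g (complex_of_real t) \<in> \<real>) \<and> z a = g \<i>"
    using assms(2) unfolding has_wick_def by blast
  from bchoice[OF this] obtain g where G: "\<forall>a\<in>S. g a holomorphic_on (- {0}) \<and>
    (\<forall>t>0. has_bochner_integral (\<Pi>\<^sub>M i\<in>{..<N}. lborel) (\<lambda>x. f a x * ?e t x) (Re (g a (complex_of_real t))) \<and>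
      g a (complex_of_real t) \<in> \<real>) \<and> z a = g a \<i>" ..
  have g: "\<And>a. a \<in> S \<Longrightarrow> g a holomorphic_on (- {0})" "\<And>a. a \<in> S \<Longrightarrow> z a = g a \<i>"
    and t: "\<And>a t. a \<in> S \<Longrightarrow> t > 0 \<Longrightarrow> has_bochner_integral (\<Pi>\<^sub>M i\<in>{..<N}. lborel) (\<lambda>x. f a x * ?e t x) (Re (g a (complex_of_real t)))"
    and r: "\<And>a t. a \<in> S \<Longrightarrow> t > 0 \<Longrightarrow> g a (complex_of_real t) \<in> \<real>"
    using G by simp_all
  show ?thesis
    unfolding has_wick_def
  proof (intro exI[of _ "\<lambda>w. \<Sum>a\<in>S. complex_of_real (c a) * g a w"] conjI allI impI)
    show "(\<lambda>w. \<Sum>a\<in>S. complex_of_real (c a) * g a w) holomorphic_on - {0}"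
      by (intro holomorphic_intros g)
    show "(\<Sum>a\<in>S. complex_of_real (c a) * z a) = (\<Sum>a\<in>S. complex_of_real (c a) * g a \<i>)"
      using g by simp
    fix t :: real assume "t > 0"
    then have "has_bochner_integral (\<Pi>\<^sub>M i\<in>{..<N}. lborel) (\<lambda>x. \<Sum>a\<in>S. c a * (f a x * ?e t x))
        (\<Sum>a\<in>S. c a * Re (g a (complex_of_real t)))"
      by (intro has_bochner_integral_sum has_bochner_integral_mult_right t)
    then show "has_bochner_integral (\<Pi>\<^sub>M i\<in>{..<N}. lborel) (\<lambda>x. (\<Sum>a\<in>S. c a * f a x) * ?e t x)
        (Re (\<Sum>a\<in>S. complex_of_real (c a) * g a (complex_of_real t)))"
      by (simp add: sum_distrib_right mult.assoc)
    show "(\<Sum>a\<in>S. complex_of_real (c a) * g a (complex_of_real t)) \<in> \<real>"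
      using r \<open>t > 0\<close> by (intro sum_in_Reals Reals_mult) auto
  qed
qed

section \<open>Moments of the Gaussian weight and their Wick rotation\<close>

definition gauss_moment :: "nat \<Rightarrow> real"
  where "gauss_moment a = (if even a then fact a / (2 ^ (a div 2) * fact (a div 2)) else 0)"

lemma gauss_moment_0 [simp]: "gauss_moment 0 = 1"
  by (simp add: gauss_moment_def)

lemma gauss_moment_1 [simp]: "gauss_moment (Suc 0) = 0"
  by (simp add: gauss_moment_def)

text \<open>The moment of even order a is the product of the odd numbers up to a - 1, written with
  factorials; the next even order adds the factor a + 1. This is integration by parts against the
  Gaussian weight.\<close>

lemma gauss_moment_Suc_Suc: "gauss_moment (Suc (Suc a)) = real (Suc a) * gauss_moment a"
proof (cases "even a")
  case True
  then obtain j where j: "a = 2 * j" by (elim evenE)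
  have two: "real (Suc (Suc (2 * j))) = 2 * real (Suc j)" by simp
  have "gauss_moment (Suc (Suc a)) = real (Suc (Suc (2 * j))) * (real (Suc (2 * j)) * fact (2 * j)) / (2 * 2 ^ j * (real (Suc j) * fact j))"
    by (simp add: gauss_moment_def j del: of_nat_Suc)
  also have "\<dots> = real (Suc (2 * j)) * (fact (2 * j) / (2 ^ j * fact j))"
    unfolding two by (simp del: of_nat_Suc)
  finally show ?thesis
    by (simp add: gauss_moment_def j)
qed (simp add: gauss_moment_def)

lemma has_bochner_integral_gauss_moment:
  "has_bochner_integral lborel (\<lambda>x::real. x ^ a * exp (- x\<^sup>2 / 2)) (sqrt (2 * pi) * gauss_moment a)"
proof -
  have "has_bochner_integral lborel (\<lambda>x. std_normal_density x * x ^ a) (gauss_moment a)"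
  proof (cases "even a")
    case True
    then obtain j where "a = 2 * j" by (elim evenE)
    then show ?thesis using std_normal_moment_even[of j] by (simp add: gauss_moment_def)
  next
    case False
    then obtain j where "a = 2 * j + 1" by (elim oddE)
    then show ?thesis using std_normal_moment_odd[of j] by (simp add: gauss_moment_def)
  qed
  then have "has_bochner_integral lborel (\<lambda>x. sqrt (2 * pi) * (std_normal_density x * x ^ a)) (sqrt (2 * pi) * gauss_moment a)"
    by (rule has_bochner_integral_mult_right)
  then show ?thesis
    by (simp add: std_normal_density_def mult.commute)
qed

text \<open>Substituting t x leaves a pure negative power of t, a function with an evident
  continuation to the punctured plane.\<close>

lemma has_bochner_integral_gauss_moment_scaled:
  assumes "t > 0"
  shows "has_bochner_integral lborel (\<lambda>x::real. x ^ a * exp (- (t * x)\<^sup>2 / 2)) (sqrt (2 * pi) * gauss_moment a / t ^ Suc a)"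
proof -
  have "has_bochner_integral lborel (\<lambda>x. (0 + t * x) ^ a * exp (- (0 + t * x)\<^sup>2 / 2)) ((sqrt (2 * pi) * gauss_moment a) /\<^sub>R \<bar>t\<bar>)"
    using lborel_has_bochner_integral_real_affine_iff[of t "\<lambda>x. x ^ a * exp (- x\<^sup>2 / 2)" "sqrt (2 * pi) * gauss_moment a" 0]
      has_bochner_integral_gauss_moment[of a] assms by simp
  then have "has_bochner_integral lborel (\<lambda>x. inverse (t ^ a) * ((0 + t * x) ^ a * exp (- (0 + t * x)\<^sup>2 / 2)))
      (inverse (t ^ a) * ((sqrt (2 * pi) * gauss_moment a) /\<^sub>R \<bar>t\<bar>))"
    by (rule has_bochner_integral_mult_right)
  then show ?thesis
    using assms by (simp add: power_mult_distrib field_simps)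
qed

text \<open>The value of the integral of 1: each of the N - k negative directions contributes 1 / t
  at t equal to the imaginary unit.\<close>

definition wick_norm :: "nat \<Rightarrow> nat \<Rightarrow> complex"
  where "wick_norm N k = complex_of_real (sqrt (2 * pi)) ^ N / \<i> ^ (N - k)"

lemma wick_norm_nonzero: "wick_norm N k \<noteq> 0"
  by (simp add: wick_norm_def)

definition wick_eps :: "nat \<Rightarrow> nat \<Rightarrow> real"
  where "wick_eps k i = (if i < k then 1 else - 1)"

lemma wick_eps_square: "wick_eps k i * wick_eps k i = 1"
  by (simp add: wick_eps_def)

text \<open>The integral of a monomial divided by \<open>wick_norm\<close>. A negative direction
  with exponent a contributes the further factor \<open>1 / \<i> ^ a\<close>, which for even a is -1
  to the power a / 2; for odd a the factor \<open>gauss_moment\<close> is zero.\<close>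

definition wick_moment :: "nat \<Rightarrow> nat \<Rightarrow> nat list \<Rightarrow> real"
  where "wick_moment N k w = (\<Prod>i<N. gauss_moment (count_list w i) * wick_eps k i ^ (count_list w i div 2))"

lemma has_wick_monomial:
  assumes k: "k \<le> N"
  shows "has_wick N k (\<lambda>x. \<Prod>i<N. x i ^ a i)
    (wick_norm N k * complex_of_real (\<Prod>i<N. gauss_moment (a i) * wick_eps k i ^ (a i div 2)))"
proof -
  let ?c = "\<lambda>i. complex_of_real (sqrt (2 * pi) * gauss_moment (a i))"
  let ?g = "\<lambda>w. \<Prod>i<N. if i < k then ?c i else ?c i / w ^ Suc (a i)"
  interpret product_sigma_finite "\<lambda>_::nat. lborel :: real measure" ..
  show ?thesis
    unfolding has_wick_def
  proof (intro exI[of _ ?g] conjI allI impI)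
    show "?g holomorphic_on - {0}"
    proof (rule holomorphic_on_prod)
      fix i
      show "(\<lambda>w. if i < k then ?c i else ?c i / w ^ Suc (a i)) holomorphic_on - {0}"
        by (cases "i < k") (auto intro!: holomorphic_intros)
    qed
    show "wick_norm N k * complex_of_real (\<Prod>i<N. gauss_moment (a i) * wick_eps k i ^ (a i div 2)) = ?g \<i>"
    proof -
      have "?g \<i> = (\<Prod>i<N. (complex_of_real (sqrt (2 * pi)) * (if i < k then 1 else 1 / \<i>)) *
          complex_of_real (gauss_moment (a i) * wick_eps k i ^ (a i div 2)))"
      proof (rule prod.cong[OF refl])
        fix i
        show "(if i < k then ?c i else ?c i / \<i> ^ Suc (a i))
            = (complex_of_real (sqrt (2 * pi)) * (if i < k then 1 else 1 / \<i>)) *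
              complex_of_real (gauss_moment (a i) * wick_eps k i ^ (a i div 2))"
        proof (cases "even (a i)")
          case True
          then obtain j where j: "a i = 2 * j" by (elim evenE)
          have "\<i> ^ (2 * j) = (-1) ^ j" by (simp add: power_mult)
          then show ?thesis using j by (cases "even j") (simp_all add: wick_eps_def)
        qed (simp add: gauss_moment_def)
      qed
      also have "\<dots> = (\<Prod>i<N. complex_of_real (sqrt (2 * pi)) * (if i < k then 1 else 1 / \<i>)) *
          complex_of_real (\<Prod>i<N. gauss_moment (a i) * wick_eps k i ^ (a i div 2))"
        by (simp only: prod.distrib of_real_prod of_real_mult)
      also have "(\<Prod>i<N. complex_of_real (sqrt (2 * pi)) * (if i < k then 1 else 1 / \<i>)) = wick_norm N k"
      proof -
        have "(\<Prod>i<N. (if i < k then 1 else 1 / \<i>)) = (\<Prod>i\<in>{k..<N}. 1 / \<i>)"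
          by (rule prod.mono_neutral_cong_right) auto
        also have "\<dots> = 1 / \<i> ^ (N - k)"
          by (simp only: prod_constant card_atLeastLessThan power_one_over)
        finally have "(\<Prod>i<N. (if i < k then 1 else 1 / \<i>)) = 1 / \<i> ^ (N - k)" .
        then show ?thesis by (simp only: prod.distrib wick_norm_def) simp
      qed
      finally show ?thesis by simp
    qed
    fix t :: real assume t: "t > 0"
    let ?s = "\<lambda>i. if i < k then 1 else t"
    let ?h = "\<lambda>i y. y ^ a i * exp (- (?s i * y)\<^sup>2 / 2)"
    have one: "has_bochner_integral lborel (?h i) (sqrt (2 * pi) * gauss_moment (a i) / ?s i ^ Suc (a i))" for i
      using t by (intro has_bochner_integral_gauss_moment_scaled) auto
    \<comment> \<open>With scale 1 in the positive and t in the negative directions, the weight is a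
      product of functions of single variables, so the integral factorises.\<close>
    have exp: "(\<Prod>i<N. x i ^ a i) * exp (- ((\<Sum>i<k. (x i)\<^sup>2) + (\<Sum>i\<in>{k..<N}. (t * x i)\<^sup>2)) / 2) = (\<Prod>i<N. ?h i (x i))"
      for x :: "nat \<Rightarrow> real"
    proof -
      have "(\<Sum>i<k. (x i)\<^sup>2) + (\<Sum>i\<in>{k..<N}. (t * x i)\<^sup>2)
          = (\<Sum>i<k. (?s i * x i)\<^sup>2) + (\<Sum>i\<in>{k..<N}. (?s i * x i)\<^sup>2)"
        by (intro arg_cong2[of _ _ _ _ "(+)"] sum.cong) auto
      also have "\<dots> = (\<Sum>i\<in>{..<k} \<union> {k..<N}. (?s i * x i)\<^sup>2)"
        by (subst sum.union_disjoint) auto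
      also have "{..<k} \<union> {k..<N} = {..<N}" using k by auto
      finally have "- ((\<Sum>i<k. (x i)\<^sup>2) + (\<Sum>i\<in>{k..<N}. (t * x i)\<^sup>2)) / 2 = (\<Sum>i<N. - (?s i * x i)\<^sup>2 / 2)"
        by (simp add: sum_negf sum_divide_distrib)
      then show ?thesis by (simp only: exp_sum finite_lessThan prod.distrib)
    qed
    have "has_bochner_integral (\<Pi>\<^sub>M i\<in>{..<N}. lborel) (\<lambda>x. \<Prod>i<N. ?h i (x i))
        (\<Prod>i<N. sqrt (2 * pi) * gauss_moment (a i) / ?s i ^ Suc (a i))"
      unfolding has_bochner_integral_iff
    proof
      have int: "integrable lborel (?h i)" for i
        using one[of i] by (simp add: has_bochner_integral_iff)
      show "integrable (\<Pi>\<^sub>M i\<in>{..<N}. lborel) (\<lambda>x. \<Prod>i<N. ?h i (x i))"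
        by (rule product_integrable_prod) (use int in auto)
      show "(\<integral>x. (\<Prod>i<N. ?h i (x i)) \<partial>(\<Pi>\<^sub>M i\<in>{..<N}. lborel))
          = (\<Prod>i<N. sqrt (2 * pi) * gauss_moment (a i) / ?s i ^ Suc (a i))"
      proof (subst product_integral_prod)
        show "(\<Prod>i<N. integral\<^sup>L lborel (?h i)) = (\<Prod>i<N. sqrt (2 * pi) * gauss_moment (a i) / ?s i ^ Suc (a i))"
          by (rule prod.cong[OF refl]) (rule has_bochner_integral_integral_eq[OF one])
      qed (use int in auto)
    qed
    moreover have g: "?g (complex_of_real t)
        = complex_of_real (\<Prod>i<N. sqrt (2 * pi) * gauss_moment (a i) / ?s i ^ Suc (a i))"
      unfolding of_real_prod by (rule prod.cong) auto
    ultimately show "has_bochner_integral (\<Pi>\<^sub>M i\<in>{..<N}. lborel)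
        (\<lambda>x. (\<Prod>i<N. x i ^ a i) * exp (- ((\<Sum>i<k. (x i)\<^sup>2) + (\<Sum>i\<in>{k..<N}. (t * x i)\<^sup>2)) / 2))
        (Re (?g (complex_of_real t)))"
      unfolding exp by (simp only: Re_complex_of_real)
    show "?g (complex_of_real t) \<in> \<real>"
      unfolding g by (rule Reals_of_real)
  qed
qed

lemma prod_list_count:
  assumes "set w \<subseteq> I" "finite I"
  shows "prod_list (map x w) = (\<Prod>i\<in>I. (x i :: real) ^ count_list w i)"
  using assms(1)
proof (induction w)
  case (Cons j w)
  have "(\<Prod>i\<in>I. x i ^ count_list (j # w) i) = (\<Prod>i\<in>I. (if i = j then x i else 1) * x i ^ count_list w i)"
    by (rule prod.cong) auto
  also have "\<dots> = x j * (\<Prod>i\<in>I. x i ^ count_list w i)"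
    using Cons.prems assms(2) by (simp add: prod.distrib)
  finally show ?case using Cons by simp
qed simp

lemma has_wick_word:
  assumes "k \<le> N" "set w \<subseteq> {..<N}"
  shows "has_wick N k (\<lambda>x. prod_list (map x w)) (wick_norm N k * complex_of_real (wick_moment N k w))"
  using has_wick_monomial[OF assms(1), of "count_list w"] assms(2)
  by (simp add: prod_list_count[of w "{..<N}"] wick_moment_def)

text \<open>Every occurrence of \<open>i\<close> leaves the same multiset, so a symmetric
  \<open>G\<close> takes one value on all remainders and the contraction counts occurrences.\<close>

lemma contract_delta:
  assumes "\<And>v w. mset v = mset w \<Longrightarrow> G v = G w"
  shows "contract (\<lambda>a. if a = i then c else 0) (\<lambda>_. 1) G w = c * real (count_list w i) * G (remove1 i w)"
  using assms
proof (induction w arbitrary: G)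
  case (Cons a w)
  have IH: "contract (\<lambda>a. if a = i then c else 0) (\<lambda>_. 1) (\<lambda>w. G (a # w)) w
      = c * real (count_list w i) * G (a # remove1 i w)"
    by (rule Cons.IH) (simp add: Cons.prems)
  show ?case
  proof (cases "a = i \<and> i \<in> set w")
    case True
    then have "G (i # remove1 i w) = G w" by (intro Cons.prems) simp
    then show ?thesis using True IH by (simp add: algebra_simps)
  next
    case False
    then show ?thesis using IH by (auto simp: count_notin)
  qed
next
  case Nil
  show ?case by simp
qed

text \<open>The words \<open>i # w\<close> and \<open>remove1 i w\<close> differ by two occurrences
  of \<open>i\<close>: the Gaussian moment changes by the number of occurrences in \<open>w\<close>,
  and the power of \<open>wick_eps\<close> by one.\<close>

lemma wick_moment_Cons:
  assumes "i < N" "set w \<subseteq> {..<N}"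
  shows "wick_moment N k (i # w) = contract (\<lambda>a. if a = i then wick_eps k i else 0) (\<lambda>_. 1) (wick_moment N k) w"
proof -
  have inv: "wick_moment N k v = wick_moment N k w" if "mset v = mset w" for v w
    using that by (simp add: wick_moment_def flip: count_mset)
  let ?f = "\<lambda>w i. gauss_moment (count_list w i) * wick_eps k i ^ (count_list w i div 2)"
  have split: "wick_moment N k v = ?f v i * (\<Prod>j\<in>{..<N} - {i}. ?f v j)" for v
    unfolding wick_moment_def by (rule prod.remove) (use assms in auto)
  have rest: "(\<Prod>j\<in>{..<N} - {i}. ?f (i # w) j) = (\<Prod>j\<in>{..<N} - {i}. ?f (remove1 i w) j)"
  proof (rule prod.cong)
    fix j assume "j \<in> {..<N} - {i}"
    then have "count_list (i # w) j = count_list (remove1 i w) j"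
      by (simp flip: count_mset)
    then show "?f (i # w) j = ?f (remove1 i w) j" by simp
  qed simp
  have "?f (i # w) i = wick_eps k i * real (count_list w i) * ?f (remove1 i w) i"
  proof (cases "count_list w i")
    case (Suc c)
    have "count_list (remove1 i w) i = c"
      using Suc by (simp flip: count_mset)
    then show ?thesis
      by (simp add: Suc gauss_moment_Suc_Suc)
  qed simp
  then have "wick_moment N k (i # w) = wick_eps k i * real (count_list w i) * wick_moment N k (remove1 i w)"
    unfolding split[of "i # w"] split[of "remove1 i w"] rest by simp
  then show ?thesis
    by (simp only: contract_delta[OF inv])
qed

section \<open>From words of coordinates to products of linear forms\<close>

fun multilinear_ext :: "'i set \<Rightarrow> ('i list \<Rightarrow> real) \<Rightarrow> ('i \<Rightarrow> real) list \<Rightarrow> real" where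
  "multilinear_ext I G [] = G []"
| "multilinear_ext I G (l # ls) = (\<Sum>i\<in>I. l i * multilinear_ext I (\<lambda>w. G (i # w)) ls)"

lemma multilinear_ext_cong:
  assumes "\<And>w. set w \<subseteq> I \<Longrightarrow> G w = H w"
  shows "multilinear_ext I G ls = multilinear_ext I H ls"
  using assms
proof (induction ls arbitrary: G H)
  case Nil
  show ?case using Nil[of "[]"] by simp
next
  case (Cons l ls)
  have "multilinear_ext I (\<lambda>w. G (i # w)) ls = multilinear_ext I (\<lambda>w. H (i # w)) ls" if "i \<in> I" for i
    by (rule Cons.IH, rule Cons.prems) (use that in simp)
  then show ?case by simp
qed

lemma multilinear_ext_add:
  "multilinear_ext I (\<lambda>w. c * G w + H w) ls = c * multilinear_ext I G ls + multilinear_ext I H ls"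
  by (induction ls arbitrary: G H) (auto simp: sum.distrib sum_distrib_left algebra_simps)

lemma multilinear_ext_scale: "multilinear_ext I (\<lambda>w. c * G w) ls = c * multilinear_ext I G ls"
  by (induction ls arbitrary: G) (auto simp: sum_distrib_left algebra_simps)

lemma multilinear_ext_prod:
  "multilinear_ext I (\<lambda>w. c * prod_list (map x w)) ls = c * prod_list (map (\<lambda>l. \<Sum>i\<in>I. l i * x i) ls)"
proof (induction ls arbitrary: c)
  case (Cons l ls)
  have "multilinear_ext I (\<lambda>w. c * prod_list (map x w)) (l # ls)
     = (\<Sum>i\<in>I. l i * multilinear_ext I (\<lambda>w. (c * x i) * prod_list (map x w)) ls)"
    by (simp add: mult.assoc)
  then show ?case unfolding Cons by (simp add: sum_distrib_left sum_distrib_right mult_ac)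
qed simp

lemma has_wick_multilinear_ext:
  assumes "finite I" "\<And>w. set w \<subseteq> I \<Longrightarrow> has_wick N k (F w) (Z * complex_of_real (V w))"
  shows "has_wick N k (\<lambda>x. multilinear_ext I (\<lambda>w. F w x) ls) (Z * complex_of_real (multilinear_ext I V ls))"
  using assms(2)
proof (induction ls arbitrary: F V)
  case (Cons l ls)
  have "has_wick N k (\<lambda>x. \<Sum>i\<in>I. l i * multilinear_ext I (\<lambda>w. F (i # w) x) ls)
     (\<Sum>i\<in>I. complex_of_real (l i) * (Z * complex_of_real (multilinear_ext I (\<lambda>w. V (i # w)) ls)))"
    by (rule has_wick_sum[OF assms(1)], rule Cons.IH, rule Cons.prems) auto
  then show ?case by (simp add: sum_distrib_left mult_ac)
qed simp

text \<open>Both sides pair the vector \<open>u\<close> with one of the linear forms; on the right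
  the forms are expanded in coordinates before the pairing. This carries a recursion for coordinate
  words over to linear forms.\<close>

lemma contract_multilinear_ext:
  assumes "finite I"
  shows "contract (\<lambda>l. \<Sum>j\<in>I. u j * l j) (\<lambda>_. 1) (multilinear_ext I G) ls
    = (\<Sum>j\<in>I. u j * multilinear_ext I (contract (\<lambda>a. if a = j then 1 else 0) (\<lambda>_. 1) G) ls)"
proof (induction ls arbitrary: G)
  case (Cons l ls)
  let ?C = "contract (\<lambda>l. \<Sum>j\<in>I. u j * l j) (\<lambda>_. 1)"
  let ?D = "\<lambda>j. contract (\<lambda>a. if a = j then 1 else 0) (\<lambda>_. 1)"
  have "?C (multilinear_ext I G) (l # ls)
     = (\<Sum>j\<in>I. u j * l j) * multilinear_ext I G ls
     + ?C (\<lambda>ls. \<Sum>i\<in>I. l i * multilinear_ext I (\<lambda>w. G (i # w)) ls) ls"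
    by simp
  also have "?C (\<lambda>ls. \<Sum>i\<in>I. l i * multilinear_ext I (\<lambda>w. G (i # w)) ls) ls
     = (\<Sum>i\<in>I. \<Sum>j\<in>I. l i * (u j * multilinear_ext I (?D j (\<lambda>w. G (i # w))) ls))"
    unfolding contract_sum Cons sum_distrib_left ..
  also have "\<dots> = (\<Sum>j\<in>I. \<Sum>i\<in>I. u j * (l i * multilinear_ext I (?D j (\<lambda>w. G (i # w))) ls))"
    by (subst sum.swap) (simp add: mult_ac)
  finally have L: "?C (multilinear_ext I G) (l # ls) = (\<Sum>j\<in>I. u j * l j) * multilinear_ext I G ls
     + (\<Sum>j\<in>I. \<Sum>i\<in>I. u j * (l i * multilinear_ext I (?D j (\<lambda>w. G (i # w))) ls))" .
  have "multilinear_ext I (?D j G) (l # ls)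
     = l j * multilinear_ext I G ls + (\<Sum>i\<in>I. l i * multilinear_ext I (?D j (\<lambda>w. G (i # w))) ls)"
    if "j \<in> I" for j
  proof -
    have "multilinear_ext I (?D j G) (l # ls)
       = (\<Sum>i\<in>I. l i * ((if i = j then 1 else 0) * multilinear_ext I G ls
           + multilinear_ext I (?D j (\<lambda>w. G (i # w))) ls))"
      unfolding multilinear_ext.simps contract.simps
      by (simp only: mult_1 multilinear_ext_add)
    also have "\<dots> = (\<Sum>i\<in>I. l i * ((if i = j then 1 else 0) * multilinear_ext I G ls))
        + (\<Sum>i\<in>I. l i * multilinear_ext I (?D j (\<lambda>w. G (i # w))) ls)"
      by (simp only: distrib_left sum.distrib)
    also have "(\<Sum>i\<in>I. l i * ((if i = j then 1 else 0) * multilinear_ext I G ls)) = l j * multilinear_ext I G ls"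
      using assms that by (simp add: if_distrib[of "\<lambda>x. _ * (x * _)"] cong: if_cong)
    finally show ?thesis .
  qed
  then have "(\<Sum>j\<in>I. u j * multilinear_ext I (?D j G) (l # ls))
     = (\<Sum>j\<in>I. u j * (l j * multilinear_ext I G ls + (\<Sum>i\<in>I. l i * multilinear_ext I (?D j (\<lambda>w. G (i # w))) ls)))"
    by (intro sum.cong) simp_all
  then show ?case
    unfolding L by (simp add: distrib_left sum.distrib sum_distrib_left sum_distrib_right mult.assoc)
qed simp

text \<open>The hypothesis says that \<open>u\<close> represents \<open>l\<close> under the diagonal
  form with entries \<open>wick_eps\<close>, so evaluating another form at \<open>u\<close> is
  pairing it with \<open>l\<close> by the inverse form.\<close>

lemma wick_moment_ext_Cons:
  assumes "\<And>i. i < N \<Longrightarrow> l i = u i * wick_eps k i"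
  shows "multilinear_ext {..<N} (wick_moment N k) (l # ls)
    = contract (\<lambda>l. \<Sum>j<N. u j * l j) (\<lambda>_. 1) (multilinear_ext {..<N} (wick_moment N k)) ls"
  unfolding contract_multilinear_ext[OF finite_lessThan] multilinear_ext.simps
proof (rule sum.cong[OF refl])
  fix i assume i: "i \<in> {..<N}"
  have delta: "contract (\<lambda>a. if a = i then wick_eps k i else 0) (\<lambda>_. 1) (wick_moment N k) w
      = wick_eps k i * contract (\<lambda>a. if a = i then 1 else 0) (\<lambda>_. 1) (wick_moment N k) w" for w
  proof -
    have inv: "wick_moment N k v = wick_moment N k w" if "mset v = mset w" for v w
      using that by (simp add: wick_moment_def flip: count_mset)
    show ?thesis by (simp add: contract_delta[OF inv])
  qed
  have "multilinear_ext {..<N} (\<lambda>w. wick_moment N k (i # w)) ls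
     = multilinear_ext {..<N} (\<lambda>w. wick_eps k i * contract (\<lambda>a. if a = i then 1 else 0) (\<lambda>_. 1) (wick_moment N k) w) ls"
    by (rule multilinear_ext_cong) (use i in \<open>simp add: wick_moment_Cons delta\<close>)
  also have "\<dots> = wick_eps k i * multilinear_ext {..<N} (contract (\<lambda>a. if a = i then 1 else 0) (\<lambda>_. 1) (wick_moment N k)) ls"
    by (rule multilinear_ext_scale)
  finally show "l i * multilinear_ext {..<N} (\<lambda>w. wick_moment N k (i # w)) ls
     = u i * multilinear_ext {..<N} (contract (\<lambda>a. if a = i then 1 else 0) (\<lambda>_. 1) (wick_moment N k)) ls"
    using assms[of i] i wick_eps_square[of k i] by simp
qed

section \<open>Perfect matchings and Wick's theorem\<close>

text \<open>Chord diagrams over an arbitrary finite set of positions: removing a chord leaves gaps,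
  so the recursions do not stay within initial segments.\<close>

definition matchings :: "nat set \<Rightarrow> nat set set set"
  where "matchings H = {c. partition_on H c \<and> (\<forall>e\<in>c. card e = 2)}"

lemma chord_diagrams_eq_matchings: "chord_diagrams k = matchings {..<2 * k}"
  by (simp add: chord_diagrams_def matchings_def)

lemma matchings_empty: "matchings {} = {{}}"
  by (auto simp: matchings_def partition_on_def)

lemma finite_matchings: "finite H \<Longrightarrow> finite (matchings H)"
  by (rule finite_subset[of _ "Pow (Pow H)"]) (auto simp: matchings_def partition_on_def)

lemma matchings_insert:
  assumes "c \<in> matchings H" "h \<notin> H" "s \<notin> H" "h \<noteq> s"
  shows "insert {h, s} c \<in> matchings (insert h (insert s H))"
  using assms by (auto simp: matchings_def partition_on_def disjoint_def)

lemma matchings_remove: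
  assumes "c \<in> matchings H" "{h, s} \<in> c"
  shows "c - {{h, s}} \<in> matchings (H - {h, s})"
proof -
  have "\<Union> c = H" "disjoint c" "{} \<notin> c"
    using assms by (auto simp: matchings_def partition_on_def)
  moreover have "\<Union> (c - {{h, s}}) = H - {h, s}"
  proof -
    have "e \<inter> {h, s} = {}" if "e \<in> c - {{h, s}}" for e
      using disjointD[OF \<open>disjoint c\<close>, of e "{h, s}"] that assms(2) by simp
    then have "\<Union> (c - {{h, s}}) \<inter> {h, s} = {}" by auto
    moreover have "\<Union> c = \<Union> (c - {{h, s}}) \<union> {h, s}" using assms(2) by auto
    ultimately show ?thesis unfolding \<open>\<Union> c = H\<close> by simp
  qed
  ultimately show ?thesis
    using assms by (auto simp: matchings_def partition_on_def disjoint_def)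
qed

lemma matchings_partner:
  assumes "c \<in> matchings H" "h \<in> H"
  obtains s where "s \<in> H" "s \<noteq> h" "{h, s} \<in> c"
proof -
  obtain e where e: "e \<in> c" "h \<in> e" "card e = 2" "e \<subseteq> H"
    using assms by (auto simp: matchings_def partition_on_def)
  then obtain s where "e = {h, s}" "s \<noteq> h"
    by (auto simp: card_2_iff doubleton_eq_iff)
  then show ?thesis using that e by auto
qed

lemma matchings_partner_unique:
  assumes "c \<in> matchings H" "{h, s} \<in> c" "{h, t} \<in> c"
  shows "s = t"
proof -
  have "{h, s} = {h, t}"
    using assms disjointD[of c "{h, s}" "{h, t}"] by (auto simp: matchings_def partition_on_def)
  then show ?thesis by (auto simp: doubleton_eq_iff)
qed

text \<open>The chord split off is the one at the smallest position, which is also the head of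
  \<open>chord_list\<close>; facts about \<open>chord_list\<close> thus follow the recursion of a
  list.\<close>

lemma matchings_induct [consumes 2, case_names empty insert]:
  assumes "finite H" "c \<in> matchings H"
    and "R {} {}"
    and "\<And>h s H c. finite H \<Longrightarrow> c \<in> matchings H \<Longrightarrow> h < s \<Longrightarrow> \<forall>x\<in>H. h < x \<Longrightarrow> s \<notin> H \<Longrightarrow>
      R H c \<Longrightarrow> R (insert h (insert s H)) (insert {h, s} c)"
  shows "R H c"
  using assms(1,2)
proof (induction "card H" arbitrary: H c rule: less_induct)
  case less
  show ?case
  proof (cases "H = {}")
    case True
    then show ?thesis using less.prems assms(3) by (simp add: matchings_empty)
  next
    case False
    let ?h = "Min H"
    obtain s where s: "s \<in> H" "s \<noteq> ?h" "{?h, s} \<in> c"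
      using matchings_partner[OF less.prems(2), of ?h] less.prems(1) False by auto
    let ?H = "H - {?h, s}" and ?c = "c - {{?h, s}}"
    have c: "?c \<in> matchings ?H"
      using less.prems(2) s(3) by (rule matchings_remove)
    have "card ?H < card H"
      using less.prems(1) s(1) by (intro psubset_card_mono) auto
    then have "R ?H ?c"
      using less.prems(1) c by (intro less.hyps) auto
    moreover have "?h < s" "\<forall>x\<in>?H. ?h < x"
      using less.prems(1) s by (auto intro: order.not_eq_order_implies_strict[OF _ Min_le])
    ultimately have "R (insert ?h (insert s ?H)) (insert {?h, s} ?c)"
      using less.prems(1) c by (intro assms(4)) auto
    moreover have "insert ?h (insert s ?H) = H" "insert {?h, s} ?c = c"
      using Min_in[OF less.prems(1) False] s by auto
    ultimately show ?thesis by simp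
  qed
qed

lemma chord_list_empty [simp]: "chord_list {} = []"
  by (simp add: chord_list_def)

lemma chord_list_insert:
  assumes "finite H" "c \<in> matchings H" "h < s" "\<forall>x\<in>H. h < x" "s \<notin> H"
  shows "chord_list (insert {h, s} c) = h # s # chord_list c"
proof -
  let ?S = "\<lambda>c. {i. \<exists>j. i < j \<and> {i, j} \<in> c}" and ?j = "\<lambda>c i. THE j. i < j \<and> {i, j} \<in> (c :: nat set set)"
  have sub: "\<And>e. e \<in> c \<Longrightarrow> e \<subseteq> H" using assms(2) by (auto simp: matchings_def partition_on_def)
  have S: "?S (insert {h, s} c) = insert h (?S c)"
    using assms(3) by (auto simp: doubleton_eq_iff)
  have "?S c \<subseteq> H" using sub by blast
  then have fin: "finite (?S c)" and h: "\<forall>i\<in>?S c. h < i"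
    using assms finite_subset by auto
  have sort: "sorted_list_of_set (insert h (?S c)) = h # sorted_list_of_set (?S c)"
    using fin h by (subst sorted_list_of_set_insert) (auto intro!: insort_is_Cons less_imp_le)
  have jh: "?j (insert {h, s} c) h = s"
    using assms sub by (intro the_equality) (auto simp: doubleton_eq_iff)
  have j: "?j (insert {h, s} c) i = ?j c i" if "i \<in> ?S c" for i
  proof -
    have "i \<in> H" "i \<noteq> h" using that \<open>?S c \<subseteq> H\<close> h by auto
    then have "{i, j} \<noteq> {h, s}" for j using assms(5) by (auto simp: doubleton_eq_iff)
    then show ?thesis by simp
  qed
  have "map (\<lambda>i. [i, ?j (insert {h, s} c) i]) (sorted_list_of_set (?S c))
      = map (\<lambda>i. [i, ?j c i]) (sorted_list_of_set (?S c))"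
    by (rule map_cong[OF refl], unfold set_sorted_list_of_set[OF fin]) (simp only: j)
  then show ?thesis
    unfolding chord_list_def S sort list.map concat.simps jh by (simp only: append_Cons append_Nil)
qed

lemma chord_list_distinct:
  assumes "finite H" "c \<in> matchings H"
  shows "distinct (chord_list c) \<and> set (chord_list c) = H"
  using assms
proof (induction rule: matchings_induct)
  case (insert h s H c)
  then show ?case by (subst (1 2) chord_list_insert) auto
qed simp

lemma matchings_card:
  assumes "finite H" "c \<in> matchings H"
  shows "even (card H)"
  using assms by (induction rule: matchings_induct) auto

text \<open>Matchings are sorted by the partner of the smallest position; for a given partner,
  deleting its chord is a bijection onto the matchings of the remaining positions.\<close>

lemma sum_matchings:
  assumes "finite H" "H \<noteq> {}"
  shows "(\<Sum>c\<in>matchings H. f c) =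
    (\<Sum>s\<in>H - {Min H}. \<Sum>c\<in>matchings (H - {Min H, s}). (f (insert {Min H, s} c) :: real))"
proof -
  let ?h = "Min H"
  have h: "?h \<in> H" using assms by simp
  let ?D = "SIGMA s:H - {?h}. matchings (H - {?h, s})" and ?f = "\<lambda>(s, c). insert {?h, s} c"
  have notin: "{?h, t} \<notin> c" if "c \<in> matchings (H - {?h, s})" for s t c
    using that by (auto simp: matchings_def partition_on_def)
  have "inj_on ?f ?D"
  proof (rule inj_onI)
    fix a b assume "a \<in> ?D" "b \<in> ?D" and f: "?f a = ?f b"
    then obtain s c s' c' where ab: "a = (s, c)" "b = (s', c')"
      and *: "s \<in> H" "s \<noteq> ?h" "c \<in> matchings (H - {?h, s})" "s' \<in> H" "s' \<noteq> ?h" "c' \<in> matchings (H - {?h, s'})"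
      by auto
    have eq: "insert {?h, s} c = insert {?h, s'} c'" using f ab by simp
    have "{?h, s'} \<in> insert {?h, s} c" using eq by simp
    then have "{?h, s'} = {?h, s}" using notin[OF *(3)] by auto
    then have "s = s'" by (auto simp: doubleton_eq_iff)
    moreover have "c = c'"
      using eq notin[OF *(3)] notin[OF *(6)] \<open>s = s'\<close> by (metis insert_ident)
    ultimately show "a = b" using ab by simp
  qed
  moreover have "?f ` ?D = matchings H"
  proof (intro equalityI subsetI)
    fix c assume "c \<in> ?f ` ?D"
    then obtain s c' where "s \<in> H" "s \<noteq> ?h" "c' \<in> matchings (H - {?h, s})" "c = insert {?h, s} c'"
      by auto
    then have "c \<in> matchings (insert ?h (insert s (H - {?h, s})))"
      by (auto intro!: matchings_insert)
    also have "insert ?h (insert s (H - {?h, s})) = H" using h \<open>s \<in> H\<close> by auto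
    finally show "c \<in> matchings H" .
  next
    fix c assume c: "c \<in> matchings H"
    then obtain s where s: "s \<in> H" "s \<noteq> ?h" "{?h, s} \<in> c"
      using matchings_partner h by metis
    then show "c \<in> ?f ` ?D"
      using matchings_remove[OF c s(3)] by (intro image_eqI[of _ _ "(s, c - {{?h, s}})"]) auto
  qed
  ultimately have "(\<Sum>c\<in>matchings H. f c) = (\<Sum>x\<in>?D. f (?f x))"
    using sum.reindex[of ?f ?D f] by simp
  also have "\<dots> = (\<Sum>s\<in>H - {?h}. \<Sum>c\<in>matchings (H - {?h, s}). f (insert {?h, s} c))"
    using assms by (subst sum.Sigma) (auto simp: finite_matchings case_prod_unfold)
  finally show ?thesis .
qed

section \<open>Wick's theorem for letters with parities\<close>

definition wick_term :: "('u \<Rightarrow> nat) \<Rightarrow> ('u \<Rightarrow> 'u \<Rightarrow> real) \<Rightarrow> (nat \<Rightarrow> 'u) \<Rightarrow> nat set \<Rightarrow> nat set set \<Rightarrow> real"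
  where "wick_term p C x H c =
    reorder_sign (\<lambda>h. p (x h)) (sorted_list_of_set H) (chord_list c) * (\<Prod>e\<in>c. C (x (Min e)) (x (Max e)))"

lemma beta_eq_wick_term:
  assumes "c \<in> chord_diagrams k" "length xs = 2 * k"
  shows "beta c p C xs = wick_term p C (\<lambda>i. xs ! i) {..<2 * k} c"
proof -
  have c: "distinct (chord_list c)" "set (chord_list c) = {..<2 * k}"
    using chord_list_distinct[of "{..<2 * k}" c] assms by (auto simp: chord_diagrams_eq_matchings)
  have "koszul_sign (map p xs) (chord_list c) = reorder_sign (\<lambda>i. map p xs ! i) [0..<2 * k] (chord_list c)"
    using c by (rule koszul_sign_eq_reorder_sign)
  also have "\<dots> = reorder_sign (\<lambda>i. p (xs ! i)) [0..<2 * k] (chord_list c)"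
    using assms by (intro reorder_sign_cong) auto
  finally show ?thesis
    by (simp add: beta_def wick_term_def sorted_list_of_set_lessThan_Suc lessThan_atLeast0)
qed

lemma contract_map:
  assumes "distinct us"
  shows "contract C (\<lambda>b. (-1) ^ (i * p b)) G (map x us) =
    (\<Sum>s\<in>set us. (-1) ^ (i * wpar (\<lambda>h. p (x h)) (takeWhile (\<lambda>t. t \<noteq> s) us)) * C (x s) * G (map x (remove1 s us)))"
  using assms
proof (induction us arbitrary: G)
  case (Cons a us)
  have "contract C (\<lambda>b. (-1) ^ (i * p b)) (\<lambda>as. G (x a # as)) (map x us)
    = (\<Sum>s\<in>set us. (-1) ^ (i * wpar (\<lambda>h. p (x h)) (takeWhile (\<lambda>t. t \<noteq> s) us)) * C (x s) * G (x a # map x (remove1 s us)))"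
    using Cons by simp
  moreover have "(-1) ^ (i * p (x a)) * \<dots> = (\<Sum>s\<in>set us. (-1) ^ (i * wpar (\<lambda>h. p (x h)) (takeWhile (\<lambda>t. t \<noteq> s) (a # us))) * C (x s)
      * G (map x (remove1 s (a # us))))"
    unfolding sum_distrib_left
    by (rule sum.cong) (use Cons.prems in \<open>auto simp: power_add distrib_left\<close>)
  ultimately show ?case
    using Cons.prems by simp
qed simp

text \<open>The recursion pairs the first letter with each later one, which is the choice of the
  partner of the smallest position. Its sign is that of moving the first letter to its partner,
  while the chord list moves the partner to the first letter. The two agree because a nonzero
  pairing forces equal parities.\<close>

theorem wick_theorem:
  assumes H: "finite H" and x: "\<And>h. h \<in> H \<Longrightarrow> x h \<in> U"
    and Nil: "G [] = 1"
    and Cons: "\<And>a as. a \<in> U \<Longrightarrow> set as \<subseteq> U \<Longrightarrow> G (a # as) = contract (C a) (\<lambda>b. (-1) ^ (p a * p b)) G as"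
    and even: "\<And>a b. a \<in> U \<Longrightarrow> b \<in> U \<Longrightarrow> C a b \<noteq> 0 \<Longrightarrow> even (p a + p b)"
  shows "G (map x (sorted_list_of_set H)) = (\<Sum>c\<in>matchings H. wick_term p C x H c)"
  using H x
proof (induction "card H" arbitrary: H rule: less_induct)
  case less
  note fin = less.prems(1)
  show ?case
  proof (cases "H = {}")
    case True
    then show ?thesis by (simp add: matchings_empty wick_term_def Nil reorder_sign_refl)
  next
    case False
    let ?h = "Min H" and ?rest = "sorted_list_of_set (H - {Min H})"
    have h: "?h \<in> H" using fin False by simp
    have sort: "sorted_list_of_set H = ?h # ?rest"
      using fin False by (rule sorted_list_of_set_nonempty)
    have rest: "distinct ?rest" "set ?rest = H - {?h}"
      using fin by auto
    have "G (map x (sorted_list_of_set H)) = contract (C (x ?h)) (\<lambda>b. (-1) ^ (p (x ?h) * p b)) G (map x ?rest)"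
      unfolding sort list.map by (rule Cons) (use less.prems(2) h rest(2) in auto)
    also have "\<dots> = (\<Sum>s\<in>H - {?h}. (-1) ^ (p (x ?h) * wpar (\<lambda>h. p (x h)) (takeWhile (\<lambda>t. t \<noteq> s) ?rest)) *
        C (x ?h) (x s) * G (map x (remove1 s ?rest)))"
      unfolding contract_map[OF rest(1)] rest(2) ..
    also have "\<dots> = (\<Sum>s\<in>H - {?h}. \<Sum>c\<in>matchings (H - {?h, s}). wick_term p C x H (insert {?h, s} c))"
    proof (rule sum.cong[OF refl])
      fix s assume s: "s \<in> H - {?h}"
      let ?H = "H - {?h, s}"
      let ?sg = "(-1) ^ (p (x ?h) * wpar (\<lambda>h. p (x h)) (takeWhile (\<lambda>t. t \<noteq> s) ?rest)) :: real"
      have rem: "remove1 s ?rest = sorted_list_of_set ?H"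
        using fin by (simp add: sorted_list_of_set_remove[symmetric] insert_commute Diff_insert2[symmetric] Diff_insert[symmetric])
      have "card ?H < card H"
        using fin h by (intro psubset_card_mono) auto
      then have IH: "G (map x (sorted_list_of_set ?H)) = (\<Sum>c\<in>matchings ?H. wick_term p C x ?H c)"
        using less.prems by (intro less.hyps) auto
      have "wick_term p C x H (insert {?h, s} c) = ?sg * C (x ?h) (x s) * wick_term p C x ?H c"
        if c: "c \<in> matchings ?H" for c
      \<comment> \<open>A vanishing pairing makes both sides zero; in the other case the parities of
        the two ends agree.\<close>
      proof (cases "C (x ?h) (x s) = 0")
        case zero: True
        have "finite (insert {?h, s} c)"
          using c fin by (auto simp: matchings_def intro: finite_elements)
        moreover have "?h < s" using s fin by (auto intro: order.not_eq_order_implies_strict[OF _ Min_le])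
        ultimately have "(\<Prod>e\<in>insert {?h, s} c. C (x (Min e)) (x (Max e))) = 0"
          using zero by (intro prod_zero bexI[of _ "{?h, s}"]) auto
        then show ?thesis using zero by (simp add: wick_term_def)
      next
        case nz: False
        have lt: "?h < s" "\<forall>y\<in>?H. ?h < y"
          using s fin by (auto intro: order.not_eq_order_implies_strict[OF _ Min_le])
        have cl: "distinct (chord_list c)" "set (chord_list c) = ?H"
          using chord_list_distinct[of ?H c] c fin by auto
        have chord: "chord_list (insert {?h, s} c) = ?h # s # chord_list c"
          by (rule chord_list_insert[of ?H]) (use lt fin c in auto)
        define pre where "pre = takeWhile (\<lambda>t. t \<noteq> s) ?rest"
        have "s \<in> set ?rest" using s rest by simp
        then obtain pre' post where post': "?rest = pre' @ s # post" "s \<notin> set pre'"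
          by (meson split_list_first)
        have "pre = pre'"
          unfolding pre_def post'(1) using post'(2) by (subst takeWhile_append2) auto
        then have post: "?rest = pre @ s # post" "s \<notin> set pre"
          using post' by simp_all
        have sH: "sorted_list_of_set ?H = pre @ post"
          unfolding rem[symmetric] post(1) using post(2) by (simp add: remove1_append)
        let ?r = "reorder_sign (\<lambda>h. p (x h))"
        have dist: "distinct (?h # pre @ s # post)" using rest post by auto
        have setp: "set (pre @ post) = ?H" using sH fin by (metis finite_Diff set_sorted_list_of_set)
        have "?r (sorted_list_of_set H) (chord_list (insert {?h, s} c)) = ?r ([?h] @ (pre @ s # post) @ []) ([?h] @ (s # chord_list c) @ [])"
          unfolding sort chord post(1) by simp
        also have "\<dots> = ?r (pre @ s # post) (s # chord_list c)"
          by (rule reorder_sign_append) (use dist cl setp s lt in auto)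
        also have "\<dots> = ?r (pre @ s # post) (s # pre @ post) * ?r (s # pre @ post) (s # chord_list c)"
          by (rule reorder_sign_trans[symmetric]) (use dist cl setp s in auto)
        also have "?r (pre @ s # post) (s # pre @ post) = ?r (s # pre @ post) (pre @ s # post)"
          by (rule reorder_sign_commute) (use dist in auto)
        also have "\<dots> = (-1) ^ (p (x s) * wpar (\<lambda>h. p (x h)) pre)"
          using reorder_sign_move[of "[]" s pre post "\<lambda>h. p (x h)"] dist by auto
        \<comment> \<open>Here the parity of \<open>s\<close> is exchanged for that of the smallest
          position.\<close>
        also have "\<dots> = ?sg"
          unfolding pre_def[symmetric] using even[of "x ?h" "x s"] nz less.prems(2) h s
          by (intro neg_one_power_cong) auto
        also have "?r (s # pre @ post) (s # chord_list c) = ?r (pre @ post) (chord_list c)"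
          using reorder_sign_append[of "[s]" "pre @ post" "[]" "chord_list c" "\<lambda>h. p (x h)"] dist cl setp by auto
        finally have sign: "?r (sorted_list_of_set H) (chord_list (insert {?h, s} c)) = ?sg * ?r (sorted_list_of_set ?H) (chord_list c)"
          unfolding sH .
        have "{?h, s} \<notin> c" "finite c"
          using c fin by (auto simp: matchings_def partition_on_def intro: finite_elements[of ?H])
        then have "(\<Prod>e\<in>insert {?h, s} c. C (x (Min e)) (x (Max e))) = C (x ?h) (x s) * (\<Prod>e\<in>c. C (x (Min e)) (x (Max e)))"
          using lt by simp
        then show ?thesis
          unfolding wick_term_def sign by simp
      qed
      then show "?sg * C (x ?h) (x s) * G (map x (remove1 s ?rest)) = (\<Sum>c\<in>matchings ?H. wick_term p C x H (insert {?h, s} c))"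
        unfolding rem IH sum_distrib_left by (intro sum.cong) auto
    qed
    also have "\<dots> = (\<Sum>c\<in>matchings H. wick_term p C x H c)"
      by (rule sum_matchings[symmetric]) (use fin False in auto)
    finally show ?thesis .
  qed
qed

text \<open>Every chord has even total parity \<open>p\<close>, so whatever stands to its left
  passes it without sign; only the sign inside each chord remains.\<close>

lemma cross_sign_chord_list:
  assumes "finite H" "c \<in> matchings H" "\<forall>e\<in>c. even (p (Min e) + p (Max e))"
  shows "even (wpar p (chord_list c)) \<and> cross_sign q p (chord_list c) = (\<Prod>e\<in>c. (-1) ^ (q (Min e) * p (Max e)))"
  using assms
proof (induction rule: matchings_induct)
  case (insert h s H c)
  have MM: "Min {h, s} = h" "Max {h, s} = s" using insert by auto
  have IH: "even (wpar p (chord_list c))" "cross_sign q p (chord_list c) = (\<Prod>e\<in>c. (-1) ^ (q (Min e) * p (Max e)))"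
    using insert by auto
  have hs: "even (p h + p s)" using insert.prems MM by auto
  have "{h, s} \<notin> c" "finite c"
    using insert by (auto simp: matchings_def partition_on_def intro: finite_elements[of H])
  moreover have "(-1 :: real) ^ (q h * wpar p (chord_list c)) = 1" "(-1 :: real) ^ (q s * wpar p (chord_list c)) = 1"
    using IH(1) by auto
  ultimately show ?case
    using IH hs by (subst (1 2) chord_list_insert[OF insert(1-5)]) (simp add: MM distrib_left power_add)
qed simp

text \<open>Reordering pairs of letters is reordering the two families separately, up to the cross
  signs before and after. The cross sign after is a product over the chords and cancels the signs in
  the tensor product form. If some chord is odd in the first family, both sides vanish.\<close>

lemma wick_term_tensor:
  assumes H: "finite H" and c: "c \<in> matchings H"
    and even: "\<And>h k. h \<in> H \<Longrightarrow> k \<in> H \<Longrightarrow> C (e h) (e k) \<noteq> 0 \<Longrightarrow> even (p (e h) + p (e k))"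
  shows "wick_term (\<lambda>(e, y). p e + q y) (\<lambda>(e, y) (f, z). (-1) ^ (q y * p f) * (C e f * D y z)) (\<lambda>h. (e h, y h)) H c
    = cross_sign (\<lambda>h. q (y h)) (\<lambda>h. p (e h)) (sorted_list_of_set H) * wick_term p C e H c * wick_term q D y H c"
proof (cases "\<forall>d\<in>c. even (p (e (Min d)) + p (e (Max d)))")
  case True
  let ?us = "sorted_list_of_set H" and ?js = "chord_list c"
  have js: "distinct ?js" "set ?js = H" using chord_list_distinct[OF H c] by auto
  have "reorder_sign (\<lambda>h. p (e h) + q (y h)) ?us ?js
     = cross_sign (\<lambda>h. q (y h)) (\<lambda>h. p (e h)) ?us * cross_sign (\<lambda>h. q (y h)) (\<lambda>h. p (e h)) ?js
     * reorder_sign (\<lambda>h. p (e h)) ?us ?js * reorder_sign (\<lambda>h. q (y h)) ?us ?js"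
    by (rule reorder_sign_add) (use H js in auto)
  moreover have "cross_sign (\<lambda>h. q (y h)) (\<lambda>h. p (e h)) ?js = (\<Prod>d\<in>c. (-1) ^ (q (y (Min d)) * p (e (Max d))))"
    using cross_sign_chord_list[OF H c, of "\<lambda>h. p (e h)" "\<lambda>h. q (y h)"] True by simp
  moreover have "(\<Prod>d\<in>c. (-1) ^ (q (y (Min d)) * p (e (Max d)))) * (\<Prod>d\<in>c. (-1 :: real) ^ (q (y (Min d)) * p (e (Max d)))) = 1"
    by (simp add: neg_one_power_square flip: prod.distrib)
  ultimately show ?thesis
    by (simp add: wick_term_def prod.distrib algebra_simps)
next
  case False
  then obtain d where d: "d \<in> c" "odd (p (e (Min d)) + p (e (Max d)))" by blast
  have "d \<subseteq> H" "card d = 2"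
    using c d by (auto simp: matchings_def partition_on_def)
  then have "Min d \<in> H" "Max d \<in> H"
    by (metis Min_in Max_in card.empty card.infinite subsetD zero_neq_numeral)+
  then have "C (e (Min d)) (e (Max d)) = 0" using even d by blast
  moreover have "finite c" using c H by (auto simp: matchings_def intro: finite_elements)
  ultimately have "(\<Prod>d\<in>c. C (e (Min d)) (e (Max d))) = 0"
    "(\<Prod>d\<in>c. C (e (Min d)) (e (Max d)) * D (y (Min d)) (y (Max d))) = 0"
    using d(1) by (auto intro!: prod_zero)
  then show ?thesis by (simp add: wick_term_def prod.distrib)
qed

section \<open>The state sum of a graph\<close>

definition edge_word :: "('h \<times> 'h) list \<Rightarrow> 'h list"
  where "edge_word es = concat (map (\<lambda>(a, b). [a, b]) es)"

lemma edge_word_simps [simp]: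
  "edge_word [] = []" "edge_word (e # es) = fst e # snd e # edge_word es"
  "edge_word (es @ fs) = edge_word es @ edge_word fs"
  by (auto simp: edge_word_def split: prod.splits)

lemma edge_word_map: "edge_word (map (map_prod f f) es) = map f (edge_word es)"
  by (induction es) auto

lemma set_edge_word: "set (edge_word es) = (\<Union>(a, b)\<in>set es. {a, b})"
  by (induction es) auto

lemma edge_word_distinct: "distinct (edge_word es) \<Longrightarrow> distinct es"
  by (induction es) (auto simp: set_edge_word)

text \<open>A graph with an order of the half-edges at every vertex and an order of the edges:
  contracting tensors needs these orders, and a graph does not provide them.\<close>

definition presentation :: "'h list list \<Rightarrow> ('h \<times> 'h) list \<Rightarrow> bool"
  where "presentation bs es \<longleftrightarrow> distinct (concat bs) \<and> distinct (edge_word es) \<and>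
    set (concat bs) = set (edge_word es) \<and> (\<forall>b\<in>set bs. 3 \<le> length b)"

text \<open>In the language of Feynman graphs, \<open>B\<close> is an even propagator and
  \<open>mt\<close> an odd symmetric vertex; the invariance of the graph value rests on these four
  properties.\<close>

locale state_sum =
  fixes E :: "'b set" and p :: "'b \<Rightarrow> nat" and B :: "'b \<Rightarrow> 'b \<Rightarrow> real" and mt :: "'b list \<Rightarrow> real"
  assumes B_even: "\<And>e f. e \<in> E \<Longrightarrow> f \<in> E \<Longrightarrow> B e f \<noteq> 0 \<Longrightarrow> even (p e + p f)"
    and B_skew: "\<And>e f. e \<in> E \<Longrightarrow> f \<in> E \<Longrightarrow> B f e = - ((-1) ^ (p e * p f) * B e f)"
    and mt_odd: "\<And>bs. set bs \<subseteq> E \<Longrightarrow> 3 \<le> length bs \<Longrightarrow> mt bs \<noteq> 0 \<Longrightarrow> odd (wpar p bs)"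
    and mt_swap: "\<And>u a b v. set (u @ a # b # v) \<subseteq> E \<Longrightarrow> 3 \<le> length (u @ a # b # v) \<Longrightarrow>
      mt (u @ a # b # v) = (-1) ^ (p a * p b) * mt (u @ b # a # v)"
begin

section \<open>State sums of presentations and their symmetries\<close>

definition state_weight :: "'h list list \<Rightarrow> ('h \<times> 'h) list \<Rightarrow> ('h \<Rightarrow> 'b) \<Rightarrow> real"
  where "state_weight bs es x = reorder_sign (\<lambda>h. p (x h)) (concat bs) (edge_word es) *
    prod_list (map (\<lambda>b. mt (map x b)) bs) * prod_list (map (\<lambda>(a, b). B (x a) (x b)) es)"

definition state_value :: "'h list list \<Rightarrow> ('h \<times> 'h) list \<Rightarrow> real"
  where "state_value bs es = (\<Sum>x\<in>PiE (set (concat bs)) (\<lambda>_. E). state_weight bs es x)"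

lemma state_value_cong:
  assumes "set (concat bs) = set (concat bs')"
    and "\<And>x. x \<in> set (concat bs) \<rightarrow> E \<Longrightarrow> state_weight bs es x = c * state_weight bs' es' x"
  shows "state_value bs es = c * state_value bs' es'"
  unfolding state_value_def assms(1) sum_distrib_left
  by (rule sum.cong) (use assms in \<open>auto simp: PiE_def\<close>)

text \<open>The sign from the symmetry of the vertex tensor equals the sign from reordering the
  half-edges, and the two cancel.\<close>

lemma state_value_block_step:
  assumes pres: "presentation (bs1 @ (u @ a # b # v) # bs2) es"
  shows "state_value (bs1 @ (u @ a # b # v) # bs2) es = state_value (bs1 @ (u @ b # a # v) # bs2) es"
proof -
  let ?b = "u @ a # b # v" and ?b' = "u @ b # a # v"
  have "state_value (bs1 @ ?b # bs2) es = 1 * state_value (bs1 @ ?b' # bs2) es"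
  proof (rule state_value_cong)
    fix x assume x: "x \<in> set (concat (bs1 @ ?b # bs2)) \<rightarrow> E"
    let ?s = "(-1) ^ (p (x a) * p (x b)) :: real" and ?r = "reorder_sign (\<lambda>h. p (x h))"
    let ?us = "concat (bs1 @ ?b # bs2)" and ?us' = "concat (bs1 @ ?b' # bs2)"
    have "?r ?us (edge_word es) = ?r ?us ?us' * ?r ?us' (edge_word es)"
      by (rule reorder_sign_trans[symmetric]) (use pres in \<open>auto simp: presentation_def\<close>)
    also have "?r ?us ?us' = ?s"
      using reorder_sign_swap[of "concat bs1 @ u" a b "v @ concat bs2" "\<lambda>h. p (x h)"] pres
      by (auto simp: presentation_def)
    finally have 1: "?r ?us (edge_word es) = ?s * ?r ?us' (edge_word es)" .
    have 2: "mt (map x ?b) = ?s * mt (map x ?b')"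
      using mt_swap[of "map x u" "x a" "x b" "map x v"] x pres by (auto simp: presentation_def)
    show "state_weight (bs1 @ ?b # bs2) es x = 1 * state_weight (bs1 @ ?b' # bs2) es x"
      unfolding state_weight_def 1 map_append list.map(2) prod_list.append prod_list.Cons
        2[unfolded map_append list.map(2)]
      using neg_one_power_square[of "p (x a) * p (x b)"] by (simp add: algebra_simps)
  qed auto
  then show ?thesis by simp
qed

lemma presentation_block:
  assumes "presentation (bs1 @ b # bs2) es" "distinct b'" "set b' = set b"
  shows "presentation (bs1 @ b' # bs2) es"
proof -
  have "length b' = length b"
    using assms by (metis presentation_def distinct_append distinct_card concat_append concat.simps(2))
  then show ?thesis using assms by (auto simp: presentation_def)
qed

lemma state_value_block:
  assumes pres: "presentation (bs1 @ b # bs2) es" and b': "distinct b'" "set b = set b'"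
  shows "state_value (bs1 @ b # bs2) es = state_value (bs1 @ b' # bs2) es"
proof -
  have "distinct b" using pres by (simp add: presentation_def)
  then show ?thesis using b'
  proof (induction rule: reorder_induct)
    case (swap u a c v)
    show ?case
      by (rule state_value_block_step, rule presentation_block[OF pres]) (use swap in auto)
  qed auto
qed

lemma state_value_blocks:
  assumes "presentation (bs0 @ bs) es" "list_all2 (\<lambda>b b'. distinct b' \<and> set b = set b') bs bs'"
  shows "state_value (bs0 @ bs) es = state_value (bs0 @ bs') es \<and> presentation (bs0 @ bs') es"
  using assms(2,1)
proof (induction arbitrary: bs0 rule: list_all2_induct)
  case (Cons b bs b' bs')
  have "presentation ((bs0 @ [b']) @ bs) es"
    using presentation_block[of bs0 b bs es b'] Cons by simp
  then have "state_value ((bs0 @ [b']) @ bs) es = state_value ((bs0 @ [b']) @ bs') es \<and> presentation ((bs0 @ [b']) @ bs') es"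
    by (rule Cons.IH)
  moreover have "state_value (bs0 @ b # bs) es = state_value (bs0 @ b' # bs) es"
    by (rule state_value_block) (use Cons in auto)
  ultimately show ?case by simp
qed simp

text \<open>A colouring contributes only if both propagators are nonzero; then each edge is even and
  the two exchange without sign.\<close>

lemma state_value_edge_step:
  assumes pres: "presentation bs (es1 @ e # f # es2)"
  shows "state_value bs (es1 @ e # f # es2) = state_value bs (es1 @ f # e # es2)"
proof -
  let ?es = "es1 @ e # f # es2" and ?fs = "es1 @ f # e # es2"
  have "state_value bs ?es = 1 * state_value bs ?fs"
  proof (rule state_value_cong)
    fix x assume x: "x \<in> set (concat bs) \<rightarrow> E"
    let ?r = "reorder_sign (\<lambda>h. p (x h))"
    let ?B = "\<lambda>(a, b). B (x a) (x b)"
    have "?r (concat bs) (edge_word ?es) = ?r (concat bs) (edge_word ?fs)" if "?B e \<noteq> 0" "?B f \<noteq> 0"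
    proof -
      have mem: "fst e \<in> set (concat bs)" "snd e \<in> set (concat bs)"
        using pres by (auto simp: presentation_def)
      have "even (p (x (fst e)) + p (x (snd e)))"
        using that(1) x mem by (intro B_even) (auto simp: case_prod_beta)
      then have sign: "?r (edge_word ?fs) (edge_word ?es) = 1"
        using reorder_sign_block_swap[of "edge_word es1" "[fst f, snd f]" "[fst e, snd e]" "edge_word es2" "\<lambda>h. p (x h)"] pres
        by (auto simp: presentation_def)
      have "?r (concat bs) (edge_word ?fs) * ?r (edge_word ?fs) (edge_word ?es) = ?r (concat bs) (edge_word ?es)"
        by (rule reorder_sign_trans) (use pres in \<open>auto simp: presentation_def\<close>)
      then show ?thesis using sign by simp
    qed
    then show "state_weight bs ?es x = 1 * state_weight bs ?fs x"
      by (cases "?B e = 0 \<or> ?B f = 0") (auto simp: state_weight_def)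
  qed simp
  then show ?thesis by simp
qed

lemma edge_word_mset: "mset (es :: ('h \<times> 'h) list) = mset fs \<Longrightarrow> mset (edge_word es) = mset (edge_word fs)"
proof -
  have "mset (edge_word es) = (\<Sum>(a, b)\<in>#mset es. {#a, b#})" for es :: "('h \<times> 'h) list"
    by (induction es) auto
  then show "mset es = mset fs \<Longrightarrow> mset (edge_word es) = mset (edge_word fs)" by simp
qed

lemma presentation_edges:
  assumes "presentation bs es" "mset es = mset fs"
  shows "presentation bs fs"
proof -
  have "mset (edge_word es) = mset (edge_word fs)" using assms(2) by (rule edge_word_mset)
  then show ?thesis
    using assms(1) unfolding presentation_def by (metis mset_eq_imp_distinct_iff mset_eq_setD)
qed

lemma state_value_edges:
  assumes pres: "presentation bs es" and "mset es = mset fs"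
  shows "state_value bs es = state_value bs fs"
  using mset_eq_adjacent_swaps[OF assms(2)]
proof (induction rule: rtranclp_induct)
  case (step gs hs)
  then obtain u a b v where gs: "gs = u @ a # b # v" and hs: "hs = u @ b # a # v"
    by (auto elim!: adjacent_swap.cases)
  have "mset es = mset gs"
    using step(1) by (induction rule: rtranclp_induct) (auto dest: adjacent_swap_mset)
  then have "presentation bs gs" using pres presentation_edges by blast
  then show ?case
    using step(3) state_value_edge_step unfolding gs hs by metis
qed simp

text \<open>A colouring contributes only if both vertex tensors are nonzero; then both are odd and
  their exchange costs -1.\<close>

lemma state_value_vertex_step:
  assumes pres: "presentation (bs1 @ b # c # bs2) es"
  shows "state_value (bs1 @ b # c # bs2) es = - state_value (bs1 @ c # b # bs2) es"
proof -
  have "state_value (bs1 @ b # c # bs2) es = - 1 * state_value (bs1 @ c # b # bs2) es"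
  proof (rule state_value_cong)
    fix x assume x: "x \<in> set (concat (bs1 @ b # c # bs2)) \<rightarrow> E"
    let ?r = "reorder_sign (\<lambda>h. p (x h))"
    let ?us = "concat (bs1 @ b # c # bs2)" and ?us' = "concat (bs1 @ c # b # bs2)"
    have "?r ?us (edge_word es) = - ?r ?us' (edge_word es)" if "mt (map x b) \<noteq> 0" "mt (map x c) \<noteq> 0"
    proof -
      have len: "3 \<le> length b" "3 \<le> length c" using pres by (auto simp: presentation_def)
      have "odd (wpar p (map x b))" "odd (wpar p (map x c))"
        by (rule mt_odd; use that len x in auto)+
      then have "?r ?us ?us' = - 1"
        using reorder_sign_block_swap[of "concat bs1" b c "concat bs2" "\<lambda>h. p (x h)"] pres
        by (auto simp: presentation_def o_def)
      moreover have "?r ?us ?us' * ?r ?us' (edge_word es) = ?r ?us (edge_word es)"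
        by (rule reorder_sign_trans) (use pres in \<open>auto simp: presentation_def\<close>)
      ultimately show ?thesis by simp
    qed
    then show "state_weight (bs1 @ b # c # bs2) es x = - 1 * state_weight (bs1 @ c # b # bs2) es x"
      by (cases "mt (map x b) = 0 \<or> mt (map x c) = 0") (auto simp: state_weight_def)
  qed auto
  then show ?thesis by simp
qed

lemma presentation_vertices:
  fixes bs :: "'h list list"
  assumes "presentation bs es" "mset bs = mset cs"
  shows "presentation cs es"
proof -
  have "mset (concat bs) = (\<Sum>b\<in>#mset bs. mset b)" for bs :: "'h list list"
    by (induction bs) auto
  then have "mset (concat bs) = mset (concat cs)" "set bs = set cs"
    using assms(2) mset_eq_setD by auto
  then show ?thesis
    using assms(1) unfolding presentation_def by (metis mset_eq_imp_distinct_iff mset_eq_setD)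
qed

lemma state_value_vertex_move:
  assumes "presentation (us @ v # vs @ ws) es"
  shows "state_value (us @ v # vs @ ws) es = (-1) ^ length vs * state_value (us @ vs @ v # ws) es"
  using assms
proof (induction vs arbitrary: us)
  case (Cons y vs)
  have "presentation ((us @ [y]) @ v # vs @ ws) es"
    using Cons.prems by (rule presentation_vertices) simp
  from Cons.IH[OF this] show ?case
    using state_value_vertex_step[of us v y "vs @ ws" es] Cons.prems by simp
qed simp

text \<open>Both sides are brought to the common order \<open>us @ vs @ w # v # ws\<close>; one
  needs one exchange of neighbours more than the other.\<close>

lemma state_value_vertex_swap:
  assumes "presentation (us @ v # vs @ w # ws) es"
  shows "state_value (us @ v # vs @ w # ws) es = - state_value (us @ w # vs @ v # ws) es"
proof -
  have "state_value (us @ v # vs @ w # ws) es = (-1) ^ length (vs @ [w]) * state_value (us @ vs @ w # v # ws) es"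
    using state_value_vertex_move[of us v "vs @ [w]" ws es] assms by simp
  moreover have "presentation (us @ w # vs @ v # ws) es"
    using assms by (rule presentation_vertices) simp
  then have "state_value (us @ w # vs @ v # ws) es = (-1) ^ length vs * state_value (us @ vs @ w # v # ws) es"
    using state_value_vertex_move[of us w vs "v # ws" es] by simp
  ultimately show ?thesis by simp
qed

text \<open>The Koszul sign appears twice, from the reordering and from the symmetry of
  \<open>B\<close>; what survives is the minus sign of skew-symmetry.\<close>

lemma state_value_reverse_edge:
  assumes pres: "presentation bs (es1 @ (a, b) # es2)"
  shows "state_value bs (es1 @ (a, b) # es2) = - state_value bs (es1 @ (b, a) # es2)"
proof -
  let ?es = "es1 @ (a, b) # es2" and ?fs = "es1 @ (b, a) # es2"
  have "state_value bs ?es = - 1 * state_value bs ?fs"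
  proof (rule state_value_cong)
    fix x assume x: "x \<in> set (concat bs) \<rightarrow> E"
    let ?r = "reorder_sign (\<lambda>h. p (x h))" and ?s = "(-1) ^ (p (x a) * p (x b)) :: real"
    have "a \<in> set (concat bs)" "b \<in> set (concat bs)"
      using pres by (auto simp: presentation_def)
    then have B: "B (x b) (x a) = - (?s * B (x a) (x b))"
      using x by (intro B_skew) auto
    have "?r (edge_word ?es) (edge_word ?fs) = ?s"
      using reorder_sign_swap[of "edge_word es1" a b "edge_word es2" "\<lambda>h. p (x h)"] pres
      by (auto simp: presentation_def)
    moreover have "?r (concat bs) (edge_word ?es) * ?r (edge_word ?es) (edge_word ?fs) = ?r (concat bs) (edge_word ?fs)"
      by (rule reorder_sign_trans) (use pres in \<open>auto simp: presentation_def\<close>)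
    ultimately have r: "?r (concat bs) (edge_word ?fs) = ?r (concat bs) (edge_word ?es) * ?s" by simp
    have "?s * ?s = 1" by (rule neg_one_power_square)
    then have "state_weight bs ?fs x = - state_weight bs ?es x"
      unfolding state_weight_def r by (simp add: B mult_ac)
    then show "state_weight bs ?es x = - 1 * state_weight bs ?fs x" by simp
  qed simp
  then show ?thesis by simp
qed

text \<open>Pulling colourings back along \<open>f\<close> is a bijection that preserves weights.
  Colourings are extensional functions, hence the restriction to the half-edges.\<close>

lemma state_value_relabel:
  fixes f :: "'h \<Rightarrow> 'g"
  assumes pres: "presentation bs es" and inj: "inj_on f (set (concat bs))"
  shows "state_value (map (map f) bs) (map (map_prod f f) es) = state_value bs es"
proof -
  let ?H = "set (concat bs)"
  have bij: "bij_betw (\<lambda>x. restrict (\<lambda>h. x (f h)) ?H) (PiE (f ` ?H) (\<lambda>_. E)) (PiE ?H (\<lambda>_. E))"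
    unfolding bij_betw_def
  proof
    show "inj_on (\<lambda>x. restrict (\<lambda>h. x (f h)) ?H) (PiE (f ` ?H) (\<lambda>_. E))"
    proof (rule inj_onI)
      fix x y assume xy: "x \<in> PiE (f ` ?H) (\<lambda>_. E)" "y \<in> PiE (f ` ?H) (\<lambda>_. E)"
        and eq: "restrict (\<lambda>h. x (f h)) ?H = restrict (\<lambda>h. y (f h)) ?H"
      show "x = y"
      proof (rule PiE_ext[OF xy])
        fix g assume "g \<in> f ` ?H"
        then show "x g = y g" using eq by (auto simp: restrict_def fun_eq_iff) metis
      qed
    qed
    show "(\<lambda>x. restrict (\<lambda>h. x (f h)) ?H) ` PiE (f ` ?H) (\<lambda>_. E) = PiE ?H (\<lambda>_. E)"
    proof (intro equalityI subsetI)
      fix y assume y: "y \<in> PiE ?H (\<lambda>_. E)"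
      let ?x = "restrict (\<lambda>g. y (the_inv_into ?H f g)) (f ` ?H)"
      have "?x \<in> PiE (f ` ?H) (\<lambda>_. E)"
        using y inj by (auto simp: the_inv_into_f_f PiE_iff)
      moreover have "y = restrict (\<lambda>h. ?x (f h)) ?H"
      proof
        fix h
        show "y h = restrict (\<lambda>h. ?x (f h)) ?H h"
          using PiE_arb[OF y] inj by (cases "h \<in> ?H") (simp_all add: the_inv_into_f_f del: set_concat)
      qed
      ultimately show "y \<in> (\<lambda>x. restrict (\<lambda>h. x (f h)) ?H) ` PiE (f ` ?H) (\<lambda>_. E)"
        unfolding image_iff by blast
    qed (auto simp: PiE_iff)
  qed
  have "state_value bs es = (\<Sum>x\<in>PiE (f ` ?H) (\<lambda>_. E). state_weight bs es (restrict (\<lambda>h. x (f h)) ?H))"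
    unfolding state_value_def by (rule sum.reindex_bij_betw[OF bij, symmetric])
  also have "\<dots> = (\<Sum>x\<in>PiE (f ` ?H) (\<lambda>_. E). state_weight (map (map f) bs) (map (map_prod f f) es) x)"
  proof (rule sum.cong[OF refl])
    fix x :: "'g \<Rightarrow> 'b"
    let ?y = "restrict (\<lambda>h. x (f h)) ?H"
    have us: "concat (map (map f) bs) = map f (concat bs)" by (simp add: map_concat)
    have "reorder_sign (\<lambda>h. p (x h)) (map f (concat bs)) (map f (edge_word es)) = reorder_sign ((\<lambda>h. p (x h)) \<circ> f) (concat bs) (edge_word es)"
      by (rule reorder_sign_map[OF inj]) (use pres in \<open>simp add: presentation_def\<close>)
    also have "\<dots> = reorder_sign (\<lambda>h. p (?y h)) (concat bs) (edge_word es)"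
      by (rule reorder_sign_cong) simp
    finally have 1: "reorder_sign (\<lambda>h. p (x h)) (concat (map (map f) bs)) (edge_word (map (map_prod f f) es))
       = reorder_sign (\<lambda>h. p (?y h)) (concat bs) (edge_word es)"
      unfolding us edge_word_map .
    have 2: "map (\<lambda>b. mt (map x b)) (map (map f) bs) = map (\<lambda>b. mt (map ?y b)) bs"
      by (auto intro!: arg_cong[of _ _ mt])
    have mem: "a \<in> ?H \<and> b \<in> ?H" if "(a, b) \<in> set es" for a b
      using pres that by (fastforce simp: presentation_def set_edge_word)
    have 3: "map (\<lambda>(a, b). B (x a) (x b)) (map (map_prod f f) es) = map (\<lambda>(a, b). B (?y a) (?y b)) es"
      unfolding map_map by (rule map_cong) (use mem in \<open>auto simp del: set_concat\<close>)
    show "state_weight bs es ?y = state_weight (map (map f) bs) (map (map_prod f f) es) x"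
      unfolding state_weight_def 1 2 3 ..
  qed
  also have "f ` ?H = set (concat (map (map f) bs))" by auto
  finally show ?thesis unfolding state_value_def by simp
qed

section \<open>The value of an oriented graph\<close>

definition edge_list :: "('h \<times> 'h) set \<Rightarrow> ('h \<times> 'h) list"
  where "edge_list S = (SOME es. distinct es \<and> set es = S)"

definition graph_value :: "ograph \<Rightarrow> real"
  where "graph_value \<Gamma> = state_value (map sorted_list_of_set (vertices \<Gamma>)) (edge_list (edges \<Gamma>))"

text \<open>Changing the enumeration of the edges or the order at a vertex does not change the state
  sum, so the choices made in \<open>graph_value\<close> are harmless; the order of the vertices and
  the directions of the edges are recorded in the graph.\<close>

lemma graph_value_presentation:
  assumes pres: "presentation bs es"
  shows "graph_value (OGraph H (map set bs) (set es)) = state_value bs es"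
proof -
  have es: "distinct es" using pres by (auto simp: presentation_def intro: edge_word_distinct)
  have "distinct (edge_list (set es)) \<and> set (edge_list (set es)) = set es"
    unfolding edge_list_def by (rule someI[of _ es]) (use es in simp)
  then have m: "mset es = mset (edge_list (set es))"
    using es by (metis set_eq_iff_mset_eq_distinct)
  note state_value_edges[OF pres m] presentation_edges[OF pres m]
  moreover have "list_all2 (\<lambda>b b'. distinct b' \<and> set b = set b') bs (map sorted_list_of_set (map set bs))"
    by (simp add: list_all2_conv_all_nth)
  ultimately show ?thesis
    using state_value_blocks[of "[]" bs "edge_list (set es)"] by (simp add: graph_value_def)
qed

text \<open>Allows the relations between graphs to be checked on lists. Disjointness of the vertices
  and of the edges gives the two distinctness conditions.\<close>

lemma is_graph_presentation:
  assumes "is_graph \<Gamma>"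
  obtains bs es where "presentation bs es" "\<Gamma> = OGraph (set (concat bs)) (map set bs) (set es)"
proof -
  obtain H vs S where \<Gamma>: "\<Gamma> = OGraph H vs S" by (cases \<Gamma>)
  have fin: "finite H" and vs: "distinct vs" "partition_on H (set vs)" "\<forall>v\<in>set vs. 3 \<le> card v"
    and S: "inj_on (\<lambda>(a, b). {a, b}) S" "\<forall>(a, b)\<in>S. a \<noteq> b" "partition_on H ((\<lambda>(a, b). {a, b}) ` S)"
    using assms by (auto simp: \<Gamma> is_graph_def)
  have "finite ((\<lambda>(a, b). {a, b}) ` S)" using fin S(3) by (rule finite_elements)
  then have "finite S" using S(1) by (rule finite_imageD)
  then obtain es where es: "set es = S" "distinct es" using finite_distinct_list by blast
  let ?bs = "map sorted_list_of_set vs"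
  have finv: "finite v" if "v \<in> set vs" for v
    using that vs(2) fin by (auto simp: partition_on_def intro: finite_subset)
  have bs: "map set ?bs = vs" using finv by (simp add: map_idI)
  have dv: "v \<inter> w = {}" if "v \<in> set vs" "w \<in> set vs" "v \<noteq> w" for v w
    using that vs(2) by (auto simp: partition_on_def dest: disjointD)
  have d1: "distinct (concat ?bs)"
  proof (rule distinct_concat)
    show "distinct ?bs"
      using vs(1) by (auto simp: distinct_map inj_on_def dest!: arg_cong[of _ _ set] simp: finv)
    show "distinct b" if "b \<in> set ?bs" for b using that by auto
    show "set b \<inter> set c = {}" if bc: "b \<in> set ?bs" "c \<in> set ?bs" "b \<noteq> c" for b c
    proof -
      obtain v w where "v \<in> set vs" "w \<in> set vs" "b = sorted_list_of_set v" "c = sorted_list_of_set w"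
        using bc by auto
      then show ?thesis using dv[of v w] bc(3) finv by auto
    qed
  qed
  have s1: "set (concat ?bs) = H"
    using vs(2) finv by (auto simp: partition_on_def)
  have d2: "distinct (edge_word es)"
    unfolding edge_word_def
  proof (rule distinct_concat)
    have "(a, b) = (c, d)" if "(a, b) \<in> S" "(c, d) \<in> S" "[a, b] = [c, d]" for a b c d
      using that by simp
    then show "distinct (map (\<lambda>(a, b). [a, b]) es)"
      using es by (auto simp: distinct_map inj_on_def)
    show "distinct w" if "w \<in> set (map (\<lambda>(a, b). [a, b]) es)" for w
      using that S(2) es(1) by auto
    show "set v \<inter> set w = {}" if vw: "v \<in> set (map (\<lambda>(a, b). [a, b]) es)" "w \<in> set (map (\<lambda>(a, b). [a, b]) es)" "v \<noteq> w" for v w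
    proof -
      obtain a b c d where ab: "(a, b) \<in> S" "v = [a, b]" and cd: "(c, d) \<in> S" "w = [c, d]"
        using vw es(1) by auto
      have "(a, b) \<noteq> (c, d)" using vw(3) ab cd by auto
      \<comment> \<open>Injectivity on oriented edges gives different underlying sets, and different
        members of a partition are disjoint.\<close>
      then have ne: "{a, b} \<noteq> {c, d}" using inj_onD[OF S(1), of "(a, b)" "(c, d)"] ab cd by auto
      have "{a, b} \<in> (\<lambda>(a, b). {a, b}) ` S" "{c, d} \<in> (\<lambda>(a, b). {a, b}) ` S"
        using ab(1) cd(1) by force+
      then have "{a, b} \<inter> {c, d} = {}"
        using S(3) ne disjointD unfolding partition_on_def by metis
      then show ?thesis using ab cd by auto
    qed
  qed
  have s2: "set (edge_word es) = H"
    using S(3) es(1) by (auto simp: set_edge_word partition_on_def)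
  have "presentation ?bs es"
    unfolding presentation_def using d1 d2 s1 s2 vs(3) by (simp add: length_sorted_list_of_set)
  then show ?thesis
    using that[of ?bs es] \<Gamma> bs s1 es(1) by simp
qed

lemma graph_value_relabel:
  assumes "is_graph \<Gamma>" "inj_on f (half_edges \<Gamma>)"
  shows "graph_value (relabel f \<Gamma>) = graph_value \<Gamma>"
proof -
  obtain bs es where pres: "presentation bs es" and \<Gamma>: "\<Gamma> = OGraph (set (concat bs)) (map set bs) (set es)"
    using is_graph_presentation[OF assms(1)] by blast
  have inj: "inj_on f (set (concat bs))" using assms(2) by (simp add: \<Gamma>)
  have "presentation (map (map f) bs) (map (map_prod f f) es)"
    unfolding presentation_def edge_word_map map_concat[symmetric]
    using pres inj by (simp add: presentation_def distinct_map)
  then have "graph_value (OGraph (f ` set (concat bs)) (map set (map (map f) bs)) (set (map (map_prod f f) es)))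
     = state_value (map (map f) bs) (map (map_prod f f) es)"
    by (rule graph_value_presentation)
  also have "\<dots> = state_value bs es"
    by (rule state_value_relabel[OF pres inj])
  also have "\<dots> = graph_value \<Gamma>"
    unfolding \<Gamma> using graph_value_presentation[OF pres] by simp
  also have "map set (map (map f) bs) = map ((`) f) (map set bs)" by simp
  finally show ?thesis by (simp add: relabel_def \<Gamma>)
qed

lemma graph_value_swap_vertices:
  assumes "is_graph (OGraph H (us @ [v] @ vs @ [w] @ ws) S)"
  shows "graph_value (OGraph H (us @ [v] @ vs @ [w] @ ws) S) = - graph_value (OGraph H (us @ [w] @ vs @ [v] @ ws) S)"
proof -
  obtain bs es where pres: "presentation bs es" and "OGraph H (us @ [v] @ vs @ [w] @ ws) S = OGraph (set (concat bs)) (map set bs) (set es)"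
    using is_graph_presentation[OF assms] by blast
  then have "map set bs = us @ v # vs @ w # ws" and S: "S = set es" by auto
  then obtain us' zs1 where 1: "bs = us' @ zs1" "map set us' = us" and zs1: "map set zs1 = v # vs @ w # ws"
    using map_eq_append_conv[of set bs us] by metis
  obtain v' zs where 2: "zs1 = v' # zs" "set v' = v" and zs: "map set zs = vs @ w # ws"
    using zs1 by (cases zs1) simp_all
  obtain vs' zs2 where 3: "zs = vs' @ zs2" "map set vs' = vs" and zs2: "map set zs2 = w # ws"
    using zs map_eq_append_conv[of set zs vs] by metis
  obtain w' ws' where 4: "zs2 = w' # ws'" "set w' = w" "map set ws' = ws"
    using zs2 by (cases zs2) simp_all
  note bs = 1(1)[unfolded 2(1) 3(1) 4(1)] and eq = 1(2) 2(2) 3(2) 4(2,3)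
  have pres': "presentation (us' @ w' # vs' @ v' # ws') es"
    using pres unfolding bs by (rule presentation_vertices) simp
  show ?thesis
    using graph_value_presentation[OF pres, of H] graph_value_presentation[OF pres', of H]
      state_value_vertex_swap[of us' v' vs' w' ws' es] pres by (simp add: bs eq S)
qed

lemma graph_value_reverse_edge:
  assumes "is_graph (OGraph H vs (insert (a, b) S))" "(a, b) \<notin> S"
  shows "graph_value (OGraph H vs (insert (a, b) S)) = - graph_value (OGraph H vs (insert (b, a) S))"
proof -
  obtain bs es where pres: "presentation bs es" and "OGraph H vs (insert (a, b) S) = OGraph (set (concat bs)) (map set bs) (set es)"
    using is_graph_presentation[OF assms(1)] by blast
  then have vs: "vs = map set bs" and es: "set es = insert (a, b) S" by auto
  obtain es1 es2 where split: "es = es1 @ (a, b) # es2"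
    using es by (metis insertI1 split_list)
  have "distinct es" using pres by (auto simp: presentation_def intro: edge_word_distinct)
  \<comment> \<open>As \<open>(a, b)\<close> is not in \<open>S\<close>, removing its only
    occurrence from the list leaves an enumeration of \<open>S\<close>.\<close>
  then have S: "S = set (es1 @ es2)" using es assms(2) unfolding split by auto
  have pres': "presentation bs (es1 @ (b, a) # es2)"
    using pres unfolding split by (auto simp: presentation_def)
  show ?thesis
    using graph_value_presentation[OF pres, of H] graph_value_presentation[OF pres', of H]
      state_value_reverse_edge[of bs es1 a b es2] pres by (simp add: split vs S)
qed

end

context state_sum
begin

lemma graph_value_rels:
  assumes "r \<in> graph_rels"
  shows "lin_ext graph_value r = 0"
proof -
  interpret linear "lin_ext graph_value" by (rule linear_lin_ext)
  show ?thesis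
    using assms unfolding graph_rels_def
    by (auto simp: diff add graph_value_relabel)
      (use graph_value_swap_vertices graph_value_reverse_edge in \<open>fastforce+\<close>)
qed

end

section \<open>Bilinear forms\<close>

lemma independent_Un:
  fixes S T :: "'w::real_vector set"
  assumes S: "independent S" and T: "independent T" and ST: "span S \<inter> span T \<subseteq> {0}"
  shows "independent (S \<union> T)"
proof -
  have disj: "S \<inter> T = {}"
  proof -
    have "x \<notin> T" if "x \<in> S" for x
    proof
      assume "x \<in> T"
      then have "x = 0" using that ST span_base by blast
      then show False using that S dependent_zero by blast
    qed
    then show ?thesis by blast
  qed
  show ?thesis
    unfolding independent_explicit_finite_subsets
  proof (intro allI impI ballI)
    fix W c v assume W: "W \<subseteq> S \<union> T" "finite W" and sum: "(\<Sum>v\<in>W. c v *\<^sub>R v) = 0" and v: "v \<in> W"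
    have "(\<Sum>v\<in>W. c v *\<^sub>R v) = (\<Sum>v\<in>W \<inter> S. c v *\<^sub>R v) + (\<Sum>v\<in>W \<inter> T. c v *\<^sub>R v)"
      using W disj by (subst sum.union_disjoint[symmetric]) (auto intro!: sum.cong)
    then have eq: "(\<Sum>v\<in>W \<inter> S. c v *\<^sub>R v) = - (\<Sum>v\<in>W \<inter> T. c v *\<^sub>R v)"
      using sum by (simp add: eq_neg_iff_add_eq_0)
    have "(\<Sum>v\<in>W \<inter> S. c v *\<^sub>R v) \<in> span S"
      by (intro span_sum span_scale span_base) auto
    moreover have "(\<Sum>v\<in>W \<inter> T. c v *\<^sub>R v) \<in> span T"
      by (intro span_sum span_scale span_base) auto
    then have "(\<Sum>v\<in>W \<inter> S. c v *\<^sub>R v) \<in> span T"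
      unfolding eq by (rule span_neg)
    ultimately have "(\<Sum>v\<in>W \<inter> S. c v *\<^sub>R v) = 0" using ST by blast
    moreover from this have "(\<Sum>v\<in>W \<inter> T. c v *\<^sub>R v) = 0" using eq by simp
    moreover have "v \<in> W \<inter> S \<or> v \<in> W \<inter> T" using v W by blast
    ultimately show "c v = 0"
      using S T W(2) unfolding independent_explicit_finite_subsets
      by (metis finite_Int inf_le2)
  qed
qed

text \<open>The map \<open>f\<close> turns the values of the functional \<open>B u\<close> on
  \<open>E\<close> into coordinates with respect to \<open>E\<close>. Nondegeneracy makes it an
  injective endomorphism of a finite-dimensional span, hence surjective by counting.\<close>

lemma riesz_exists:
  fixes E :: "'w::real_vector set"
  assumes E: "finite E" "independent E"
    and lin: "\<And>e. linear (\<lambda>u. B u e)"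
    and nondeg: "\<And>u. u \<in> span E \<Longrightarrow> (\<And>e. e \<in> E \<Longrightarrow> B u e = 0) \<Longrightarrow> u = 0"
  obtains u where "u \<in> span E" "\<And>e. e \<in> E \<Longrightarrow> B u e = (g e :: real)"
proof -
  define f where "f u = (\<Sum>e\<in>E. B u e *\<^sub>R e)" for u
  have f: "linear f"
  proof
    show "f (u + v) = f u + f v" for u v
      by (simp add: f_def linear_add[OF lin] scaleR_add_left sum.distrib)
    show "f (r *\<^sub>R u) = r *\<^sub>R f u" for r u
      by (simp add: f_def linear_scale[OF lin] scaleR_sum_right)
  qed
  have coeff: "c e = d e" if "(\<Sum>e\<in>E. c e *\<^sub>R e) = (\<Sum>e\<in>E. d e *\<^sub>R e)" "e \<in> E" for c d e
  proof -
    have "(\<Sum>e\<in>E. (c e - d e) *\<^sub>R e) = 0"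
      using that(1) by (simp add: scaleR_diff_left sum_subtractf)
    then have "c e - d e = 0"
      using E that(2) unfolding independent_explicit_finite_subsets by (metis (mono_tags) order_refl)
    then show ?thesis by simp
  qed
  have zero: "u = 0" if "u \<in> span E" "f u = 0" for u
  proof (rule nondeg[OF that(1)])
    fix e assume "e \<in> E"
    then show "B u e = 0" using coeff[of "B u" "\<lambda>_. 0" e] that(2) by (simp add: f_def)
  qed
  then have inj: "inj_on f (span E)"
    by (subst linear_injective_on_subspace_0[OF f]) (auto simp: subspace_span)
  have ind: "independent (f ` E)"
    by (rule linear_independent_injective_image[OF f E(2) inj])
  have card: "card (f ` E) = card E"
    by (rule card_image) (rule inj_on_subset[OF inj span_superset])
  have sub: "f ` E \<subseteq> span E"
    unfolding f_def by (intro image_subsetI span_sum span_scale span_base)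
  have "span E \<subseteq> span (f ` E)"
  proof (rule span_minimal)
    show "E \<subseteq> span (f ` E)"
    proof
      fix e assume e: "e \<in> E"
      show "e \<in> span (f ` E)"
      proof (rule ccontr)
        \<comment> \<open>A basis vector outside the span of the image would enlarge an independent
          set that already has as many elements as \<open>E\<close>.\<close>
        assume n: "e \<notin> span (f ` E)"
        then have "independent (insert e (f ` E))"
          using ind by (rule independent_insertI)
        then have "card (insert e (f ` E)) \<le> card E"
          using independent_span_bound[OF E(1)] sub e span_base by auto
        moreover have "e \<notin> f ` E" using span_base[of e "f ` E"] n by (rule contrapos_nn[rotated])
        then have "card (insert e (f ` E)) = Suc (card E)"
          unfolding card[symmetric] by (rule card_insert_disjoint[OF finite_imageI[OF E(1)]])
        ultimately show False by linarith
      qed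
    qed
  qed (rule subspace_span)
  moreover have "(\<Sum>e\<in>E. g e *\<^sub>R e) \<in> span E"
    by (intro span_sum span_scale span_base)
  ultimately have "(\<Sum>e\<in>E. g e *\<^sub>R e) \<in> f ` span E"
    unfolding linear_span_image[OF f] by blast
  then obtain u where u: "u \<in> span E" "f u = (\<Sum>e\<in>E. g e *\<^sub>R e)" by force
  then show ?thesis
    using that coeff[of "B u" g] by (simp add: f_def)
qed

text \<open>Take a largest orthogonal family of vectors of square 1 or -1. On its orthogonal
  complement every vector has square zero, since it could otherwise be normalised and added; by
  polarisation the form vanishes there, and nondegeneracy leaves only zero in the
  complement.\<close>

lemma orthonormal_basis_exists:
  fixes V :: "'w::real_vector set" and B :: "'w \<Rightarrow> 'w \<Rightarrow> real"
  assumes V: "subspace V" "V \<subseteq> span T" "finite T"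
    and lin1: "\<And>v. linear (\<lambda>u. B u v)" and lin2: "\<And>u. linear (B u)"
    and sym: "\<And>u v. u \<in> V \<Longrightarrow> v \<in> V \<Longrightarrow> B u v = B v u"
    and nondeg: "\<And>u. u \<in> V \<Longrightarrow> (\<And>v. v \<in> V \<Longrightarrow> B u v = 0) \<Longrightarrow> u = 0"
  obtains W where "W \<subseteq> V" "finite W" "independent W" "V \<subseteq> span W"
    "\<And>u v. u \<in> W \<Longrightarrow> v \<in> W \<Longrightarrow> u \<noteq> v \<Longrightarrow> B u v = 0"
    "\<And>u. u \<in> W \<Longrightarrow> B u u = 1 \<or> B u u = - 1"
proof -
  define ok where "ok W \<longleftrightarrow> W \<subseteq> V \<and> finite W \<and> (\<forall>u\<in>W. \<forall>v\<in>W. u \<noteq> v \<longrightarrow> B u v = 0) \<and>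
    (\<forall>u\<in>W. B u u = 1 \<or> B u u = - 1)" for W
  have ind: "independent W" if "ok W" for W
  proof (rule independent_if_scalars_zero)
    show fin: "finite W" using that by (simp add: ok_def)
    fix c x assume sum: "(\<Sum>x\<in>W. c x *\<^sub>R x) = 0" and x: "x \<in> W"
    have "0 = B (\<Sum>y\<in>W. c y *\<^sub>R y) x" unfolding sum by (simp add: linear_0[OF lin1])
    also have "\<dots> = (\<Sum>y\<in>W. c y * B y x)"
      by (simp add: linear_sum[OF lin1] linear_scale[OF lin1])
    also have "\<dots> = (\<Sum>y\<in>W. if y = x then c x * B x x else 0)"
      by (rule sum.cong) (use that x in \<open>auto simp: ok_def\<close>)
    also have "\<dots> = c x * B x x" using fin x by simp
    finally show "c x = 0" using that x by (auto simp: ok_def)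
  qed
  have bound: "card W \<le> card T" if "ok W" for W
    using independent_span_bound[OF V(3) ind[OF that]] that V(2) by (auto simp: ok_def)
  have empty: "ok {}" by (simp add: ok_def)
  have "\<exists>W. ok W \<and> (\<forall>W'. ok W' \<longrightarrow> card W' \<le> card W)"
    by (rule ex_has_greatest_nat[of ok "{}" card "Suc (card T)"]) (use bound empty in \<open>simp_all add: le_imp_less_Suc\<close>)
  then obtain W where W: "ok W" and max: "\<And>W'. ok W' \<Longrightarrow> card W' \<le> card W"
    by blast
  have fin: "finite W" and WV: "W \<subseteq> V"
    and ort: "\<And>u v. u \<in> W \<Longrightarrow> v \<in> W \<Longrightarrow> u \<noteq> v \<Longrightarrow> B u v = 0"
    and norm: "\<And>u. u \<in> W \<Longrightarrow> B u u = 1 \<or> B u u = - 1"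
    using W by (auto simp: ok_def)
  define V' where "V' = {v \<in> V. \<forall>w\<in>W. B v w = 0}"
  have null: "B v v = 0" if v: "v \<in> V'" for v
  proof (rule ccontr)
    assume nz: "B v v \<noteq> 0"
    define w where "w = (1 / sqrt \<bar>B v v\<bar>) *\<^sub>R v"
    have "B w w = B v v / \<bar>B v v\<bar>"
      by (simp add: w_def linear_scale[OF lin1] linear_scale[OF lin2])
    then have ww: "B w w = 1 \<or> B w w = - 1" using nz by (auto simp: abs_if)
    have wV: "w \<in> V" using v V(1) by (simp add: w_def V'_def subspace_scale)
    have w0: "B w u = 0" "B u w = 0" if "u \<in> W" for u
    proof -
      show "B w u = 0" using v that by (simp add: w_def V'_def linear_scale[OF lin1])
      then show "B u w = 0" using sym[of u w] wV that WV by auto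
    qed
    have "w \<notin> W" using w0 ww by force
    moreover have "ok (insert w W)"
      using W ww wV w0 by (auto simp: ok_def)
    ultimately show False using max[of "insert w W"] fin by simp
  qed
  have sub: "subspace V'"
    using V(1) by (auto simp: V'_def subspace_def linear_0[OF lin1] linear_add[OF lin1] linear_scale[OF lin1])
  have null2: "B u v = 0" if "u \<in> V'" "v \<in> V'" for u v
  proof -
    have "B (u + v) (u + v) = 0"
      using sub that by (intro null) (simp add: subspace_add)
    then have "B u v + B v u = 0"
      using null[OF that(1)] null[OF that(2)] by (simp add: linear_add[OF lin1] linear_add[OF lin2])
    moreover have "B u v = B v u" using that by (intro sym) (auto simp: V'_def)
    ultimately show ?thesis by simp
  qed
  \<comment> \<open>The orthogonal projection to the complement of \<open>W\<close>; dividing by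
    \<open>B w w\<close> is multiplying by it, as it is 1 or -1.\<close>
  define pr where "pr v = v - (\<Sum>w\<in>W. (B w w * B v w) *\<^sub>R w)" for v
  have pr: "pr v \<in> V'" if "v \<in> V" for v
    unfolding V'_def
  proof (intro CollectI conjI ballI)
    show "pr v \<in> V"
      unfolding pr_def using that WV V(1) by (intro subspace_diff subspace_sum subspace_scale) auto
    fix x assume x: "x \<in> W"
    have "B (pr v) x = B v x - (\<Sum>w\<in>W. B w w * B v w * B w x)"
      by (simp add: pr_def linear_diff[OF lin1] linear_sum[OF lin1] linear_scale[OF lin1])
    also have "(\<Sum>w\<in>W. B w w * B v w * B w x) = (\<Sum>w\<in>W. if w = x then B x x * B v x * B x x else 0)"
      by (rule sum.cong) (use ort x in auto)
    also have "\<dots> = B v x" using fin x norm[OF x] by auto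
    finally show "B (pr v) x = 0" by simp
  qed
  have "V \<subseteq> span W"
  proof
    fix v assume v: "v \<in> V"
    have "pr v = 0"
    proof (rule nondeg)
      show "pr v \<in> V" using pr[OF v] by (simp add: V'_def)
      fix w assume w: "w \<in> V"
      have "B (pr v) (pr w) = B (pr v) w - (\<Sum>x\<in>W. (B x x * B w x) * B (pr v) x)"
        unfolding pr_def[of w] by (simp add: linear_diff[OF lin2] linear_sum[OF lin2] linear_scale[OF lin2])
      then show "B (pr v) w = 0"
        using null2[OF pr[OF v] pr[OF w]] pr[OF v] by (simp add: V'_def)
    qed
    then have "v = (\<Sum>w\<in>W. (B w w * B v w) *\<^sub>R w)" by (simp add: pr_def)
    moreover have "(\<Sum>w\<in>W. (B w w * B v w) *\<^sub>R w) \<in> span W"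
      by (intro span_sum span_scale span_base)
    ultimately show "v \<in> span W" by simp
  qed
  then show ?thesis
    using that[of W] WV fin ind[OF W] ort norm by blast
qed

text \<open>For other representing vectors u' and v' one has B u' v' = f v' = B u v' = g u, so the
  description has a single value.\<close>

lemma inverse_form_eq:
  assumes u: "u \<in> W" "\<And>x. x \<in> W \<Longrightarrow> f x = B u x"
    and v: "v \<in> W" "\<And>x. x \<in> W \<Longrightarrow> g x = B x v"
  shows "inverse_form W B f g = g u"
  unfolding inverse_form_def
proof (rule the_equality)
  show "\<exists>u'\<in>W. \<exists>v\<in>W. (\<forall>x\<in>W. f x = B u' x) \<and> (\<forall>x\<in>W. g x = B x v) \<and> g u = B u' v"
    using u v by auto
  fix r assume "\<exists>u\<in>W. \<exists>v\<in>W. (\<forall>x\<in>W. f x = B u x) \<and> (\<forall>x\<in>W. g x = B x v) \<and> r = B u v"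
  then obtain u' v' where "u' \<in> W" "v' \<in> W" "\<forall>x\<in>W. f x = B u' x" "\<forall>x\<in>W. g x = B x v'" "r = B u' v'"
    by blast
  then show "r = g u" using u by metis
qed

section \<open>The symplectic form on V\<close>

fun partner :: "coord \<Rightarrow> coord" where
  "partner (P i) = Q i"
| "partner (Q i) = P i"
| "partner (X i) = X i"

text \<open>The nonzero entries of the form on V: dp dq gives 1 and -1 for its two orders; half of
  dx dx gives -1, because the sign in front is negative for odd x and the two summands then
  coincide.\<close>

fun partner_sign :: "coord \<Rightarrow> real" where
  "partner_sign (P i) = 1"
| "partner_sign (Q i) = - 1"
| "partner_sign (X i) = - 1"

lemma partner_partner [simp]: "partner (partner y) = y"
  by (cases y) auto

lemma partner_coords [simp]: "partner y \<in> coords n m \<longleftrightarrow> y \<in> coords n m"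
  by (cases y) (auto simp: coords_def)

lemma cpar_partner [simp]: "cpar (partner y) = cpar y"
  by (cases y) auto

lemma partner_sign_square: "partner_sign y * partner_sign y = 1"
  by (cases y) auto

lemma partner_sign_partner: "partner_sign (partner y) = - ((-1) ^ cpar y * partner_sign y)"
  by (cases y) auto

lemma finite_coords [simp]: "finite (coords n m)"
  by (simp add: coords_def)

lemma sum_coords: "(\<Sum>y\<in>coords n m. f y) = (\<Sum>i<n. f (P i)) + (\<Sum>i<n. f (Q i)) + (\<Sum>i<m. f (X i))"
proof -
  have "(\<Sum>y\<in>coords n m. f y) = (\<Sum>y\<in>P ` {..<n}. f y) + (\<Sum>y\<in>Q ` {..<n}. f y) + (\<Sum>y\<in>X ` {..<m}. f y)"
    unfolding coords_def by (subst sum.union_disjoint; auto)+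
  then show ?thesis by (simp add: sum.reindex inj_on_def)
qed

lemma form_V_eq:
  "form_V n m v w = (\<Sum>y\<in>coords n m. partner_sign y * (Poly_Mapping.lookup v y * Poly_Mapping.lookup w (partner y)))"
proof -
  interpret up: linear "lin_ext upsilon_word" by (rule linear_lin_ext)
  interpret ev: linear "lin_ext (eval2 v w)" by (rule linear_lin_ext)
  show ?thesis
    unfolding form_V_def omega_def
    by (simp add: up.add up.scale up.sum ev.add ev.scale ev.sum ev.diff ev.neg sum_coords sum_subtractf sum_negf
        scaleR_sum_right sum_distrib_left flip: sum.distrib)
qed

lemma form_V_gen:
  assumes "y \<in> coords n m"
  shows "form_V n m (gen y) w = partner_sign y * Poly_Mapping.lookup w (partner y)"
  unfolding form_V_eq using assms
  by (simp add: lookup_single when_def if_distrib[of "\<lambda>x. _ * (x * _)"] cong: if_cong)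

lemma form_V_dual_eq:
  assumes "y \<in> coords n m" "z \<in> coords n m"
  shows "form_V_dual n m y z = (if z = partner y then partner_sign (partner y) else 0)"
proof -
  \<comment> \<open>The vectors representing the coordinate \<open>y\<close> from the left and the
    coordinate \<open>z\<close> from the right.\<close>
  let ?u = "partner_sign (partner y) *\<^sub>R gen (partner y)" and ?v = "partner_sign z *\<^sub>R gen (partner z)"
  have u: "form_V n m ?u x = Poly_Mapping.lookup x y" for x
  proof -
    have "form_V n m ?u x = (\<Sum>w\<in>coords n m. if w = partner y then
        (partner_sign (partner y) * partner_sign (partner y)) * Poly_Mapping.lookup x y else 0)"
      unfolding form_V_eq by (rule sum.cong) (auto simp: lookup_single when_def)
    then show ?thesis using assms(1) by (simp add: partner_sign_square)
  qed
  have v: "form_V n m x ?v = Poly_Mapping.lookup x z" for x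
  proof -
    have "form_V n m x ?v = (\<Sum>w\<in>coords n m. if w = z then (partner_sign z * partner_sign z) * Poly_Mapping.lookup x z else 0)"
      unfolding form_V_eq by (rule sum.cong) (auto simp: lookup_single when_def dest: arg_cong[of _ _ partner])
    then show ?thesis using assms(2) by (simp add: partner_sign_square)
  qed
  have "?u \<in> V_space n m" "?v \<in> V_space n m"
    using assms keys_scaleR by (auto simp: V_space_def dest!: subsetD[OF keys_scaleR])
  then have "form_V_dual n m y z = Poly_Mapping.lookup ?u z"
    unfolding form_V_dual_def using u v by (intro inverse_form_eq[where v = ?v]) auto
  then show ?thesis by (auto simp: lookup_single when_def)
qed

section \<open>The algebra and its Lagrangian subspace\<close>

locale frobenius_lagrangian =
  fixes A :: "'a::real_vector dg_alg" and L :: "'a set"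
  assumes frobenius: "dg_comm_frobenius A"
    and odd_sp: "sp_odd A" and symmetric_sp: "sp_symmetric A" and nondegenerate_sp: "sp_nondegenerate A"
    and maximal: "maximally_isotropic A L"
    and complement: "complements_boundaries A L"
begin

lemma graded:
  "subspace (even_part A)" "subspace (odd_part A)" "even_part A \<inter> odd_part A = {0}"
  using frobenius unfolding dg_comm_frobenius_def by simp_all

lemma subspace_hom_part: "subspace (hom_part A p)"
  using graded by (simp add: hom_part_def)

lemma hom_part_cong: "even (p + q) \<Longrightarrow> hom_part A p = hom_part A q"
  by (auto simp: hom_part_def)

lemma hom_part_Int: "odd (p + q) \<Longrightarrow> a \<in> hom_part A p \<Longrightarrow> a \<in> hom_part A q \<Longrightarrow> a = 0"
  using graded(3) by (auto simp: hom_part_def split: if_splits)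

lemma subspace_L: "subspace L"
  and L_isotropic: "a \<in> L \<Longrightarrow> b \<in> L \<Longrightarrow> sp A a b = 0"
  using maximal by (auto simp: maximally_isotropic_def graded_subspace_def isotropic_def)

lemma decompose:
  obtains x y where "x \<in> even_part A" "y \<in> odd_part A" "a = x + y"
proof -
  have "graded_subspace A UNIV" using frobenius by (simp add: dg_comm_frobenius_def)
  then show ?thesis using that unfolding graded_subspace_def by blast
qed

lemma decompose_L:
  assumes "a \<in> L"
  obtains x y where "x \<in> L" "y \<in> L" "x \<in> even_part A" "y \<in> odd_part A" "a = x + y"
proof -
  have "graded_subspace A L" using maximal by (simp add: maximally_isotropic_def)
  then show ?thesis using that assms unfolding graded_subspace_def by blast
qed

lemma frobenius_axioms:
  shows finitely_spanned: "\<exists>B :: 'a set. finite B \<and> span B = UNIV"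
    and bilin_sp: "bilin (sp A)" and bilin_mul: "bilin (mul A)"
    and linear_dif: "linear (dif A)" and dif_dif [rule_format]: "\<forall>a. dif A (dif A a) = 0"
    and dif_hom [rule_format]: "\<forall>p. \<forall>a\<in>hom_part A p. dif A a \<in> hom_part A (p + 1)"
    and mul_hom [rule_format]: "\<forall>p q. \<forall>a\<in>hom_part A p. \<forall>b\<in>hom_part A q. mul A a b \<in> hom_part A (p + q)"
    and mul_commute [rule_format]: "\<forall>p q. \<forall>a\<in>hom_part A p. \<forall>b\<in>hom_part A q. mul A a b = (-1) ^ (p * q) *\<^sub>R mul A b a"
    and mul_assoc [rule_format]: "\<forall>a b c. mul A (mul A a b) c = mul A a (mul A b c)"
    and sp_mul [rule_format]: "\<forall>a b c. sp A (mul A a b) c = sp A a (mul A b c)"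
    and sp_dif [rule_format]: "\<forall>p. \<forall>a\<in>hom_part A p. \<forall>b. sp A (dif A a) b + (-1) ^ p * sp A a (dif A b) = 0"
  using frobenius unfolding dg_comm_frobenius_def by - (elim conjE, assumption)+

lemma bilinear_sp: "linear (sp A a)" "linear (\<lambda>a. sp A a b)"
  using bilin_sp by (simp_all add: bilin_def)

lemma bilinear_mul: "linear (mul A a)" "linear (\<lambda>a. mul A a b)"
  using bilin_mul by (simp_all add: bilin_def)

lemma sp_hom: "a \<in> hom_part A p \<Longrightarrow> b \<in> hom_part A q \<Longrightarrow> even (p + q) \<Longrightarrow> sp A a b = 0"
  using odd_sp unfolding sp_odd_def by blast

lemma sp_commute: "a \<in> hom_part A p \<Longrightarrow> b \<in> hom_part A q \<Longrightarrow> sp A a b = (-1) ^ (p * q) * sp A b a"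
  using symmetric_sp unfolding sp_symmetric_def by blast

lemma par_sign_decomposed:
  assumes x: "x \<in> even_part A" and y: "y \<in> odd_part A"
  shows "par_sign A k (x + y) = x + (-1) ^ k *\<^sub>R y"
  unfolding par_sign_def
proof (rule the_equality)
  show "\<exists>x'\<in>even_part A. \<exists>y'\<in>odd_part A. x + y = x' + y' \<and> x + (-1) ^ k *\<^sub>R y = x' + (-1) ^ k *\<^sub>R y'"
    using assms by blast
  fix b assume "\<exists>x'\<in>even_part A. \<exists>y'\<in>odd_part A. x + y = x' + y' \<and> b = x' + (-1) ^ k *\<^sub>R y'"
  then obtain x' y' where *: "x' \<in> even_part A" "y' \<in> odd_part A" "x + y = x' + y'" "b = x' + (-1) ^ k *\<^sub>R y'"
    by blast
  have eq: "x - x' = y' - y" using *(3) by (simp add: algebra_simps)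
  moreover have "x - x' \<in> even_part A" using x *(1) graded(1) by (simp add: subspace_diff)
  moreover have "y' - y \<in> odd_part A" using y *(2) graded(2) by (simp add: subspace_diff)
  ultimately have "x - x' \<in> even_part A \<inter> odd_part A" by simp
  then have "x - x' = 0" "y' - y = 0" using graded(3) eq by simp_all
  then show "b = x + (-1) ^ k *\<^sub>R y" using * by simp
qed

lemma par_sign_hom:
  assumes "a \<in> hom_part A p"
  shows "par_sign A k a = (-1) ^ (k * p) *\<^sub>R a"
proof (cases "even p")
  case True
  then show ?thesis
    using par_sign_decomposed[of a 0 k] assms subspace_0[OF graded(2)] by (simp add: hom_part_def)
next
  case False
  then have "(-1) ^ (k * p) = ((-1) ^ k :: real)"
    by (intro neg_one_power_cong) simp
  then show ?thesis
    using False par_sign_decomposed[of 0 a k] assms subspace_0[OF graded(1)] by (simp add: hom_part_def)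
qed

lemma linear_par_sign: "linear (par_sign A k)"
proof
  fix a b and r :: real
  obtain x y where xy: "x \<in> even_part A" "y \<in> odd_part A" "a = x + y" by (rule decompose)
  obtain x' y' where xy': "x' \<in> even_part A" "y' \<in> odd_part A" "b = x' + y'" by (rule decompose)
  have p: "par_sign A k ((x + x') + (y + y')) = (x + x') + (-1) ^ k *\<^sub>R (y + y')"
    using xy xy' graded by (intro par_sign_decomposed) (auto intro: subspace_add)
  have eq: "a + b = (x + x') + (y + y')" using xy xy' by simp
  show "par_sign A k (a + b) = par_sign A k a + par_sign A k b"
    unfolding eq p unfolding xy(3) xy'(3) par_sign_decomposed[OF xy(1,2)] par_sign_decomposed[OF xy'(1,2)]
    by (simp add: scaleR_add_right)
  have "par_sign A k (r *\<^sub>R x + r *\<^sub>R y) = r *\<^sub>R x + (-1) ^ k *\<^sub>R (r *\<^sub>R y)"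
    using xy graded by (intro par_sign_decomposed) (auto intro: subspace_scale)
  then show "par_sign A k (r *\<^sub>R a) = r *\<^sub>R par_sign A k a"
    using xy by (simp add: par_sign_decomposed scaleR_add_right)
qed

lemma par_sign_L: "a \<in> L \<Longrightarrow> par_sign A k a \<in> L"
proof -
  assume "a \<in> L"
  then obtain x y where "x \<in> L" "y \<in> L" "x \<in> even_part A" "y \<in> odd_part A" "a = x + y" by (rule decompose_L)
  then show ?thesis
    using subspace_L by (simp add: par_sign_decomposed subspace_add subspace_scale)
qed

lemma par_sign_eq_0: "par_sign A k a = 0 \<Longrightarrow> a = 0"
proof -
  assume 0: "par_sign A k a = 0"
  obtain x y where xy: "x \<in> even_part A" "y \<in> odd_part A" "a = x + y" by (rule decompose)
  then have xeq: "x = - ((-1) ^ k *\<^sub>R y)" using 0 by (simp add: par_sign_decomposed eq_neg_iff_add_eq_0)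
  then have "x \<in> odd_part A" using xy(2) graded(2) by (simp add: subspace_neg subspace_scale)
  then have "x = 0" using xy(1) graded(3) by auto
  moreover from this have "y = 0" using xeq by simp
  ultimately show "a = 0" using xy by simp
qed

lemma bilinear_form_d: "linear (form_d A a)" "linear (\<lambda>a. form_d A a b)"
proof -
  show "linear (form_d A a)"
    unfolding form_d_def using linear_compose[OF linear_dif bilinear_sp(1)] by (simp add: o_def)
  show "linear (\<lambda>a. form_d A a b)"
    unfolding form_d_def using linear_compose[OF linear_par_sign bilinear_sp(2)] by (simp add: o_def)
qed

lemma form_d_hom: "a \<in> hom_part A p \<Longrightarrow> form_d A a b = (-1) ^ p * sp A a (dif A b)"
  by (simp add: form_d_def par_sign_hom linear_scale[OF bilinear_sp(2)])

lemma form_d_even: "a \<in> hom_part A p \<Longrightarrow> b \<in> hom_part A q \<Longrightarrow> odd (p + q) \<Longrightarrow> form_d A a b = 0"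
  using sp_hom[OF _ dif_hom, of a p b q] by (simp add: form_d_hom)

text \<open>If the parities differ, both values vanish by evenness. Otherwise the symmetry of the
  scalar product exchanges the arguments, and its compatibility with the differential moves d from
  one to the other.\<close>

lemma form_d_skew:
  assumes a: "a \<in> hom_part A p" and b: "b \<in> hom_part A q"
  shows "form_d A b a = - ((-1) ^ (p * q) * form_d A a b)"
proof (cases "odd (p + q)")
  case True
  then show ?thesis using form_d_even[OF a b] form_d_even[OF b a] by (simp add: add.commute)
next
  case False
  then have "hom_part A q = hom_part A p" by (intro hom_part_cong) (simp add: add.commute)
  then have b': "b \<in> hom_part A p" using b by simp
  \<comment> \<open>The exponent is a product of consecutive numbers, so this exchange is free of
    sign.\<close>
  have "sp A (dif A a) b = (-1) ^ ((p + 1) * p) * sp A b (dif A a)"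
    using dif_hom[OF a] b' by (rule sp_commute)
  then have "sp A b (dif A a) = sp A (dif A a) b" by simp
  also have "\<dots> = - form_d A a b"
    using sp_dif[OF a, of b] a by (simp add: form_d_hom)
  finally have "form_d A b a = - ((-1) ^ p * form_d A a b)"
    using b' by (simp add: form_d_hom)
  moreover have "(-1) ^ (p * q) = ((-1) ^ p :: real)"
    using False by (intro neg_one_power_cong) auto
  ultimately show ?thesis by simp
qed

lemma form_d_par_sign:
  assumes "a \<in> hom_part A p"
  shows "form_d A a (par_sign A k b) = (-1) ^ (k * p) * form_d A a b"
proof -
  obtain x y where xy: "x \<in> even_part A" "y \<in> odd_part A" "b = x + y" by (rule decompose)
  then have hom: "x \<in> hom_part A 0" "y \<in> hom_part A 1" by (auto simp: hom_part_def)
  have eq: "form_d A a (par_sign A k b) = form_d A a x + (-1) ^ k * form_d A a y"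
    using xy by (simp add: par_sign_decomposed linear_add[OF bilinear_form_d(1)] linear_scale[OF bilinear_form_d(1)])
  have eq': "form_d A a b = form_d A a x + form_d A a y"
    using xy by (simp add: linear_add[OF bilinear_form_d(1)])
  show ?thesis
  proof (cases "even p")
    case True
    then have "form_d A a y = 0" using form_d_even[OF assms hom(2)] by simp
    then show ?thesis using True eq eq' by simp
  next
    case False
    then have "form_d A a x = 0" using form_d_even[OF assms hom(1)] by simp
    moreover have "(-1) ^ (k * p) = ((-1) ^ k :: real)"
      using False by (intro neg_one_power_cong) auto
    ultimately show ?thesis using eq eq' by simp
  qed
qed

text \<open>As d vanishes on d(A), pairing to zero with d(L) is pairing to zero with all of d(A).
  Together with the isotropy of \<open>L\<close> and the splitting of A this puts
  \<open>par_sign A 1 a\<close> into the radical of the scalar product.\<close>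

lemma form_d_nondegenerate:
  assumes a: "a \<in> L" and zero: "\<And>b. b \<in> L \<Longrightarrow> form_d A a b = 0"
  shows "a = 0"
proof -
  have 0: "sp A (par_sign A 1 a) (dif A z) = 0" for z
  proof -
    obtain x y where x: "x \<in> L" and y: "y \<in> range (dif A)" "z = x + y"
      using complement unfolding complements_boundaries_def by blast
    have "dif A z = dif A x" using y by (auto simp: linear_add[OF linear_dif] dif_dif)
    then show ?thesis using zero[OF x] by (simp add: form_d_def)
  qed
  have "sp A (par_sign A 1 a) b = 0" for b
  proof -
    obtain x y where "x \<in> L" "y \<in> range (dif A)" "b = x + y"
      using complement unfolding complements_boundaries_def by blast
    then show ?thesis
      using 0 L_isotropic[OF par_sign_L[OF a]] by (auto simp: linear_add[OF bilinear_sp(1)])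
  qed
  then have "par_sign A 1 a = 0" using nondegenerate_sp by (auto simp: sp_nondegenerate_def)
  then show ?thesis by (rule par_sign_eq_0)
qed

section \<open>A homogeneous basis of \<open>L\<close> and the inverse form on its dual\<close>

definition E :: "'a set"
  where "E = (SOME E. hom_basis A L E)"

lemma finite_spanning: obtains T where "finite T" "span T = (UNIV :: 'a set)"
  using finitely_spanned by blast

text \<open>Bases of the even and of the odd part are joined. \<open>E\<close> is literally the
  choice made inside \<open>beta_L_dual\<close>, so that definition unfolds to sums over
  \<open>E\<close>.\<close>

lemma hom_basis_E: "hom_basis A L E"
  unfolding E_def
proof (rule someI_ex)
  let ?L0 = "L \<inter> even_part A" and ?L1 = "L \<inter> odd_part A"
  obtain E0 where E0: "E0 \<subseteq> ?L0" "independent E0" "?L0 \<subseteq> span E0" using basis_exists by metis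
  obtain E1 where E1: "E1 \<subseteq> ?L1" "independent E1" "?L1 \<subseteq> span E1" using basis_exists by metis
  have s0: "span E0 \<subseteq> ?L0"
    using E0(1) subspace_L graded by (intro span_minimal subspace_inter) auto
  have s1: "span E1 \<subseteq> ?L1"
    using E1(1) subspace_L graded by (intro span_minimal subspace_inter) auto
  have "independent (E0 \<union> E1)"
    using E0(2) E1(2) s0 s1 graded(3) by (intro independent_Un) auto
  moreover have "span (E0 \<union> E1) = L"
  proof
    show "span (E0 \<union> E1) \<subseteq> L"
      using E0(1) E1(1) subspace_L by (intro span_minimal) auto
    show "L \<subseteq> span (E0 \<union> E1)"
    proof
      fix a assume "a \<in> L"
      then obtain x y where xy: "x \<in> L" "y \<in> L" "x \<in> even_part A" "y \<in> odd_part A" "a = x + y" by (rule decompose_L)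
      then have "x \<in> span (E0 \<union> E1)" "y \<in> span (E0 \<union> E1)"
        using E0(3) E1(3) span_mono[of E0 "E0 \<union> E1"] span_mono[of E1 "E0 \<union> E1"] by auto
      then show "a \<in> span (E0 \<union> E1)" using xy(5) by (simp add: span_add)
    qed
  qed
  moreover have "E0 \<union> E1 \<subseteq> even_part A \<union> odd_part A" using E0(1) E1(1) by auto
  ultimately show "\<exists>E. hom_basis A L E" unfolding hom_basis_def by blast
qed

lemma independent_E: "independent E" and span_E: "span E = L" and E_hom: "E \<subseteq> even_part A \<union> odd_part A"
  using hom_basis_E by (auto simp: hom_basis_def)

lemma finite_E: "finite E"
proof -
  obtain T where "finite T" "span T = (UNIV :: 'a set)" by (rule finite_spanning)
  then show ?thesis using independent_span_bound[of T E] independent_E by auto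
qed

lemma E_L: "e \<in> E \<Longrightarrow> e \<in> L"
  using span_E span_base by blast

abbreviation ep :: "'a \<Rightarrow> nat" where "ep \<equiv> elem_par A"

lemma E_hom_part: "e \<in> E \<Longrightarrow> e \<in> hom_part A (ep e)"
  using E_hom by (auto simp: elem_par_def hom_part_def)

definition co :: "'a \<Rightarrow> 'a \<Rightarrow> real"
  where "co e x = representation E x e"

lemma co_add: "x \<in> L \<Longrightarrow> y \<in> L \<Longrightarrow> co e (x + y) = co e x + co e y"
  using representation_add[OF independent_E, of y x] by (simp add: co_def span_E add.commute)

lemma co_scale: "x \<in> L \<Longrightarrow> co e (r *\<^sub>R x) = r * co e x"
  using representation_scale[OF independent_E, of x r] by (simp add: co_def span_E)

lemma co_sum: "(\<And>i. i \<in> I \<Longrightarrow> x i \<in> L) \<Longrightarrow> co e (\<Sum>i\<in>I. x i) = (\<Sum>i\<in>I. co e (x i))"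
  using representation_sum[OF independent_E, of I x] by (simp add: co_def span_E)

lemma co_zero [simp]: "co e 0 = 0"
  using co_scale[of 0 e 0] subspace_L subspace_0 by auto

lemma co_basis: "e \<in> E \<Longrightarrow> f \<in> E \<Longrightarrow> co e f = (if e = f then 1 else 0)"
  using representation_basis[OF independent_E, of f] by (simp add: co_def)

lemma co_expand: "x \<in> L \<Longrightarrow> (\<Sum>e\<in>E. co e x *\<^sub>R e) = x"
  using sum_representation_eq[OF independent_E, of x E] finite_E by (simp add: co_def span_E)

text \<open>The part of the expansion over basis vectors of the other parity is homogeneous of both
  parities, hence zero, and then so are its coordinates.\<close>

lemma co_hom:
  assumes x: "x \<in> L" "x \<in> hom_part A p" and e: "e \<in> E" and nz: "co e x \<noteq> 0"
  shows "even (p + ep e)"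
proof (rule ccontr)
  assume odd: "odd (p + ep e)"
  let ?S = "{f \<in> E. even (p + ep f)}" and ?T = "{f \<in> E. odd (p + ep f)}"
  have split: "x = (\<Sum>f\<in>?S. co f x *\<^sub>R f) + (\<Sum>f\<in>?T. co f x *\<^sub>R f)"
    using co_expand[OF x(1)] finite_E
    by (subst sum.union_disjoint[symmetric]) (auto intro!: sum.cong simp: set_eq_iff elim!: trans[OF sym])
  have "f \<in> hom_part A p" if "f \<in> ?S" for f
    using that E_hom_part[of f] hom_part_cong[of "ep f" p] by (simp add: add.commute)
  then have "(\<Sum>f\<in>?S. co f x *\<^sub>R f) \<in> hom_part A p"
    by (intro subspace_sum subspace_scale subspace_hom_part)
  then have "x - (\<Sum>f\<in>?S. co f x *\<^sub>R f) \<in> hom_part A p"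
    using x(2) subspace_hom_part by (simp add: subspace_diff)
  then have 1: "(\<Sum>f\<in>?T. co f x *\<^sub>R f) \<in> hom_part A p"
    by (subst (asm) split) simp
  have "f \<in> hom_part A (p + 1)" if "f \<in> ?T" for f
    using that E_hom_part[of f] hom_part_cong[of "ep f" "p + 1"] by (simp add: add.commute)
  then have 2: "(\<Sum>f\<in>?T. co f x *\<^sub>R f) \<in> hom_part A (p + 1)"
    by (intro subspace_sum subspace_scale subspace_hom_part)
  have 0: "(\<Sum>f\<in>?T. co f x *\<^sub>R f) = 0"
    by (rule hom_part_Int[OF _ 1 2]) simp
  have "0 = co e (\<Sum>f\<in>?T. co f x *\<^sub>R f)" unfolding 0 by simp
  also have "\<dots> = (\<Sum>f\<in>?T. co f x * co e f)"
    using E_L subspace_L by (subst co_sum) (auto simp: co_scale subspace_scale)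
  also have "\<dots> = (\<Sum>f\<in>?T. if f = e then co e x else 0)"
    by (rule sum.cong) (auto simp: co_basis e)
  also have "\<dots> = co e x" using odd e finite_E by simp
  finally show False using nz by simp
qed

lemma riesz_L:
  obtains u where "u \<in> L" "\<And>x. x \<in> L \<Longrightarrow> form_d A u x = co e x"
proof -
  obtain u where u: "u \<in> span E" "\<And>f. f \<in> E \<Longrightarrow> form_d A u f = co e f"
  proof (rule riesz_exists[where g = "co e", OF finite_E independent_E bilinear_form_d(2)])
    fix u assume "u \<in> span E" and 0: "\<And>f. f \<in> E \<Longrightarrow> form_d A u f = 0"
    then have "u \<in> L" using span_E by simp
    then show "u = 0"
    proof (rule form_d_nondegenerate)
      fix b assume "b \<in> L"
      then have "form_d A u b = form_d A u (\<Sum>e\<in>E. co e b *\<^sub>R e)" using co_expand by simp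
      also have "\<dots> = 0"
        using 0 by (simp add: linear_sum[OF bilinear_form_d(1)] linear_scale[OF bilinear_form_d(1)])
      finally show "form_d A u b = 0" .
    qed
  qed blast
  have "form_d A u x = co e x" if "x \<in> L" for x
  proof -
    have "form_d A u x = form_d A u (\<Sum>f\<in>E. co f x *\<^sub>R f)" using co_expand that by simp
    also have "\<dots> = (\<Sum>f\<in>E. co f x * co e f)"
      using u(2) by (simp add: linear_sum[OF bilinear_form_d(1)] linear_scale[OF bilinear_form_d(1)])
    also have "\<dots> = co e (\<Sum>f\<in>E. co f x *\<^sub>R f)"
      using E_L subspace_L by (subst co_sum) (auto simp: co_scale subspace_scale)
    finally show ?thesis using co_expand that by simp
  qed
  then show ?thesis using that u(1) span_E by simp
qed

text \<open>The vector of \<open>L\<close> representing the functional \<open>e\<^sup>*\<close> from the left.\<close>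

definition dv :: "'a \<Rightarrow> 'a"
  where "dv e = (SOME u. u \<in> L \<and> (\<forall>x\<in>L. form_d A u x = co e x))"

lemma dv: "dv e \<in> L" "x \<in> L \<Longrightarrow> form_d A (dv e) x = co e x"
proof -
  have "\<exists>u. u \<in> L \<and> (\<forall>x\<in>L. form_d A u x = co e x)" using riesz_L by metis
  then have "dv e \<in> L \<and> (\<forall>x\<in>L. form_d A (dv e) x = co e x)"
    unfolding dv_def by (rule someI_ex)
  then show "dv e \<in> L" "x \<in> L \<Longrightarrow> form_d A (dv e) x = co e x" by auto
qed

text \<open>Split the vector by parity. Evenness of the form and homogeneity of the coordinate
  functional make the component of the wrong parity orthogonal to \<open>L\<close>, so it vanishes
  by nondegeneracy.\<close>

lemma dv_hom:
  assumes e: "e \<in> E"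
  shows "dv e \<in> hom_part A (ep e)"
proof -
  obtain x y where xy: "x \<in> L" "y \<in> L" "x \<in> even_part A" "y \<in> odd_part A" "dv e = x + y"
    using decompose_L[OF dv(1)] by metis
  then have hom: "x \<in> hom_part A 0" "y \<in> hom_part A 1" by (auto simp: hom_part_def)
  have zero: "z = 0" if z: "z \<in> L" "z \<in> hom_part A q" "z' \<in> hom_part A (q + 1)" "dv e = z + z'" "odd (q + ep e)" for z z' q
  proof (rule form_d_nondegenerate[OF z(1)])
    have f0: "form_d A z w = 0" if w: "w \<in> L" "w \<in> hom_part A r" for w r
    proof (cases "odd (q + r)")
      case True
      then show ?thesis using form_d_even z(2) w(2) by blast
    next
      case False
      then have "form_d A z' w = 0" using form_d_even[OF z(3) w(2)] by simp
      then have "form_d A z w = co e w"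
        using dv(2)[OF w(1), of e] z(4) by (simp add: linear_add[OF bilinear_form_d(2)])
      moreover have "odd (r + ep e)" using False z(5) by simp
      ultimately show ?thesis using co_hom[OF w e] by fastforce
    qed
    fix b assume "b \<in> L"
    then obtain x y where b: "x \<in> L" "y \<in> L" "x \<in> even_part A" "y \<in> odd_part A" "b = x + y" by (rule decompose_L)
    then show "form_d A z b = 0"
      using f0[of x 0] f0[of y 1] by (simp add: hom_part_def linear_add[OF bilinear_form_d(1)])
  qed
  show ?thesis
  proof (cases "even (ep e)")
    case True
    then have "y = 0"
      using zero[of y 1 x] xy hom by (simp add: add.commute hom_part_def)
    then show ?thesis using True xy by (simp add: hom_part_def)
  next
    case False
    then have "x = 0"
      using zero[of x 0 y] xy hom by simp
    then show ?thesis using False xy by (simp add: hom_part_def)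
  qed
qed

text \<open>The inverse form in the basis dual to \<open>E\<close>.\<close>

definition CL :: "'a \<Rightarrow> 'a \<Rightarrow> real"
  where "CL e f = co f (dv e)"

lemma inverse_form_d:
  assumes f: "f \<in> E"
  shows "inverse_form L (form_d A) (\<lambda>x. representation E x e) (\<lambda>x. representation E x f) = CL e f"
proof -
  \<comment> \<open>Skew-symmetry turns the vector representing the functional from the left into
    one representing it from the right.\<close>
  let ?v = "- ((-1) ^ ep f *\<^sub>R dv f)"
  have "form_d A x ?v = co f x" if x: "x \<in> L" for x
  proof -
    have hom: "form_d A z ?v = form_d A (dv f) z" if z: "z \<in> hom_part A q" for z q
    proof -
      have "form_d A (dv f) z = - ((-1) ^ (q * ep f) * form_d A z (dv f))"
        by (rule form_d_skew[OF z dv_hom[OF f]])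
      moreover have "(-1) ^ (q * ep f) * form_d A z (dv f) = (-1) ^ ep f * form_d A z (dv f)"
      proof (cases "even (q + ep f)")
        case True
        then have "(-1) ^ (q * ep f) = ((-1) ^ ep f :: real)" by (intro neg_one_power_cong) auto
        then show ?thesis by simp
      next
        case False
        then show ?thesis using form_d_even[OF z dv_hom[OF f]] by simp
      qed
      ultimately show ?thesis
        by (simp add: linear_neg[OF bilinear_form_d(1)] linear_scale[OF bilinear_form_d(1)])
    qed
    obtain a b where ab: "a \<in> even_part A" "b \<in> odd_part A" "x = a + b" by (rule decompose)
    then have "form_d A x ?v = form_d A a ?v + form_d A b ?v"
      by (simp add: linear_add[OF bilinear_form_d(2)])
    also have "\<dots> = form_d A (dv f) a + form_d A (dv f) b"
      using hom[of a 0] hom[of b 1] ab by (simp add: hom_part_def)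
    also have "\<dots> = form_d A (dv f) x"
      using ab by (simp add: linear_add[OF bilinear_form_d(1)])
    finally show ?thesis using dv(2)[OF x] by simp
  qed
  moreover have "?v \<in> L" using dv(1) subspace_L by (simp add: subspace_neg subspace_scale)
  ultimately show ?thesis
    unfolding CL_def co_def[symmetric]
    by (intro inverse_form_eq[where u = "dv e" and v = ?v]) (simp_all add: dv)
qed

lemma CL_even: "e \<in> E \<Longrightarrow> f \<in> E \<Longrightarrow> CL e f \<noteq> 0 \<Longrightarrow> even (ep e + ep f)"
  unfolding CL_def by (rule co_hom[OF dv(1) dv_hom])

lemma CL_skew:
  assumes "e \<in> E" "f \<in> E"
  shows "CL f e = - ((-1) ^ (ep e * ep f) * CL e f)"
proof -
  have "CL f e = form_d A (dv e) (dv f)" "CL e f = form_d A (dv f) (dv e)"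
    by (simp_all add: CL_def dv)
  then show ?thesis
    using form_d_skew[OF dv_hom[OF assms(2)] dv_hom[OF assms(1)]] by (simp add: mult.commute)
qed

section \<open>Products of basis elements and the vertex tensors\<close>

lemma mul_list_append: "u \<noteq> [] \<Longrightarrow> v \<noteq> [] \<Longrightarrow> mul_list A (u @ v) = mul A (mul_list A u) (mul_list A v)"
proof (induction u rule: induct_list012)
  case (2 x)
  then show ?case by (cases v) auto
qed (auto simp: mul_assoc)

lemma mul_list_hom: "as \<noteq> [] \<Longrightarrow> set as \<subseteq> E \<Longrightarrow> mul_list A as \<in> hom_part A (wpar ep as)"
proof (induction as rule: induct_list012)
  case (3 a b as)
  then show ?case
    using mul_hom[OF E_hom_part[of a], of "mul_list A (b # as)" "wpar ep (b # as)"] by simp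
qed (auto simp: E_hom_part)

lemma mul_list_swap:
  assumes "a \<in> E" "b \<in> E"
  shows "mul_list A (u @ a # b # v) = (-1) ^ (ep a * ep b) *\<^sub>R mul_list A (u @ b # a # v)"
proof -
  have ab: "mul A a b = (-1) ^ (ep a * ep b) *\<^sub>R mul A b a"
    using assms E_hom_part by (intro mul_commute)
  have 1: "mul_list A (a # b # v) = (-1) ^ (ep a * ep b) *\<^sub>R mul_list A (b # a # v)"
    by (cases v) (simp_all add: ab mul_assoc[symmetric] linear_scale[OF bilinear_mul(2)])
  show ?thesis
  proof (cases "u = []")
    case False
    then show ?thesis
      unfolding mul_list_append[OF False, of "a # b # v", simplified] mul_list_append[OF False, of "b # a # v", simplified]
        1[simplified] by (simp add: linear_scale[OF bilinear_mul(1)] del: mul_list.simps(3))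
  qed (use 1 in simp)
qed

lemma m_tilde_odd:
  assumes "set bs \<subseteq> E" "3 \<le> length bs" "m_tilde A bs \<noteq> 0"
  shows "odd (wpar ep bs)"
proof -
  have ne: "bs \<noteq> []" "butlast bs \<noteq> []" using assms(2) by (auto simp: butlast_conv_take)
  have "mul_list A (butlast bs) \<in> hom_part A (wpar ep (butlast bs))"
    using ne assms(1) by (intro mul_list_hom) (auto dest: in_set_butlastD)
  moreover have "last bs \<in> hom_part A (ep (last bs))"
    using ne assms(1) by (intro E_hom_part) auto
  ultimately have "odd (wpar ep (butlast bs) + ep (last bs))"
    using assms(3) sp_hom unfolding m_tilde_def by blast
  also have "wpar ep (butlast bs) + ep (last bs) = wpar ep (butlast bs @ [last bs])"
    by simp
  also have "butlast bs @ [last bs] = bs" using ne by simp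
  finally show ?thesis .
qed

text \<open>Inside the product this is supercommutativity. A swap involving the last argument is
  first moved inside by the invariance of the scalar product.\<close>

lemma m_tilde_swap:
  assumes "set (u @ a # b # v) \<subseteq> E" "3 \<le> length (u @ a # b # v)"
  shows "m_tilde A (u @ a # b # v) = (-1) ^ (ep a * ep b) * m_tilde A (u @ b # a # v)"
proof (cases v rule: rev_cases)
  case Nil
  then have u: "u \<noteq> []" using assms(2) by auto
  have "m_tilde A (u @ [a, b]) = sp A (mul_list A u) (mul A a b)" for a b
    using mul_list_append[OF u, of "[a]"] by (simp add: m_tilde_def butlast_append sp_mul)
  moreover have "mul A a b = (-1) ^ (ep a * ep b) *\<^sub>R mul A b a"
    using assms E_hom_part by (intro mul_commute) auto
  ultimately show ?thesis using Nil by (simp add: linear_scale[OF bilinear_sp(1)])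
next
  case (snoc v' c)
  then show ?thesis
    using mul_list_swap[of a b u v'] assms(1)
    by (simp add: m_tilde_def butlast_append linear_scale[OF bilinear_sp(2)])
qed

sublocale state_sum E ep CL "m_tilde A"
  by standard (fact CL_even CL_skew m_tilde_odd m_tilde_swap)+

end

section \<open>Sums over words\<close>

definition words :: "'i set \<Rightarrow> nat \<Rightarrow> 'i list set"
  where "words I r = {w. set w \<subseteq> I \<and> length w = r}"

lemma words_0 [simp]: "words I 0 = {[]}"
  by (auto simp: words_def)

lemma finite_words: "finite I \<Longrightarrow> finite (words I r)"
  unfolding words_def by (rule finite_lists_length_eq)

lemma sum_words_Suc:
  "(\<Sum>w\<in>words I (Suc r). f w) = (\<Sum>i\<in>I. \<Sum>w\<in>words I r. (f (i # w) :: 'c::comm_monoid_add))"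
proof -
  have "words I (Suc r) = (\<lambda>(i, w). i # w) ` (I \<times> words I r)"
    by (auto simp: words_def length_Suc_conv image_iff)
  then show ?thesis
    by (simp add: sum.reindex inj_on_def case_prod_unfold sum.cartesian_product)
qed

lemma sum_words_add:
  "(\<Sum>w\<in>words I (r + s). f w) = (\<Sum>v\<in>words I r. \<Sum>w\<in>words I s. (f (v @ w) :: 'c::comm_monoid_add))"
  by (induction r arbitrary: f) (simp_all add: sum_words_Suc)

lemma multilinear_ext_words:
  "multilinear_ext I G ls = (\<Sum>w\<in>words I (length ls). prod_list (map2 (\<lambda>l i. l i) ls w) * G w)"
  by (induction ls arbitrary: G) (simp_all add: sum_words_Suc sum_distrib_left mult.assoc)

section \<open>Chord diagrams as edge lists and the values of their graphs\<close>

definition chord_edges :: "nat set set \<Rightarrow> (nat \<times> nat) list"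
  where "chord_edges c = map (\<lambda>i. (i, THE j. i < j \<and> {i, j} \<in> c)) (sorted_list_of_set {i. \<exists>j. i < j \<and> {i, j} \<in> c})"

lemma edge_word_chord_edges: "edge_word (chord_edges c) = chord_list c"
  by (simp add: edge_word_def chord_edges_def chord_list_def o_def)

lemma set_chord_edges:
  assumes "finite H" "c \<in> matchings H"
  shows "set (chord_edges c) = {(i, j). i < j \<and> {i, j} \<in> c}"
proof -
  have the: "(THE j. i < j \<and> {i, j} \<in> c) = j" if "i < j" "{i, j} \<in> c" for i j
    using that matchings_partner_unique[OF assms(2)] by (intro the_equality) auto
  have "{i. \<exists>j. i < j \<and> {i, j} \<in> c} \<subseteq> H"
    using assms(2) by (auto simp: matchings_def partition_on_def)
  then have "finite {i. \<exists>j. i < j \<and> {i, j} \<in> c}" using assms(1) finite_subset by blast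
  then show ?thesis
    unfolding chord_edges_def by (auto simp: image_iff the)
qed

lemma prod_chord_edges:
  assumes "finite H" "c \<in> matchings H"
  shows "prod_list (map (\<lambda>(a, b). B (x a) (x b)) (chord_edges c)) = (\<Prod>e\<in>c. B (x (Min e)) (x (Max e)) :: real)"
proof -
  have bij: "bij_betw (\<lambda>(a, b). {a, b}) {(i, j). i < j \<and> {i, j} \<in> c} c"
    unfolding bij_betw_def
  proof
      show "inj_on (\<lambda>(a, b). {a, b}) {(i, j). i < j \<and> {i, j} \<in> c}"
        by (auto simp: inj_on_def doubleton_eq_iff)
      show "(\<lambda>(a, b). {a, b}) ` {(i, j). i < j \<and> {i, j} \<in> c} = c"
      proof (intro equalityI subsetI)
        fix e assume e: "e \<in> c"
        then have "card e = 2" using assms(2) by (simp add: matchings_def)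
        then obtain a b where "e = {a, b}" "a < b" by (metis card_2_iff insert_commute linorder_neqE_nat)
        then show "e \<in> (\<lambda>(a, b). {a, b}) ` {(i, j). i < j \<and> {i, j} \<in> c}"
          using e by (intro image_eqI[of _ _ "(a, b)"]) auto
      qed auto
  qed
  have "distinct (chord_edges c)"
    using chord_list_distinct[OF assms] edge_word_distinct[of "chord_edges c"] by (simp add: edge_word_chord_edges)
  then have "prod_list (map (\<lambda>(a, b). B (x a) (x b)) (chord_edges c)) = (\<Prod>(a, b)\<in>{(i, j). i < j \<and> {i, j} \<in> c}. B (x a) (x b))"
    by (simp add: prod.distinct_set_conv_list[symmetric] set_chord_edges[OF assms])
  also have "\<dots> = (\<Prod>e\<in>c. B (x (Min e)) (x (Max e)))"
    unfolding prod.reindex_bij_betw[OF bij, of "\<lambda>e. B (x (Min e)) (x (Max e))", symmetric]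
    by (rule prod.cong) auto
  finally show ?thesis .
qed

lemma concat_blocks: "length w = sum_list ks \<Longrightarrow> concat (blocks ks w) = w"
  by (induction ks w rule: blocks.induct) auto

lemma length_blocks: "length w = sum_list ks \<Longrightarrow> map length (blocks ks w) = ks"
  by (induction ks w rule: blocks.induct) auto

lemma blocks_map: "blocks ks (map f w) = map (map f) (blocks ks w)"
  by (induction ks w rule: blocks.induct) (auto simp: take_map drop_map)

lemma bij_betw_words: "bij_betw (\<lambda>x. map x [0..<r]) (PiE {..<r} (\<lambda>_. I)) (words I r)"
  unfolding bij_betw_def
proof
  show "inj_on (\<lambda>x. map x [0..<r]) (PiE {..<r} (\<lambda>_. I))"
  proof (rule inj_onI)
    fix x y assume xy: "x \<in> PiE {..<r} (\<lambda>_. I)" "y \<in> PiE {..<r} (\<lambda>_. I)" and eq: "map x [0..<r] = map y [0..<r]"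
    show "x = y" by (rule PiE_ext[OF xy]) (use eq in simp)
  qed
  show "(\<lambda>x. map x [0..<r]) ` PiE {..<r} (\<lambda>_. I) = words I r"
  proof (intro equalityI subsetI)
    fix w assume w: "w \<in> words I r"
    let ?x = "restrict (\<lambda>i. w ! i) {..<r}"
    have "?x \<in> PiE {..<r} (\<lambda>_. I)" using w by (auto simp: words_def)
    moreover have "w = map ?x [0..<r]" using w by (auto simp: words_def intro: nth_equalityI)
    ultimately show "w \<in> (\<lambda>x. map x [0..<r]) ` PiE {..<r} (\<lambda>_. I)" by blast
  next
    fix w assume "w \<in> (\<lambda>x. map x [0..<r]) ` PiE {..<r} (\<lambda>_. I)"
    then obtain x where x: "x \<in> PiE {..<r} (\<lambda>_. I)" and w: "w = map x [0..<r]" by blast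
    have "x i \<in> I" if "i < r" for i using x that by (intro PiE_mem[of x]) auto
    then show "w \<in> words I r" unfolding w words_def by auto
  qed
qed

text \<open>With half-edges numbered consecutively, a colouring is a word in the basis, the vertices
  are consecutive blocks and the edges spell out \<open>chord_list\<close>; the state sum becomes
  the expansion of \<open>beta\<close> in a basis.\<close>

lemma (in state_sum) graph_value_chord_graph:
  assumes ks: "\<forall>i\<in>set ks. 3 \<le> i" "sum_list ks = 2 * k" and c: "c \<in> chord_diagrams k"
  shows "graph_value (chord_graph ks c) = (\<Sum>es\<in>words E (2 * k). prod_list (map mt (blocks ks es)) * beta c p B es)"
proof -
  let ?w = "[0..<2 * k]" and ?H = "{..<2 * k}"
  have c': "c \<in> matchings ?H" using c by (simp add: chord_diagrams_eq_matchings)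
  have cl: "distinct (chord_list c)" "set (chord_list c) = ?H" using chord_list_distinct[OF _ c'] by auto
  have cat: "concat (blocks ks ?w) = ?w" using ks by (intro concat_blocks) simp
  have "map length (blocks ks ?w) = ks" using ks by (intro length_blocks) simp
  then have len: "\<forall>b\<in>set (blocks ks ?w). 3 \<le> length b" using ks(1) by (metis image_eqI list.set_map)
  have pres: "presentation (blocks ks ?w) (chord_edges c)"
    unfolding presentation_def edge_word_chord_edges cat using cl len by (simp add: lessThan_atLeast0)
  have "graph_value (chord_graph ks c) = state_value (blocks ks ?w) (chord_edges c)"
    using graph_value_presentation[OF pres, of ?H] set_chord_edges[OF _ c'] ks by (simp add: chord_graph_def)
  also have "\<dots> = (\<Sum>x\<in>PiE ?H (\<lambda>_. E). state_weight (blocks ks ?w) (chord_edges c) x)"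
    unfolding state_value_def cat by (simp add: lessThan_atLeast0)
  also have "\<dots> = (\<Sum>x\<in>PiE ?H (\<lambda>_. E). prod_list (map mt (blocks ks (map x ?w))) * beta c p B (map x ?w))"
  proof (rule sum.cong[OF refl])
    fix x :: "nat \<Rightarrow> 'b"
    have "beta c p B (map x ?w) = wick_term p B (\<lambda>i. map x ?w ! i) ?H c"
      using c by (rule beta_eq_wick_term) simp
    also have "\<dots> = reorder_sign (\<lambda>h. p (map x ?w ! h)) ?w (chord_list c) * (\<Prod>e\<in>c. B (map x ?w ! Min e) (map x ?w ! Max e))"
      by (simp add: wick_term_def lessThan_atLeast0)
    also have "reorder_sign (\<lambda>h. p (map x ?w ! h)) ?w (chord_list c) = reorder_sign (\<lambda>h. p (x h)) ?w (chord_list c)"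
      by (rule reorder_sign_cong) simp
    also have "(\<Prod>e\<in>c. B (map x ?w ! Min e) (map x ?w ! Max e)) = (\<Prod>e\<in>c. B (x (Min e)) (x (Max e)))"
    proof (rule prod.cong[OF refl])
      fix e assume "e \<in> c"
      then have "e \<subseteq> ?H" "card e = 2" using c' by (auto simp: matchings_def partition_on_def)
      then have "Min e \<in> ?H" "Max e \<in> ?H"
        by (metis Min_in Max_in card.empty card.infinite subsetD zero_neq_numeral)+
      then show "B (map x ?w ! Min e) (map x ?w ! Max e) = B (x (Min e)) (x (Max e))" by simp
    qed
    also have "\<dots> = prod_list (map (\<lambda>(a, b). B (x a) (x b)) (chord_edges c))"
      by (rule prod_chord_edges[OF _ c', symmetric]) simp
    finally show "state_weight (blocks ks ?w) (chord_edges c) x = prod_list (map mt (blocks ks (map x ?w))) * beta c p B (map x ?w)"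
      by (simp add: state_weight_def cat edge_word_chord_edges blocks_map o_def)
  qed
  also have "\<dots> = (\<Sum>es\<in>words E (2 * k). prod_list (map mt (blocks ks es)) * beta c p B es)"
    by (rule sum.reindex_bij_betw[OF bij_betw_words])
  finally show ?thesis .
qed

context frobenius_lagrangian
begin

lemma beta_L_dual_eq:
  assumes "c \<in> chord_diagrams k"
  shows "beta_L_dual A L c (2 * k) T = (\<Sum>es\<in>words E (2 * k). T es * beta c ep CL es)"
proof -
  have "beta c ep (\<lambda>e f. inverse_form L (form_d A) (\<lambda>x. representation E x e) (\<lambda>x. representation E x f)) es = beta c ep CL es"
    if es: "es \<in> words E (2 * k)" for es
    unfolding beta_def
  proof (intro arg_cong2[of _ _ _ _ "(*)"] refl prod.cong inverse_form_d)
    fix d assume "d \<in> c"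
    then have "d \<subseteq> {..<2 * k}" "card d = 2" using assms by (auto simp: chord_diagrams_def partition_on_def)
    then have "Max d \<in> {..<2 * k}"
      by (metis Max_in card.empty card.infinite subsetD zero_neq_numeral)
    then show "es ! Max d \<in> E" using es by (auto simp: words_def)
  qed
  then show ?thesis
    unfolding beta_L_dual_def E_def[symmetric] Let_def words_def[symmetric] by (intro sum.cong) simp_all
qed

text \<open>\<open>F_map\<close> picks some functional with the prescribed values; the graph value
  provides one, so the chosen one has these values too.\<close>

lemma F_functional_exists: "F_functional A L (SOME \<phi>. F_functional A L \<phi>)"
proof (rule someI[of _ "lin_ext graph_value"])
  show "F_functional A L (lin_ext graph_value)"
    unfolding F_functional_def
  proof (intro conjI ballI allI impI)
    show "linear (lin_ext graph_value)" by (rule linear_lin_ext)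
    show "lin_ext graph_value r = 0" if "r \<in> graph_rels" for r using that by (rule graph_value_rels)
    fix ks k c assume *: "(\<forall>i\<in>set ks. 3 \<le> i) \<and> sum_list ks = 2 * k \<and> c \<in> chord_diagrams k"
    then have "lin_ext graph_value (gen (chord_graph ks c)) = (\<Sum>es\<in>words E (2 * k). prod_list (map (m_tilde A) (blocks ks es)) * beta c ep CL es)"
      by (simp add: graph_value_chord_graph)
    also have "\<dots> = beta_L_dual A L c (2 * k) (m_tilde_tensor A ks)"
      using * by (simp add: beta_L_dual_eq m_tilde_tensor_def)
    finally show "lin_ext graph_value (gen (chord_graph ks c)) = beta_L_dual A L c (2 * k) (m_tilde_tensor A ks)" .
  qed
qed

lemma linear_mul_list: "linear (\<lambda>x. mul_list A (u @ x # v))"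
proof -
  have 1: "linear (\<lambda>x. mul_list A (x # v))"
    by (cases v) (simp_all add: bilinear_mul linear_ident)
  show ?thesis
  proof (cases "u = []")
    case False
    show ?thesis
      unfolding mul_list_append[OF False list.distinct(2)]
      using linear_compose[OF 1 bilinear_mul(1)] by (simp add: o_def)
  qed (use 1 in simp)
qed

lemma linear_m_tilde:
  assumes "u \<noteq> [] \<or> v \<noteq> []"
  shows "linear (\<lambda>x. m_tilde A (u @ x # v))"
proof (cases v rule: rev_cases)
  case Nil
  then show ?thesis by (simp add: m_tilde_def bilinear_sp)
next
  case (snoc v' c)
  then show ?thesis
    using linear_compose[OF linear_mul_list[of u v'] bilinear_sp(2)[of c]] by (simp add: m_tilde_def butlast_append o_def)
qed

text \<open>The prefix \<open>u\<close> holds the arguments already expanded into basis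
  vectors.\<close>

lemma m_tilde_multilinear:
  assumes "2 \<le> length u + length ls"
  shows "m_tilde A (u @ map (\<lambda>l. \<Sum>e\<in>E. l e *\<^sub>R e) ls) = multilinear_ext E (\<lambda>w. m_tilde A (u @ w)) ls"
  using assms
proof (induction ls arbitrary: u)
  case (Cons l ls)
  let ?T = "\<lambda>l. \<Sum>e\<in>E. l e *\<^sub>R e"
  have lin: "linear (\<lambda>x. m_tilde A (u @ x # map ?T ls))"
    using Cons.prems by (intro linear_m_tilde) auto
  have "m_tilde A (u @ ?T l # map ?T ls) = (\<Sum>e\<in>E. l e * m_tilde A ((u @ [e]) @ map ?T ls))"
    using linear_sum[OF lin, of "\<lambda>e. l e *\<^sub>R e" E] linear_scale[OF lin] by simp
  also have "\<dots> = (\<Sum>e\<in>E. l e * multilinear_ext E (\<lambda>w. m_tilde A ((u @ [e]) @ w)) ls)"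
    by (intro sum.cong refl arg_cong2[of _ _ _ _ "(*)"] Cons.IH) (use Cons.prems in simp)
  finally show ?case by simp
qed simp

end

section \<open>The superspace \<open>L \<otimes> V\<close>\<close>

context frobenius_lagrangian
begin

lemma par_sign_par_sign: "par_sign A k (par_sign A k a) = a"
proof -
  obtain x y where xy: "x \<in> even_part A" "y \<in> odd_part A" "a = x + y" by (rule decompose)
  have "par_sign A k (x + (-1) ^ k *\<^sub>R y) = x + (-1) ^ k *\<^sub>R ((-1) ^ k *\<^sub>R y)"
    using xy graded by (intro par_sign_decomposed) (auto intro: subspace_scale)
  then show ?thesis
    using xy neg_one_power_square[of k] by (simp add: par_sign_decomposed)
qed

lemma par_sign_hom_part: "a \<in> hom_part A p \<Longrightarrow> par_sign A k a \<in> hom_part A p"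
  by (simp add: par_sign_hom subspace_scale[OF subspace_hom_part])

lemma subspace_LV: "subspace (LV_space L n m)"
  using subspace_L
  by (auto simp: subspace_def LV_space_def lookup_add dest!: subsetD[OF Poly_Mapping.keys_add] subsetD[OF keys_scaleR])

lemma subspace_LV_part: "subspace (LV_part A L n m p)"
  using subspace_LV[of n m] subspace_hom_part
  by (auto simp: subspace_def LV_part_def lookup_add)

lemma LV_partD: "w \<in> LV_part A L n m p \<Longrightarrow> w \<in> LV_space L n m"
  by (simp add: LV_part_def)

lemma LV_part_lookup: "w \<in> LV_part A L n m p \<Longrightarrow> Poly_Mapping.lookup w y \<in> hom_part A (p + cpar y)"
  by (simp add: LV_part_def)

lemma LV_lookup: "w \<in> LV_space L n m \<Longrightarrow> Poly_Mapping.lookup w y \<in> L"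
  by (simp add: LV_space_def)

lemma single_LV: "a \<in> L \<Longrightarrow> y \<in> coords n m \<Longrightarrow> Poly_Mapping.single y a \<in> LV_space L n m"
  using subspace_0[OF subspace_L] by (auto simp: LV_space_def lookup_single when_def)

text \<open>Coordinatewise: the parity of a tensor is the sum of two, so over an odd coordinate the
  even and the odd part of an element of \<open>L\<close> exchange roles.\<close>

lemma LV_decompose:
  assumes "w \<in> LV_space L n m"
  obtains u v where "u \<in> LV_part A L n m 0" "v \<in> LV_part A L n m 1" "w = u + v"
proof -
  have "\<exists>u v. u \<in> LV_part A L n m 0 \<and> v \<in> LV_part A L n m 1 \<and> Poly_Mapping.single y a = u + v"
    if y: "y \<in> coords n m" and a: "a \<in> L" for y a
  proof -
    obtain x x' where x: "x \<in> L" "x' \<in> L" "x \<in> even_part A" "x' \<in> odd_part A" "a = x + x'"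
      using a by (rule decompose_L)
    have hom: "x \<in> hom_part A 0" "x' \<in> hom_part A 1" using x by (auto simp: hom_part_def)
    have part: "Poly_Mapping.single y z \<in> LV_part A L n m p" if "z \<in> L" "z \<in> hom_part A (p + cpar y)" for z p
      using single_LV[OF that(1) y] that(2) subspace_0[OF subspace_hom_part]
      by (auto simp: LV_part_def lookup_single when_def)
    have split: "Poly_Mapping.single y a = Poly_Mapping.single y x + Poly_Mapping.single y x'"
      using x(5) by (simp add: single_add)
    show ?thesis
    proof (cases "even (cpar y)")
      case True
      then have "x \<in> hom_part A (0 + cpar y)" "x' \<in> hom_part A (1 + cpar y)" using hom by (simp_all add: hom_part_def)
      then show ?thesis using part x split by blast
    next
      case False
      then have "x' \<in> hom_part A (0 + cpar y)" "x \<in> hom_part A (1 + cpar y)" using hom by (simp_all add: hom_part_def)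
      then show ?thesis using part x split by (metis add.commute)
    qed
  qed
  then have ex: "\<forall>y. \<exists>uv. y \<in> coords n m \<longrightarrow> fst uv \<in> LV_part A L n m 0 \<and> snd uv \<in> LV_part A L n m 1 \<and>
      Poly_Mapping.single y (Poly_Mapping.lookup w y) = fst uv + snd uv"
    using LV_lookup[OF assms] by (metis fst_conv snd_conv)
  obtain uv where uv: "\<And>y. y \<in> coords n m \<Longrightarrow> fst (uv y) \<in> LV_part A L n m 0 \<and> snd (uv y) \<in> LV_part A L n m 1 \<and>
      Poly_Mapping.single y (Poly_Mapping.lookup w y) = fst (uv y) + snd (uv y)"
    using choice[OF ex] by blast
  have "w = (\<Sum>y\<in>coords n m. Poly_Mapping.single y (Poly_Mapping.lookup w y))"
  proof (rule poly_mapping_eqI)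
    fix z
    have "Poly_Mapping.lookup w z = (if z \<in> coords n m then Poly_Mapping.lookup w z else 0)"
      using assms by (auto simp: LV_space_def in_keys_iff)
    then show "Poly_Mapping.lookup w z = Poly_Mapping.lookup (\<Sum>y\<in>coords n m. Poly_Mapping.single y (Poly_Mapping.lookup w y)) z"
      by (simp add: lookup_sum lookup_single when_def)
  qed
  also have "\<dots> = (\<Sum>y\<in>coords n m. fst (uv y)) + (\<Sum>y\<in>coords n m. snd (uv y))"
    using uv by (simp add: sum.distrib)
  finally show ?thesis
    using that uv by (metis (no_types, lifting) subspace_LV_part subspace_sum)
qed

lemma form_dV_eq:
  "form_dV A n m u w = (\<Sum>y\<in>coords n m. partner_sign y *
     form_d A (Poly_Mapping.lookup u y) (par_sign A (cpar y) (Poly_Mapping.lookup w (partner y))))"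
  unfolding form_dV_def
proof (rule sum.cong[OF refl])
  fix y assume y: "y \<in> coords n m"
  let ?f = "\<lambda>z. form_d A (Poly_Mapping.lookup u y) (par_sign A (cpar y) (Poly_Mapping.lookup w z))"
  have "(\<Sum>z\<in>coords n m. ?f z * form_V n m (gen y) (gen z)) = (\<Sum>z\<in>coords n m. if z = partner y then ?f z * partner_sign y else 0)"
    by (rule sum.cong) (auto simp: form_V_gen[OF y] lookup_single when_def)
  then show "(\<Sum>z\<in>coords n m. ?f z * form_V n m (gen y) (gen z)) = partner_sign y * ?f (partner y)"
    using y by simp
qed

lemma bilinear_form_dV: "linear (form_dV A n m u)" "linear (\<lambda>u. form_dV A n m u w)"
proof -
  have ps: "linear (\<lambda>x. form_d A a (par_sign A k x))" for a k
    using linear_compose[OF linear_par_sign bilinear_form_d(1)] by (simp add: o_def)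
  show "linear (form_dV A n m u)"
    by (rule linearI) (simp_all add: form_dV_eq lookup_add linear_add[OF ps] linear_scale[OF ps]
        distrib_left sum.distrib sum_distrib_left mult.left_commute)
  show "linear (\<lambda>u. form_dV A n m u w)"
    by (rule linearI) (simp_all add: form_dV_eq lookup_add linear_add[OF bilinear_form_d(2)]
        linear_scale[OF bilinear_form_d(2)] distrib_left sum.distrib sum_distrib_left mult.left_commute)
qed

lemma form_dV_even:
  assumes "u \<in> LV_part A L n m p" "w \<in> LV_part A L n m q" "odd (p + q)"
  shows "form_dV A n m u w = 0"
  unfolding form_dV_eq
proof (intro sum.neutral ballI)
  fix y
  have "form_d A (Poly_Mapping.lookup u y) (par_sign A (cpar y) (Poly_Mapping.lookup w (partner y))) = 0"
    by (rule form_d_even[OF LV_part_lookup[OF assms(1)] par_sign_hom_part[OF LV_part_lookup[OF assms(2)]]])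
      (use assms(3) in auto)
  then show "partner_sign y * form_d A (Poly_Mapping.lookup u y) (par_sign A (cpar y) (Poly_Mapping.lookup w (partner y))) = 0"
    by simp
qed

text \<open>The tensor product of two skew forms is symmetric in the graded sense: symmetric on even
  vectors, where it gives a Gaussian weight, and skew on odd ones, where it gives a Grassmann
  exponent. Reindexing by \<open>partner\<close> matches the terms of the two sums.\<close>

lemma form_dV_symmetric:
  assumes u: "u \<in> LV_part A L n m p" and w: "w \<in> LV_part A L n m p"
  shows "form_dV A n m w u = (-1) ^ p * form_dV A n m u w"
proof -
  let ?t = "\<lambda>u w y. partner_sign y * form_d A (Poly_Mapping.lookup u y) (par_sign A (cpar y) (Poly_Mapping.lookup w (partner y)))"
  have bij: "bij_betw partner (coords n m) (coords n m)"
    by (rule bij_betw_byWitness[where f' = partner]) auto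
  have "?t w u (partner y) = (-1) ^ p * ?t u w y" for y
  proof -
    let ?a = "Poly_Mapping.lookup u y" and ?b = "Poly_Mapping.lookup w (partner y)" and ?q = "p + cpar y"
    have a: "?a \<in> hom_part A ?q" using LV_part_lookup[OF u] .
    have b: "?b \<in> hom_part A ?q" using LV_part_lookup[OF w, of "partner y"] by simp
    have "form_d A ?b ?a = - ((-1) ^ (?q * ?q) * form_d A ?a ?b)"
      by (rule form_d_skew[OF a b])
    then have "?t w u (partner y) = - ((-1) ^ cpar y * partner_sign y) * ((-1) ^ (cpar y * ?q) * - ((-1) ^ (?q * ?q) * form_d A ?a ?b))"
      by (simp add: form_d_par_sign[OF b] partner_sign_partner)
    also have "\<dots> = ((-1) ^ cpar y * (-1) ^ (?q * ?q)) * (partner_sign y * ((-1) ^ (cpar y * ?q) * form_d A ?a ?b))"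
      by (simp add: mult_ac)
    also have "(-1 :: real) ^ cpar y * (-1) ^ (?q * ?q) = (-1) ^ p"
      by (simp flip: power_add) (rule neg_one_power_cong, auto)
    also have "(-1) ^ (cpar y * ?q) * form_d A ?a ?b = form_d A ?a (par_sign A (cpar y) ?b)"
      by (simp add: form_d_par_sign[OF a])
    finally show ?thesis .
  qed
  then have "(\<Sum>y\<in>coords n m. ?t w u (partner y)) = (-1) ^ p * (\<Sum>y\<in>coords n m. ?t u w y)"
    by (simp only: sum_distrib_left)
  then show ?thesis
    unfolding form_dV_eq using sum.reindex_bij_betw[OF bij, of "?t w u"] by simp
qed

lemma form_dV_single:
  assumes "y \<in> coords n m"
  shows "form_dV A n m u (Poly_Mapping.single (partner y) a) = partner_sign y * form_d A (Poly_Mapping.lookup u y) (par_sign A (cpar y) a)"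
proof -
  have 0: "form_d A x (par_sign A k 0) = 0" for x k
    by (simp add: linear_0[OF linear_par_sign] linear_0[OF bilinear_form_d(1)])
  have "form_dV A n m u (Poly_Mapping.single (partner y) a) = (\<Sum>z\<in>coords n m. if z = y then
      partner_sign y * form_d A (Poly_Mapping.lookup u y) (par_sign A (cpar y) a) else 0)"
    unfolding form_dV_eq
    by (rule sum.cong) (auto simp: lookup_single when_def 0 dest: arg_cong[of _ _ partner])
  then show ?thesis using assms by simp
qed

text \<open>Testing against vectors supported at \<open>partner y\<close> isolates the coordinate at
  \<open>y\<close>, and \<open>par_sign\<close> in the test vector undoes the sign in the
  form.\<close>

lemma form_dV_nondegenerate:
  assumes u: "u \<in> LV_space L n m" and zero: "\<And>w. w \<in> LV_space L n m \<Longrightarrow> form_dV A n m u w = 0"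
  shows "u = 0"
proof (rule poly_mapping_eqI)
  fix y
  show "Poly_Mapping.lookup u y = Poly_Mapping.lookup 0 y"
  proof (cases "y \<in> coords n m")
    case True
    have "Poly_Mapping.lookup u y = 0"
    proof (rule form_d_nondegenerate[OF LV_lookup[OF u]])
      fix b assume b: "b \<in> L"
      have "form_dV A n m u (Poly_Mapping.single (partner y) (par_sign A (cpar y) b)) = 0"
        using True b by (intro zero single_LV par_sign_L) auto
      then have "partner_sign y * form_d A (Poly_Mapping.lookup u y) b = 0"
        unfolding form_dV_single[OF True] par_sign_par_sign .
      then show "form_d A (Poly_Mapping.lookup u y) b = 0"
        using partner_sign_square[of y] by auto
    qed
    then show ?thesis by simp
  qed (use u in \<open>auto simp: LV_space_def in_keys_iff\<close>)
qed

text \<open>The functional \<open>e\<^sup>* \<otimes> y\<close> on \<open>L \<otimes> V\<close>, and the vector representing it.\<close>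

definition lf :: "'a \<times> coord \<Rightarrow> (coord \<Rightarrow>\<^sub>0 'a) \<Rightarrow> real"
  where "lf l w = co (fst l) (Poly_Mapping.lookup w (snd l))"

definition lp :: "'a \<times> coord \<Rightarrow> nat"
  where "lp = (\<lambda>(e, y). ep e + cpar y)"

text \<open>It sits at the partner of the coordinate because the form on V pairs only partners; the
  scalar undoes the signs that \<open>form_dV\<close> creates.\<close>

definition du :: "'a \<times> coord \<Rightarrow> coord \<Rightarrow>\<^sub>0 'a"
  where "du = (\<lambda>(e, y). Poly_Mapping.single (partner y) ((partner_sign (partner y) * (-1) ^ (cpar y * ep e)) *\<^sub>R dv e))"

lemma lf_scale: "w \<in> LV_space L n m \<Longrightarrow> lf l (r *\<^sub>R w) = r * lf l w"
  by (simp add: lf_def co_scale LV_lookup)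

lemma lf_sum: "(\<And>i. i \<in> I \<Longrightarrow> w i \<in> LV_space L n m) \<Longrightarrow> lf l (\<Sum>i\<in>I. w i) = (\<Sum>i\<in>I. lf l (w i))"
  unfolding lf_def lookup_sum by (rule co_sum) (rule LV_lookup)

lemma lf_even:
  assumes "w \<in> LV_part A L n m p" "fst l \<in> E" "lf l w \<noteq> 0"
  shows "even (p + lp l)"
proof -
  have "even ((p + cpar (snd l)) + ep (fst l))"
    using assms unfolding lf_def
    by (intro co_hom[OF LV_lookup[OF LV_partD[OF assms(1)]] LV_part_lookup[OF assms(1)]])
  then show ?thesis by (simp add: lp_def case_prod_beta add_ac)
qed

lemma du_LV: "snd l \<in> coords n m \<Longrightarrow> du l \<in> LV_space L n m"
  using subspace_L dv(1) by (auto simp: du_def case_prod_beta intro!: single_LV subspace_scale)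

lemma form_dV_du:
  assumes l: "fst l \<in> E" "snd l \<in> coords n m" and w: "w \<in> LV_space L n m"
  shows "form_dV A n m (du l) w = lf l w"
proof -
  obtain e y where ey: "l = (e, y)" by (cases l)
  let ?c = "partner_sign (partner y) * (-1) ^ (cpar y * ep e)"
  have "form_dV A n m (du l) w = (\<Sum>z\<in>coords n m. if z = partner y then
      partner_sign (partner y) * form_d A (?c *\<^sub>R dv e) (par_sign A (cpar y) (Poly_Mapping.lookup w y)) else 0)"
    unfolding form_dV_eq
    by (rule sum.cong) (auto simp: du_def ey lookup_single when_def linear_0[OF bilinear_form_d(2)])
  also have "\<dots> = partner_sign (partner y) * form_d A (?c *\<^sub>R dv e) (par_sign A (cpar y) (Poly_Mapping.lookup w y))"
    using l ey by simp
  also have "\<dots> = (partner_sign (partner y) * partner_sign (partner y)) * ((-1) ^ (cpar y * ep e) * (-1) ^ (cpar y * ep e)) * co e (Poly_Mapping.lookup w y)"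
    using l ey dv_hom[of e] LV_lookup[OF w]
    by (simp add: linear_scale[OF bilinear_form_d(2)] form_d_par_sign[of "dv e" "ep e"] dv(2))
  also have "\<dots> = lf l w"
    by (simp add: partner_sign_square neg_one_power_square lf_def ey)
  finally show ?thesis .
qed

text \<open>The covariance of two functionals is the inverse form on the tensor product of the
  duals, with the sign of moving y past the second functional on \<open>L\<close>. A nonzero
  \<open>CL\<close> forces equal parities, so this sign may be written with f in place of e.\<close>

lemma lf_du:
  assumes "e \<in> E" "f \<in> E" "y \<in> coords n m" "z \<in> coords n m"
  shows "lf (f, z) (du (e, y)) = (-1) ^ (cpar y * ep f) * (CL e f * form_V_dual n m y z)"
proof (cases "z = partner y \<and> CL e f \<noteq> 0")
  case True
  then have "even (ep e + ep f)" using CL_even assms by blast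
  then have "(-1) ^ (cpar y * ep e) = ((-1) ^ (cpar y * ep f) :: real)"
    by (intro neg_one_power_cong) (auto simp flip: distrib_left)
  then show ?thesis
    using True assms by (simp add: lf_def du_def CL_def form_V_dual_eq co_scale dv)
next
  case False
  then show ?thesis
    using assms by (auto simp: lf_def du_def CL_def form_V_dual_eq co_scale dv lookup_single when_def)
qed

lemma LV_spanning:
  obtains T where "finite T" "LV_space L n m \<subseteq> span T"
proof
  let ?T = "(\<lambda>(e, y). Poly_Mapping.single y e) ` (E \<times> coords n m)"
  show "finite ?T" using finite_E by simp
  show "LV_space L n m \<subseteq> span ?T"
  proof
    fix w assume w: "w \<in> LV_space L n m"
    have "w = (\<Sum>y\<in>coords n m. \<Sum>e\<in>E. co e (Poly_Mapping.lookup w y) *\<^sub>R Poly_Mapping.single y e)"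
    proof (rule poly_mapping_eqI)
      fix z
      have "Poly_Mapping.lookup (\<Sum>y\<in>coords n m. \<Sum>e\<in>E. co e (Poly_Mapping.lookup w y) *\<^sub>R Poly_Mapping.single y e) z
          = (\<Sum>y\<in>coords n m. if y = z then (\<Sum>e\<in>E. co e (Poly_Mapping.lookup w y) *\<^sub>R e) else 0)"
        unfolding lookup_sum by (rule sum.cong) (auto simp: lookup_single when_def)
      also have "\<dots> = (if z \<in> coords n m then Poly_Mapping.lookup w z else 0)"
        using co_expand[OF LV_lookup[OF w]] by simp
      also have "\<dots> = Poly_Mapping.lookup w z"
        using w by (auto simp: LV_space_def in_keys_iff)
      finally show "Poly_Mapping.lookup w z
          = Poly_Mapping.lookup (\<Sum>y\<in>coords n m. \<Sum>e\<in>E. co e (Poly_Mapping.lookup w y) *\<^sub>R Poly_Mapping.single y e) z" ..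
    qed
    also have "\<dots> \<in> span ?T"
      by (intro span_sum span_scale span_base) auto
    finally show "w \<in> span ?T" .
  qed
qed

end

section \<open>The super Gaussian integral in adapted coordinates\<close>

text \<open>A letter failing \<open>R\<close> contributes neither a pairing nor a sign, so the
  contraction sees only the others. This separates even from odd letters.\<close>

lemma contract_filter:
  assumes "\<And>a. a \<in> set as \<Longrightarrow> \<not> R a \<Longrightarrow> C a = 0 \<and> k a = 1"
  shows "contract C k (\<lambda>as. G (filter (\<lambda>a. \<not> R a) as) * H (filter R as)) as
    = G (filter (\<lambda>a. \<not> R a) as) * contract C k H (filter R as)"
  using assms
proof (induction as arbitrary: G H)
  case (Cons a as)
  have ass: "\<And>b. b \<in> set as \<Longrightarrow> \<not> R b \<Longrightarrow> C b = 0 \<and> k b = 1" using Cons.prems by simp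
  show ?case
  proof (cases "R a")
    case True
    then show ?thesis
      using Cons.IH[OF ass, of G "\<lambda>as. H (a # as)"] by (simp add: algebra_simps)
  next
    case False
    moreover have "C a = 0" "k a = 1" using Cons.prems[of a] False by auto
    ultimately show ?thesis
      using Cons.IH[OF ass, of "\<lambda>as. G (a # as)" H] by simp
  qed
qed simp

lemma contract_map_cong:
  assumes "\<And>a. a \<in> set as \<Longrightarrow> C a = D (f a)" "\<And>a. a \<in> set as \<Longrightarrow> k a = l (f a)"
  shows "contract C k (\<lambda>as. G (map f as)) as = contract D l G (map f as)"
  using assms
proof (induction as arbitrary: G)
  case (Cons a as)
  have "contract C k (\<lambda>as. G (f a # map f as)) as = contract D l (\<lambda>as. G (f a # as)) (map f as)"
    by (rule Cons.IH) (simp_all add: Cons.prems)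
  then show ?case by (simp add: Cons.prems)
qed simp

lemma gr_mul_empty: "gr_mul f g {} = f {} * g {}"
  by (simp add: gr_mul_def)

lemma gr_prod_finitary: "gr_finitary (gr_prod gs)"
  by (cases gs) (simp_all add: gr_prod_def)

lemma coordinate_empty: "coordinate N i x {} = (if i < N then x i else 0)"
  by (auto simp: coordinate_def gr_const_def)

lemma coordinate_odd:
  assumes "N \<le> i"
  shows "coordinate N i x = gr_left i (gr_const 1)"
proof
  fix K
  show "coordinate N i x K = gr_left i (gr_const 1) K"
  proof (cases "K = {i}")
    case True
    have none: "{j. j = i \<and> j < i} = {}" by blast
    show ?thesis
      using assms unfolding True by (simp add: coordinate_def gr_left_def gr_const_def sign_below_def none)
  next
    case False
    then have "\<not> (i \<in> K \<and> K - {i} = {})" by blast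
    then show ?thesis
      using assms False by (simp add: coordinate_def gr_left_def gr_const_def)
  qed
qed

lemma sigma_superfun_eq:
  "sigma_superfun A n m N M b x K = 1 / 2 * (\<Sum>i<N + M. \<Sum>j<N + M. form_dV A n m (b i) (b j) *
     gr_prod [coordinate N i x, coordinate N j x] K)"
  unfolding sigma_superfun_def tensor_superfun_def words_def[symmetric]
  by (simp add: numeral_2_eq_2 sum_words_Suc)

lemma sigma_superfun_empty:
  "sigma_superfun A n m N M b x {} = 1 / 2 * (\<Sum>i<N. \<Sum>j<N. form_dV A n m (b i) (b j) * (x i * x j))"
proof -
  have sub: "(\<Sum>i<N + M. f i) = (\<Sum>i<N. f i)" if "\<And>i. N \<le> i \<Longrightarrow> f i = 0" for f :: "nat \<Rightarrow> real"
    by (rule sum.mono_neutral_right) (use that in auto)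
  show ?thesis
    unfolding sigma_superfun_eq
    by (subst sub, simp add: gr_prod_def gr_mul_empty coordinate_empty, subst sub)
      (simp_all add: gr_prod_def gr_mul_empty coordinate_empty gr_const_def)
qed

text \<open>Mixed entries vanish and products of two even coordinates have only a constant term, so
  apart from the constant term the exponent is the quadratic form in the odd generators, independent
  of \<open>x\<close>.\<close>

lemma sigma_superfun_odd:
  assumes mixed: "\<And>i j. i < N \<Longrightarrow> j \<in> {N..<N + M} \<Longrightarrow> form_dV A n m (b i) (b j) = 0 \<and> form_dV A n m (b j) (b i) = 0"
  shows "(\<lambda>K. if K = {} then 0 else - sigma_superfun A n m N M b x K)
    = gr_quadratic {N..<N + M} (\<lambda>i j. form_dV A n m (b i) (b j)) (gr_const 1)"
proof
  fix K :: "nat set"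
  let ?J = "{N..<N + M}" and ?B = "\<lambda>i j. form_dV A n m (b i) (b j)"
  let ?t = "\<lambda>i j. ?B i j * gr_prod [coordinate N i x, coordinate N j x] K"
  show "(if K = {} then 0 else - sigma_superfun A n m N M b x K) = gr_quadratic ?J ?B (gr_const 1) K"
  proof (cases "K = {}")
    case True
    then show ?thesis by (simp add: gr_quadratic_def gr_left_def)
  next
    case False
    have even: "gr_prod [coordinate N i x, coordinate N j x] K = 0" if "i < N" "j < N" for i j
    proof -
      have "gr_prod [coordinate N i x, coordinate N j x] = (\<lambda>K. x i * (x j * gr_const 1 K))"
        using that by (simp add: gr_prod_def coordinate_def gr_mul_const_left gr_mul_scale_right mult.left_commute)
      then show ?thesis using False by (simp add: gr_const_def)
    qed
    have odd: "gr_prod [coordinate N i x, coordinate N j x] = gr_left i (gr_left j (gr_const 1))" if "N \<le> i" "N \<le> j" for i j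
      using that by (simp add: gr_prod_def coordinate_odd gr_mul_left gr_mul_const_left)
    have zero: "?t i j = 0" if "i \<notin> ?J \<or> j \<notin> ?J" "i < N + M" "j < N + M" for i j
    proof (cases "i < N \<and> j < N")
      case True
      then show ?thesis by (simp add: even)
    next
      case False
      then have "?B i j = 0" using that mixed[of i j] mixed[of j i] by auto
      then show ?thesis by simp
    qed
    have "(\<Sum>i<N + M. \<Sum>j<N + M. ?t i j) = (\<Sum>i\<in>?J. \<Sum>j\<in>?J. ?B i j * gr_left i (gr_left j (gr_const 1)) K)"
    proof -
      have "(\<Sum>i<N + M. \<Sum>j<N + M. ?t i j) = (\<Sum>i\<in>?J. \<Sum>j<N + M. ?t i j)"
        by (rule sum.mono_neutral_right) (use zero in \<open>auto intro!: sum.neutral\<close>)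
      also have "\<dots> = (\<Sum>i\<in>?J. \<Sum>j\<in>?J. ?t i j)"
      proof (rule sum.cong[OF refl])
        fix i assume i: "i \<in> ?J"
        have z: "?t i j = 0" if "j \<in> {..<N + M} - ?J" for j
          by (rule zero) (use i that in auto)
        show "(\<Sum>j<N + M. ?t i j) = (\<Sum>j\<in>?J. ?t i j)"
          by (rule sum.mono_neutral_right[OF _ _ ballI[OF z]]) auto
      qed
      also have "\<dots> = (\<Sum>i\<in>?J. \<Sum>j\<in>?J. ?B i j * gr_left i (gr_left j (gr_const 1)) K)"
        by (intro sum.cong refl) (simp add: odd)
      finally show ?thesis .
    qed
    then show ?thesis
      using False by (simp add: sigma_superfun_eq gr_quadratic_def gr_lin_def gr_left_sum sum_distrib_left sum_negf)
  qed
qed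

context frobenius_lagrangian
begin

text \<open>On the even part the form is symmetric and nondegenerate, so there is an orthogonal
  basis of vectors of square 1 or -1; those of square 1 are numbered first. On the odd part any
  basis serves.\<close>

lemma adapted_coordinates_exist: "\<exists>z. adapted_coordinates A L n m z"
proof -
  obtain T where T: "finite T" "LV_space L n m \<subseteq> span T" by (rule LV_spanning)
  let ?B = "form_dV A n m" and ?V0 = "LV_part A L n m 0" and ?V1 = "LV_part A L n m 1"
  have sub0: "?V0 \<subseteq> LV_space L n m" and sub1: "?V1 \<subseteq> LV_space L n m" by (auto simp: LV_part_def)
  obtain W where W: "W \<subseteq> ?V0" "finite W" "independent W" "?V0 \<subseteq> span W"
    and ort: "\<And>u v. u \<in> W \<Longrightarrow> v \<in> W \<Longrightarrow> u \<noteq> v \<Longrightarrow> ?B u v = 0"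
    and norm: "\<And>u. u \<in> W \<Longrightarrow> ?B u u = 1 \<or> ?B u u = - 1"
  proof (rule orthonormal_basis_exists[OF subspace_LV_part subset_trans[OF sub0 T(2)] T(1), where B = ?B])
    show "linear (\<lambda>u. ?B u v)" "linear (?B u)" for u v by (rule bilinear_form_dV)+
    show "?B u v = ?B v u" if "u \<in> ?V0" "v \<in> ?V0" for u v
      using form_dV_symmetric[OF that] by simp
    show "u = 0" if u: "u \<in> ?V0" and zero: "\<And>v. v \<in> ?V0 \<Longrightarrow> ?B u v = 0" for u
    proof (rule form_dV_nondegenerate)
      show "u \<in> LV_space L n m" using u sub0 by blast
      fix w assume "w \<in> LV_space L n m"
      then obtain a c where "a \<in> ?V0" "c \<in> ?V1" "w = a + c" by (rule LV_decompose)
      then show "?B u w = 0"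
        using zero form_dV_even[OF u, of c 1] by (simp add: linear_add[OF bilinear_form_dV(1)])
    qed
  qed blast
  obtain D where D: "D \<subseteq> ?V1" "independent D" "?V1 \<subseteq> span D" using basis_exists by metis
  have finD: "finite D" using independent_span_bound[OF T(1) D(2)] D(1) sub1 T(2) by blast
  let ?Wp = "{u \<in> W. ?B u u = 1}"
  define k where "k = card ?Wp"
  define N where "N = card W"
  define M where "M = card D"
  have cW: "card (W - ?Wp) = N - k" using W(2) by (simp add: card_Diff_subset k_def N_def)
  have kN: "k \<le> N" using W(2) by (auto simp: k_def N_def intro: card_mono)
  obtain f where f: "bij_betw f {..<k} ?Wp"
    using ex_bij_betw_nat_finite[of ?Wp] W(2) by (auto simp: k_def lessThan_atLeast0)
  have "\<exists>g. bij_betw g {k..<N} (W - ?Wp)"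
    using W(2) cW by (intro finite_same_card_bij) auto
  then obtain g where g: "bij_betw g {k..<N} (W - ?Wp)" by blast
  have "\<exists>h. bij_betw h {N..<N + M} D"
    using finD by (intro finite_same_card_bij) (auto simp: M_def)
  then obtain h where h: "bij_betw h {N..<N + M} D" by blast
  define b where "b i = (if i < k then f i else if i < N then g i else h i)" for i
  have bf: "bij_betw b {..<k} ?Wp"
    using f by (subst bij_betw_cong[of _ _ f]) (auto simp: b_def)
  have bg: "bij_betw b {k..<N} (W - ?Wp)"
    using g kN by (subst bij_betw_cong[of _ _ g]) (auto simp: b_def)
  have bh: "bij_betw b {N..<N + M} D"
    using h kN by (subst bij_betw_cong[of _ _ h]) (auto simp: b_def)
  have "bij_betw b ({..<k} \<union> {k..<N}) (?Wp \<union> (W - ?Wp))"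
    using bf bg by (rule bij_betw_combine) auto
  moreover have "{..<k} \<union> {k..<N} = {..<N}" "?Wp \<union> (W - ?Wp) = W" using kN by auto
  ultimately have bW: "bij_betw b {..<N} W" by simp
  have span0: "span W \<subseteq> ?V0" by (rule span_minimal[OF W(1) subspace_LV_part])
  have span1: "span D \<subseteq> ?V1" by (rule span_minimal[OF D(1) subspace_LV_part])
  have int: "?V0 \<inter> ?V1 \<subseteq> {0}"
  proof
    fix u assume u: "u \<in> ?V0 \<inter> ?V1"
    have "Poly_Mapping.lookup u y = 0" for y
      using u by (intro hom_part_Int[OF _ LV_part_lookup[of u n m 0] LV_part_lookup[of u n m 1]]) auto
    then show "u \<in> {0}" by (auto intro: poly_mapping_eqI)
  qed
  have ind: "independent (W \<union> D)"
    using span0 span1 int by (intro independent_Un W(3) D(2)) blast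
  have disj: "W \<inter> D = {}"
  proof -
    have "0 \<notin> W" using W(3) dependent_zero by blast
    moreover have "W \<inter> D \<subseteq> {0}" using W(1) D(1) int by blast
    ultimately show ?thesis by blast
  qed
  have "bij_betw b ({..<N} \<union> {N..<N + M}) (W \<union> D)"
    using bW bh disj by (rule bij_betw_combine)
  moreover have "{..<N} \<union> {N..<N + M} = {..<N + M}" by auto
  ultimately have bWD: "bij_betw b {..<N + M} (W \<union> D)" by simp
  have span: "span (W \<union> D) = LV_space L n m"
  proof
    show "span (W \<union> D) \<subseteq> LV_space L n m"
      using W(1) D(1) sub0 sub1 by (intro span_minimal subspace_LV) auto
    show "LV_space L n m \<subseteq> span (W \<union> D)"
    proof
      fix w assume "w \<in> LV_space L n m"
      then obtain a c where "a \<in> ?V0" "c \<in> ?V1" "w = a + c" by (rule LV_decompose)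
      moreover have "span W \<subseteq> span (W \<union> D)" "span D \<subseteq> span (W \<union> D)" by (simp_all add: span_mono)
      ultimately show "w \<in> span (W \<union> D)" using W(4) D(3) by (auto intro!: span_add)
    qed
  qed
  have sigma: "sigma_superfun A n m N M b x {} = ((\<Sum>i<k. (x i)\<^sup>2) - (\<Sum>i\<in>{k..<N}. (x i)\<^sup>2)) / 2" for x
  proof -
    have diag: "?B (b i) (b j) = (if j = i then wick_eps k i else 0)" if ij: "i < N" "j < N" for i j
    proof (cases "j = i")
      case True
      have "b i \<in> W" using bW ij(1) by (auto simp: bij_betw_def)
      then have pm: "?B (b i) (b i) = 1 \<or> ?B (b i) (b i) = - 1" by (rule norm)
      show ?thesis
      proof (cases "i < k")
        case True
        then have "b i \<in> ?Wp" using bf by (auto simp: bij_betw_def)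
        then show ?thesis using True \<open>j = i\<close> by (simp add: wick_eps_def)
      next
        case False
        then have "b i \<in> W - ?Wp" using bg ij by (auto simp: bij_betw_def)
        then show ?thesis using pm False \<open>j = i\<close> by (auto simp: wick_eps_def)
      qed
    next
      case False
      then have "b i \<noteq> b j" using bW ij by (auto simp: bij_betw_def inj_on_def)
      then show ?thesis using ort[of "b i" "b j"] bW ij False by (auto simp: bij_betw_def)
    qed
    have "(\<Sum>i<N. \<Sum>j<N. ?B (b i) (b j) * (x i * x j)) = (\<Sum>i<N. \<Sum>j<N. if j = i then wick_eps k i * (x i)\<^sup>2 else 0)"
      by (intro sum.cong refl) (simp add: diag power2_eq_square)
    also have "\<dots> = (\<Sum>i<N. wick_eps k i * (x i)\<^sup>2)" by simp
    also have "\<dots> = (\<Sum>i\<in>{..<k} \<union> {k..<N}. wick_eps k i * (x i)\<^sup>2)"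
      using kN by (intro sum.cong) auto
    also have "\<dots> = (\<Sum>i<k. (x i)\<^sup>2) - (\<Sum>i\<in>{k..<N}. (x i)\<^sup>2)"
      by (subst sum.union_disjoint) (auto simp: wick_eps_def sum_negf)
    finally show ?thesis unfolding sigma_superfun_empty by simp
  qed
  have "adapted_coordinates A L n m (N, M, k, b)"
    unfolding adapted_coordinates_def
    using bWD bW bh ind span W(1) D(1) kN sigma by (simp add: bij_betw_def)
  then show ?thesis by blast
qed

end

section \<open>Normalised integrals in fixed adapted coordinates\<close>

locale gaussian = frobenius_lagrangian A L for A :: "'a::real_vector dg_alg" and L :: "'a set" +
  fixes n m N M k :: nat and b :: "nat \<Rightarrow> coord \<Rightarrow>\<^sub>0 'a"
  assumes adapted: "adapted_coordinates A L n m (N, M, k, b)"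
begin

abbreviation J :: "nat set" where "J \<equiv> {N..<N + M}"

definition Bb :: "nat \<Rightarrow> nat \<Rightarrow> real" where "Bb i j = form_dV A n m (b i) (b j)"

lemma inj_b: "inj_on b {..<N + M}" and ind_b: "independent (b ` {..<N + M})"
  and span_b: "span (b ` {..<N + M}) = LV_space L n m" and kN: "k \<le> N"
  using adapted by (simp_all add: adapted_coordinates_def)

lemma b_even: "i < N \<Longrightarrow> b i \<in> LV_part A L n m 0" and b_odd: "i \<in> J \<Longrightarrow> b i \<in> LV_part A L n m 1"
  using adapted by (auto simp: adapted_coordinates_def)

lemma b_LV: "i < N + M \<Longrightarrow> b i \<in> LV_space L n m"
  using span_base[of "b i" "b ` {..<N + M}"] unfolding span_b by simp

lemma Bb_mixed:
  assumes "i < N" "j \<in> J"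
  shows "Bb i j = 0" "Bb j i = 0"
  unfolding Bb_def
  by (rule form_dV_even[OF b_even[OF assms(1)] b_odd[OF assms(2)]], simp)
    (rule form_dV_even[OF b_odd[OF assms(2)] b_even[OF assms(1)]], simp)

lemma Bb_skew: "i \<in> J \<Longrightarrow> j \<in> J \<Longrightarrow> Bb j i = - Bb i j"
  unfolding Bb_def using form_dV_symmetric[OF b_odd b_odd, of i j] by simp

text \<open>Adapted coordinates prescribe the quadratic form; polarisation recovers the matrix, by
  evaluating at the indicator of one index and at that of a pair of indices.\<close>

lemma Bb_even:
  assumes "i < N" "j < N"
  shows "Bb i j = (if i = j then wick_eps k i else 0)"
proof -
  have q: "(\<Sum>i<N. \<Sum>j<N. Bb i j * (x i * x j)) = (\<Sum>i<N. wick_eps k i * (x i)\<^sup>2)" for x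
  proof -
    have "sigma_superfun A n m N M b x {} = ((\<Sum>i<k. (x i)\<^sup>2) - (\<Sum>i\<in>{k..<N}. (x i)\<^sup>2)) / 2"
      using adapted by (simp add: adapted_coordinates_def)
    then have "(\<Sum>i<N. \<Sum>j<N. Bb i j * (x i * x j)) = (\<Sum>i<k. (x i)\<^sup>2) - (\<Sum>i\<in>{k..<N}. (x i)\<^sup>2)"
      unfolding sigma_superfun_empty Bb_def by simp
    also have "\<dots> = (\<Sum>i\<in>{..<k} \<union> {k..<N}. wick_eps k i * (x i)\<^sup>2)"
      by (subst sum.union_disjoint) (auto simp: wick_eps_def sum_negf)
    also have "{..<k} \<union> {k..<N} = {..<N}" using kN by auto
    finally show ?thesis .
  qed
  have two: "(\<Sum>l<N. f l * (if l = i then s else if l = j then t else 0)) = f i * s + f j * t"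
    if "i \<noteq> j" for f :: "nat \<Rightarrow> real" and s t :: real
  proof -
    have "(\<Sum>l<N. f l * (if l = i then s else if l = j then t else 0)) = (\<Sum>l\<in>{i, j}. f l * (if l = i then s else if l = j then t else 0))"
      by (rule sum.mono_neutral_right) (use assms in auto)
    then show ?thesis using that by simp
  qed
  have one: "Bb l l = wick_eps k l" if "l < N" for l
  proof -
    have "(\<Sum>i<N. \<Sum>j<N. Bb i j * ((if i = l then 1 else 0) * (if j = l then 1 else 0))) = Bb l l"
      using that by (simp add: if_distrib[of "\<lambda>x. _ * x"] if_distrib[of "\<lambda>x. x * _"] cong: if_cong)
    moreover have "(\<Sum>i<N. wick_eps k i * (if i = l then 1 else 0)\<^sup>2) = wick_eps k l"
      using that by (simp add: if_distrib[of "\<lambda>x. x\<^sup>2"] if_distrib[of "\<lambda>x. _ * x"] cong: if_cong)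
    ultimately show ?thesis using q[of "\<lambda>i. if i = l then 1 else 0"] by simp
  qed
  show ?thesis
  proof (cases "i = j")
    case True
    then show ?thesis using one assms by simp
  next
    case False
    have sym: "Bb j i = Bb i j"
      unfolding Bb_def using form_dV_symmetric[OF b_even b_even, of i j] assms by simp
    define x where "x l = (if l = i then 1 else if l = j then 1 else 0 :: real)" for l
    have "(\<Sum>l<N. Bb p l * (x p * x l)) = x p * (Bb p i + Bb p j)" for p
      using two[OF False, of "\<lambda>l. Bb p l * x p" 1 1] by (simp add: x_def mult.assoc algebra_simps)
    then have "(\<Sum>p<N. \<Sum>l<N. Bb p l * (x p * x l)) = (\<Sum>p<N. (Bb p i + Bb p j) * x p)"
      by (simp add: mult.commute)
    also have "\<dots> = (Bb i i + Bb i j) + (Bb j i + Bb j j)"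
      using two[OF False, of "\<lambda>p. Bb p i + Bb p j" 1 1] by (simp add: x_def)
    finally have l: "(\<Sum>p<N. \<Sum>l<N. Bb p l * (x p * x l)) = (Bb i i + Bb i j) + (Bb j i + Bb j j)" .
    have "(x p)\<^sup>2 = x p" for p by (simp add: x_def)
    then have "(\<Sum>p<N. wick_eps k p * (x p)\<^sup>2) = wick_eps k i + wick_eps k j"
      using two[OF False, of "wick_eps k" 1 1] by (simp add: x_def)
    then show ?thesis using q[of x] l one assms sym False by simp
  qed
qed

lemma expand:
  assumes "u \<in> LV_space L n m"
  obtains c where "u = (\<Sum>i<N + M. c i *\<^sub>R b i)"
proof -
  have "u \<in> span (b ` {..<N + M})" using assms span_b by simp
  then obtain c where "u = (\<Sum>v\<in>b ` {..<N + M}. c v *\<^sub>R v)"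
    using span_finite[of "b ` {..<N + M}"] by auto
  then have "u = (\<Sum>i<N + M. c (b i) *\<^sub>R b i)" by (simp add: sum.reindex[OF inj_b])
  then show ?thesis by (rule that)
qed

definition ee :: grassmann where "ee = gr_exp M (gr_quadratic J Bb (gr_const 1))"

lemma ee_eq: "gr_exp M (\<lambda>K. if K = {} then 0 else - sigma_superfun A n m N M b x K) = ee"
  using sigma_superfun_odd[of N M A n m b x] Bb_mixed unfolding ee_def Bb_def by simp

text \<open>Supplies the hypothesis of \<open>berezin_Nil_nonzero\<close>. Even vectors pair to zero
  with odd ones, so nondegeneracy on the whole space restricts to the odd part.\<close>

lemma Bb_nondegenerate: "\<exists>u. \<forall>j\<in>J. a j = (\<Sum>i\<in>J. u i * Bb i j)"
proof -
  have JNM: "J \<subseteq> {..<N + M}" by auto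
  have inj: "inj_on b J" using inj_on_subset[OF inj_b JNM] .
  have ind: "independent (b ` J)" using independent_mono[OF ind_b image_mono[OF JNM]] .
  let ?g = "\<lambda>v. a (the_inv_into J b v)"
  obtain u where u: "u \<in> span (b ` J)" "\<And>v. v \<in> b ` J \<Longrightarrow> form_dV A n m u v = ?g v"
  proof (rule riesz_exists[where g = ?g and B = "form_dV A n m", OF _ ind bilinear_form_dV(2)])
    show "finite (b ` J)" by simp
    fix u assume u: "u \<in> span (b ` J)" and zero: "\<And>v. v \<in> b ` J \<Longrightarrow> form_dV A n m u v = 0"
    have "span (b ` J) \<subseteq> LV_part A L n m 1"
      using b_odd by (intro span_minimal subspace_LV_part) auto
    then have u1: "u \<in> LV_part A L n m 1" using u by blast
    have z: "form_dV A n m u (b i) = 0" if "i < N + M" for i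
    proof (cases "i < N")
      case True
      then show ?thesis using form_dV_even[OF u1 b_even] by simp
    next
      case False
      then show ?thesis using zero that by auto
    qed
    show "u = 0"
    proof (rule form_dV_nondegenerate[OF LV_partD[OF u1]])
      fix w assume "w \<in> LV_space L n m"
      then obtain c where "w = (\<Sum>i<N + M. c i *\<^sub>R b i)" by (rule expand)
      then show "form_dV A n m u w = 0"
        by (simp add: linear_sum[OF bilinear_form_dV(1)] linear_scale[OF bilinear_form_dV(1)] z)
    qed
  qed blast
  obtain c where c: "u = (\<Sum>v\<in>b ` J. c v *\<^sub>R v)"
    using u(1) span_finite[of "b ` J"] by auto
  then have u': "u = (\<Sum>i\<in>J. c (b i) *\<^sub>R b i)" by (simp add: sum.reindex[OF inj])
  have "a j = (\<Sum>i\<in>J. c (b i) * Bb i j)" if j: "j \<in> J" for j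
  proof -
    have "a j = form_dV A n m u (b j)"
      using u(2)[of "b j"] j by (simp add: the_inv_into_f_f[OF inj])
    also have "\<dots> = (\<Sum>i\<in>J. c (b i) * Bb i j)"
      unfolding u' Bb_def by (simp add: linear_sum[OF bilinear_form_dV(2)] linear_scale[OF bilinear_form_dV(2)])
    finally show ?thesis .
  qed
  then show ?thesis by (intro exI[of _ "\<lambda>i. c (b i)"] ballI)
qed

lemma berezin_nonzero: "berezin J ee [] \<noteq> 0"
  unfolding ee_def
proof (rule berezin_Nil_nonzero[where b = Bb])
  show "Bb j i = - Bb i j" if "i \<in> J" "j \<in> J" for i j using that by (rule Bb_skew)
  show "\<exists>u. \<forall>j\<in>J. a j = (\<Sum>i\<in>J. u i * Bb i j)" for a by (rule Bb_nondegenerate)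
qed simp_all

definition cf :: "'a \<times> coord \<Rightarrow> nat \<Rightarrow> real" where "cf l i = lf l (b i)"

text \<open>The normalised integral of a product of functionals \<open>e\<^sup>* \<otimes> y\<close>; the even ones commute with everything.\<close>

definition expect :: "('a \<times> coord) list \<Rightarrow> real"
  where "expect ls = multilinear_ext {..<N} (wick_moment N k) (map cf (filter (\<lambda>l. even (lp l)) ls)) *
    (berezin J ee (map cf (filter (\<lambda>l. odd (lp l)) ls)) / berezin J ee [])"

lemma expect_Nil: "expect [] = 1"
  using berezin_nonzero by (simp add: expect_def wick_moment_def)

abbreviation letters :: "('a \<times> coord) set" where "letters \<equiv> E \<times> coords n m"

lemma cf_parity:
  assumes "l \<in> letters"
  shows "odd (lp l) \<Longrightarrow> i < N \<Longrightarrow> cf l i = 0" "even (lp l) \<Longrightarrow> i \<in> J \<Longrightarrow> cf l i = 0"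
  unfolding cf_def using lf_even[OF b_even, of i l] lf_even[OF b_odd, of i l] assms
  by (auto simp: mem_Times_iff)

lemma lf_du_parity:
  assumes "l \<in> letters" "l' \<in> letters" "lf l' (du l) \<noteq> 0"
  shows "even (lp l + lp l')"
proof -
  obtain e y f z where l: "l = (e, y)" "l' = (f, z)" by (cases l, cases l')
  have "CL e f \<noteq> 0" "z = partner y"
    using assms unfolding l by (auto simp: lf_du form_V_dual_eq split: if_splits)
  then show ?thesis using CL_even[of e f] assms by (auto simp: l lp_def)
qed

text \<open>Letters of the other parity neither pair with \<open>l\<close> nor contribute a sign, so
  the recursion is the Gaussian one for even \<open>l\<close> and the Berezin one for odd
  \<open>l\<close>. In both, the direction of differentiation is given by the coefficients of
  \<open>du l\<close>.\<close>

lemma expect_Cons: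
  assumes l: "l \<in> letters" and ls: "set ls \<subseteq> letters"
  shows "expect (l # ls) = contract (\<lambda>l'. lf l' (du l)) (\<lambda>l'. (-1) ^ (lp l * lp l')) expect ls"
proof -
  obtain u where u: "du l = (\<Sum>i<N + M. u i *\<^sub>R b i)"
    using expand[OF du_LV, of l] l by (auto simp: mem_Times_iff)
  have split: "(\<Sum>i<N + M. f i) = (\<Sum>i<N. f i) + (\<Sum>i\<in>J. f i)" for f :: "nat \<Rightarrow> real"
  proof -
    have eq: "{..<N + M} = {..<N} \<union> J" by auto
    show ?thesis unfolding eq by (rule sum.union_disjoint) auto
  qed
  have C: "lf l' (du l) = (\<Sum>i<N. u i * cf l' i) + (\<Sum>i\<in>J. u i * cf l' i)" for l'
  proof -
    have "lf l' (du l) = (\<Sum>i<N + M. u i * cf l' i)"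
      unfolding u cf_def
      by (subst lf_sum[where n = n and m = m]) (simp_all add: lf_scale[OF b_LV] subspace_scale[OF subspace_LV b_LV])
    then show ?thesis by (simp only: split)
  qed
  \<comment> \<open>Pairing \<open>du l\<close> with the basis gives back \<open>l\<close>, which is
    the form in which both recursions ask for the representing vector.\<close>
  have cfl: "cf l j = (\<Sum>i<N. u i * Bb i j) + (\<Sum>i\<in>J. u i * Bb i j)" if "j < N + M" for j
  proof -
    have "cf l j = form_dV A n m (du l) (b j)"
      unfolding cf_def using l that by (intro form_dV_du[symmetric] b_LV) auto
    also have "\<dots> = (\<Sum>i<N + M. u i * Bb i j)"
      unfolding u Bb_def by (simp add: linear_sum[OF bilinear_form_dV(2)] linear_scale[OF bilinear_form_dV(2)])
    finally show ?thesis by (simp only: split)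
  qed
  let ?C = "\<lambda>l'. lf l' (du l)" and ?k = "\<lambda>l'. (-1) ^ (lp l * lp l') :: real"
  let ?ev = "\<lambda>ls. multilinear_ext {..<N} (wick_moment N k) (map cf ls)"
  let ?od = "\<lambda>ls. berezin J ee (map cf ls) / berezin J ee []"
  let ?E = "filter (\<lambda>l. even (lp l))" and ?O = "filter (\<lambda>l. odd (lp l))"
  have mem: "l' \<in> letters" if "l' \<in> set ls" for l' using ls that by blast
  show ?thesis
  proof (cases "even (lp l)")
    case True
    have C0: "?C l' = 0 \<and> ?k l' = 1" if "l' \<in> set ls" "\<not> even (lp l')" for l'
      using lf_du_parity[OF l mem[OF that(1)]] True that by auto
    have ex: "expect = (\<lambda>ls. ?od (filter (\<lambda>l. \<not> even (lp l)) ls) * ?ev (?E ls))"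
      by (rule ext) (simp add: expect_def)
    have "contract ?C ?k expect ls = contract ?C ?k (\<lambda>ls. ?od (filter (\<lambda>l. \<not> even (lp l)) ls) * ?ev (?E ls)) ls"
      by (simp only: ex)
    also have "\<dots> = ?od (filter (\<lambda>l. \<not> even (lp l)) ls) * contract ?C ?k ?ev (?E ls)"
      by (rule contract_filter) (rule C0)
    also have "contract ?C ?k ?ev (?E ls)
        = contract (\<lambda>l. \<Sum>j<N. u j * l j) (\<lambda>_. 1) (multilinear_ext {..<N} (wick_moment N k)) (map cf (?E ls))"
    proof (rule contract_map_cong)
      fix l' assume "l' \<in> set (?E ls)"
      then have "(\<Sum>i\<in>J. u i * cf l' i) = 0"
        using mem cf_parity(2) by (intro sum.neutral) auto
      then show "?C l' = (\<Sum>j<N. u j * cf l' j)" by (simp add: C)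
      show "?k l' = 1" using True by simp
    qed
    also have "\<dots> = multilinear_ext {..<N} (wick_moment N k) (cf l # map cf (?E ls))"
    proof (rule wick_moment_ext_Cons[symmetric])
      fix i assume i: "i < N"
      have "(\<Sum>j<N. u j * Bb j i) = (\<Sum>j<N. if j = i then u i * wick_eps k i else 0)"
        by (rule sum.cong) (use i in \<open>auto simp: Bb_even\<close>)
      moreover have "(\<Sum>j\<in>J. u j * Bb j i) = 0"
        by (rule sum.neutral) (use i Bb_mixed in auto)
      ultimately show "cf l i = u i * wick_eps k i" using cfl[of i] i by simp
    qed
    also have "?od (filter (\<lambda>l. \<not> even (lp l)) ls) * multilinear_ext {..<N} (wick_moment N k) (cf l # map cf (?E ls)) = expect (l # ls)"
      using True by (simp add: expect_def)
    finally show ?thesis ..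
  next
    case False
    have C0: "?C l' = 0 \<and> ?k l' = 1" if "l' \<in> set ls" "\<not> odd (lp l')" for l'
      using lf_du_parity[OF l mem[OF that(1)]] False that by auto
    have ex: "expect = (\<lambda>ls. ?ev (filter (\<lambda>l. \<not> odd (lp l)) ls) * ?od (?O ls))"
      by (rule ext) (simp add: expect_def)
    have "contract ?C ?k expect ls = contract ?C ?k (\<lambda>ls. ?ev (filter (\<lambda>l. \<not> odd (lp l)) ls) * ?od (?O ls)) ls"
      by (simp only: ex)
    also have "\<dots> = ?ev (filter (\<lambda>l. \<not> odd (lp l)) ls) * contract ?C ?k ?od (?O ls)"
      by (rule contract_filter) (rule C0)
    also have "contract ?C ?k ?od (?O ls) = contract ?C ?k (\<lambda>ls. (1 / berezin J ee []) * berezin J ee (map cf ls)) (?O ls)"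
      by simp
    also have "\<dots> = (1 / berezin J ee []) * contract ?C ?k (\<lambda>ls. berezin J ee (map cf ls)) (?O ls)"
      by (rule contract_mult)
    also have "contract ?C ?k (\<lambda>ls. berezin J ee (map cf ls)) (?O ls)
        = contract (\<lambda>c. \<Sum>j\<in>J. u j * c j) (\<lambda>_. - 1) (berezin J ee) (map cf (?O ls))"
    proof (rule contract_map_cong)
      fix l' assume l': "l' \<in> set (?O ls)"
      then have "(\<Sum>i<N. u i * cf l' i) = 0"
        using mem cf_parity(1) by (intro sum.neutral) auto
      then show "?C l' = (\<Sum>j\<in>J. u j * cf l' j)" by (simp add: C)
      show "?k l' = - 1" using False l' by simp
    qed
    also have "\<dots> = berezin J ee (cf l # map cf (?O ls))"
      unfolding ee_def
    proof (rule berezin_Cons[where b = Bb, symmetric])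
      show "finite J" "card J = M" by simp_all
      show "Bb j i = - Bb i j" if "i \<in> J" "j \<in> J" for i j using that by (rule Bb_skew)
      fix j assume j: "j \<in> J"
      have "(\<Sum>i<N. u i * Bb i j) = 0"
        by (rule sum.neutral) (use j Bb_mixed in auto)
      then show "cf l j = (\<Sum>i\<in>J. u i * Bb i j)" using cfl[of j] j by simp
    qed
    also have "?ev (filter (\<lambda>l. \<not> odd (lp l)) ls) * ((1 / berezin J ee []) * berezin J ee (cf l # map cf (?O ls))) = expect (l # ls)"
      using False by (simp add: expect_def)
    finally show ?thesis ..
  qed
qed

end

section \<open>The integral of the vertex tensors\<close>

lemma cross_sign_map: "cross_sign q p (map f us) = cross_sign (\<lambda>h. q (f h)) (\<lambda>h. p (f h)) us"
  by (induction us) (simp_all add: o_def)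

lemma wick_term_cong:
  assumes "finite H" "c \<in> matchings H" "\<And>h k. h \<in> H \<Longrightarrow> k \<in> H \<Longrightarrow> C (x h) (x k) = D (x h) (x k)"
  shows "wick_term p C x H c = wick_term p D x H c"
proof -
  have "Min e \<in> H \<and> Max e \<in> H" if "e \<in> c" for e
  proof -
    have "e \<subseteq> H" "card e = 2" using that assms(2) by (auto simp: matchings_def partition_on_def)
    then show ?thesis
      by (metis Min_in Max_in card.empty card.infinite subsetD zero_neq_numeral)
  qed
  then show ?thesis
    unfolding wick_term_def using assms(3) by (intro arg_cong2[of _ _ _ _ "(*)"] refl prod.cong) blast+
qed

text \<open>The sign of reshuffling a word of functionals on \<open>L\<close> followed by a word of
  coordinates into an alternating word.\<close>

definition psi_sign :: "'a dg_alg \<Rightarrow> 'a::real_vector list \<Rightarrow> coord list \<Rightarrow> real"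
  where "psi_sign A es h = cross_sign (\<lambda>l. cpar (snd l)) (\<lambda>l. elem_par A (fst l)) (zip es h)"

lemma psi_sign_append:
  assumes "length v = length h" "length w = length h'"
  shows "psi_sign A (v @ w) (h @ h') = psi_sign A v h * (-1) ^ (wpar cpar h * wpar (elem_par A) w) * psi_sign A w h'"
proof -
  have "wpar (\<lambda>l. cpar (snd l)) (zip v h) = wpar cpar h"
    using assms(1) by (induction v h rule: list_induct2) auto
  moreover have "wpar (\<lambda>l. elem_par A (fst l)) (zip w h') = wpar (elem_par A) w"
    using assms(2) by (induction w h' rule: list_induct2) auto
  ultimately show ?thesis
    using assms by (simp add: psi_sign_def cross_sign_append)
qed

text \<open>In \<open>psi\<close> each functional passes the coordinates before it, in
  \<open>cross_sign\<close> each coordinate passes the functionals after it; both count the same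
  pairs.\<close>

lemma psi_sign_nth:
  assumes "length es = length h"
  shows "(\<Prod>j<length h. (-1) ^ (wpar cpar (take j h) * elem_par A (es ! j))) = psi_sign A es h"
  using assms
proof (induction h arbitrary: es rule: rev_induct)
  case (snoc y h)
  then obtain es' e where es: "es = es' @ [e]" "length es' = length h"
    by (cases es rule: rev_cases) auto
  have "(\<Prod>j<length h. (-1) ^ (wpar cpar (take j (h @ [y])) * elem_par A (es ! j)))
      = (\<Prod>j<length h. (-1) ^ (wpar cpar (take j h) * elem_par A (es' ! j)) :: real)"
    by (rule prod.cong) (auto simp: es nth_append)
  also have "\<dots> = psi_sign A es' h" by (rule snoc.IH) (rule es(2))
  finally show ?case
    using es psi_sign_append[of es' h "[e]" "[y]" A] by (simp add: psi_sign_def nth_append)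
qed (simp add: psi_sign_def)

context frobenius_lagrangian
begin

lemma co_par_sign:
  assumes x: "x \<in> L" and e: "e \<in> E"
  shows "co e (par_sign A j x) = (-1) ^ (j * ep e) * co e x"
proof -
  obtain a b where ab: "a \<in> L" "b \<in> L" "a \<in> even_part A" "b \<in> odd_part A" "x = a + b"
    using x by (rule decompose_L)
  have hom: "a \<in> hom_part A 0" "b \<in> hom_part A 1" using ab by (auto simp: hom_part_def)
  have l: "co e (par_sign A j x) = co e a + (-1) ^ j * co e b"
    using ab subspace_L by (simp add: par_sign_decomposed co_add co_scale subspace_scale)
  have r: "co e x = co e a + co e b" using ab by (simp add: co_add)
  show ?thesis
  proof (cases "even (ep e)")
    case True
    then have "co e b = 0" using co_hom[OF ab(2) hom(2) e] by auto
    then show ?thesis using l r True by simp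
  next
    case False
    then have "co e a = 0" using co_hom[OF ab(1) hom(1) e] by auto
    moreover have "(-1) ^ (j * ep e) = ((-1) ^ j :: real)"
      using False by (intro neg_one_power_cong) auto
    ultimately show ?thesis using l r by simp
  qed
qed

text \<open>Each vertex tensor is nonzero only on words of odd parity, and there is one for each
  factor of the chain.\<close>

lemma m_tilde_tensor_parity:
  assumes "es \<in> words E (length (concat hs))" "\<forall>h\<in>set hs. 3 \<le> length h" "m_tilde_tensor A (map length hs) es \<noteq> 0"
  shows "even (wpar ep es + length hs)"
  using assms
proof (induction hs arbitrary: es)
  case (Cons h hs)
  let ?v = "take (length h) es" and ?w = "drop (length h) es"
  have es: "set es \<subseteq> E" "length es = length h + length (concat hs)" using Cons.prems(1) by (auto simp: words_def)
  have nz: "m_tilde A ?v \<noteq> 0" "m_tilde_tensor A (map length hs) ?w \<noteq> 0"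
    using Cons.prems(3) by (auto simp: m_tilde_tensor_def)
  have "odd (wpar ep ?v)"
    using es Cons.prems(2) by (intro m_tilde_odd nz) (auto dest: in_set_takeD)
  moreover have "even (wpar ep ?w + length hs)"
    using es Cons.prems(2) by (intro Cons.IH nz) (auto simp: words_def dest: in_set_dropD)
  moreover have "wpar ep es = wpar ep ?v + wpar ep ?w"
    unfolding wpar_append[symmetric] by simp
  ultimately show ?case by simp
qed (simp add: words_def)

fun psi_coeff :: "coord list list \<Rightarrow> 'a list \<Rightarrow> real" where
  "psi_coeff [] es = 1"
| "psi_coeff (h # hs) es = psi_sign A (take (length h) es) h * m_tilde A (take (length h) es) * psi_coeff hs (drop (length h) es)"

text \<open>The sign \<open>(-1)\<^bsup>p(h)\<^esup>\<close> moves the odd tensors past the \<open>h\<^sub>i\<close>.\<close>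

lemma psi_coeff_eq:
  assumes "es \<in> words E (length (concat hs))" "\<forall>h\<in>set hs. 3 \<le> length h"
  shows "(-1) ^ (\<Sum>i<length hs. (length hs - Suc i) * wpar cpar (hs ! i)) * psi_coeff hs es
    = psi_sign A es (concat hs) * m_tilde_tensor A (map length hs) es"
  using assms
proof (induction hs arbitrary: es)
  case (Cons h hs)
  let ?v = "take (length h) es" and ?w = "drop (length h) es" and ?l = "length hs"
  have es: "set es \<subseteq> E" "length es = length h + length (concat hs)" using Cons.prems(1) by (auto simp: words_def)
  have w: "?w \<in> words E (length (concat hs))" using es by (auto simp: words_def dest: in_set_dropD)
  have IH: "(-1) ^ (\<Sum>i<?l. (?l - Suc i) * wpar cpar (hs ! i)) * psi_coeff hs ?w
      = psi_sign A ?w (concat hs) * m_tilde_tensor A (map length hs) ?w"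
    using Cons.prems(2) by (intro Cons.IH w) auto
  have p: "(\<Sum>i<length (h # hs). (length (h # hs) - Suc i) * wpar cpar ((h # hs) ! i))
      = ?l * wpar cpar h + (\<Sum>i<?l. (?l - Suc i) * wpar cpar (hs ! i))"
    by (simp add: sum.lessThan_Suc_shift del: sum.lessThan_Suc)
  have "psi_sign A (?v @ ?w) (h @ concat hs)
      = psi_sign A ?v h * (-1) ^ (wpar cpar h * wpar ep ?w) * psi_sign A ?w (concat hs)"
    by (rule psi_sign_append) (use es in auto)
  then have s: "psi_sign A es (concat (h # hs)) = psi_sign A ?v h * (-1) ^ (wpar cpar h * wpar ep ?w) * psi_sign A ?w (concat hs)"
    by simp
  have m: "m_tilde_tensor A (map length (h # hs)) es = m_tilde A ?v * m_tilde_tensor A (map length hs) ?w"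
    by (simp add: m_tilde_tensor_def)
  \<comment> \<open>Only words on which the remaining vertex tensors are nonzero matter, and their
    parity is the number of remaining vertices; this produces the exponent in
    \<open>p(h)\<close>.\<close>
  have q: "(-1) ^ (wpar cpar h * wpar ep ?w) * m_tilde_tensor A (map length hs) ?w
      = (-1) ^ (?l * wpar cpar h) * m_tilde_tensor A (map length hs) ?w"
  proof (cases "m_tilde_tensor A (map length hs) ?w = 0")
    case False
    then have "even (wpar ep ?w + ?l)"
      using Cons.prems(2) by (intro m_tilde_tensor_parity w) auto
    then have "(-1) ^ (wpar cpar h * wpar ep ?w) = ((-1) ^ (?l * wpar cpar h) :: real)"
      by (intro neg_one_power_cong) auto
    then show ?thesis by simp
  qed simp
  have "(-1) ^ (?l * wpar cpar h + (\<Sum>i<?l. (?l - Suc i) * wpar cpar (hs ! i))) * psi_coeff (h # hs) es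
      = psi_sign A ?v h * m_tilde A ?v * (-1) ^ (?l * wpar cpar h) *
        ((-1) ^ (\<Sum>i<?l. (?l - Suc i) * wpar cpar (hs ! i)) * psi_coeff hs ?w)"
    by (simp add: power_add mult_ac)
  also have "\<dots> = psi_sign A ?v h * m_tilde A ?v * psi_sign A ?w (concat hs) *
      ((-1) ^ (?l * wpar cpar h) * m_tilde_tensor A (map length hs) ?w)"
    unfolding IH by (simp only: mult_ac)
  also have "\<dots> = psi_sign A es (concat (h # hs)) * m_tilde_tensor A (map length (h # hs)) es"
    unfolding q[symmetric] s m by (simp only: mult_ac)
  finally show ?case unfolding p .
qed (simp add: psi_sign_def m_tilde_tensor_def)

end

context gaussian
begin

section \<open>Products of linear superfunctions\<close>

definition lin_fun :: "(nat \<Rightarrow> real) \<Rightarrow> superfun"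
  where "lin_fun c x = (\<lambda>K. \<Sum>i<N + M. c i * coordinate N i x K)"

lemma lin_fun_even:
  assumes "\<And>i. i \<in> J \<Longrightarrow> c i = 0"
  shows "lin_fun c x = gr_const (\<Sum>i<N. c i * x i)"
proof
  fix K
  have "lin_fun c x K = (\<Sum>i<N. c i * coordinate N i x K)"
    unfolding lin_fun_def by (rule sum.mono_neutral_right) (use assms in auto)
  also have "\<dots> = (\<Sum>i<N. c i * gr_const (x i) K)"
    by (rule sum.cong) (auto simp: coordinate_def)
  also have "\<dots> = gr_const (\<Sum>i<N. c i * x i) K"
    by (simp add: gr_const_def)
  finally show "lin_fun c x K = gr_const (\<Sum>i<N. c i * x i) K" .
qed

lemma lin_fun_odd:
  assumes "\<And>i. i < N \<Longrightarrow> c i = 0"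
  shows "lin_fun c x = gr_lin J c (gr_const 1)"
proof
  fix K
  have "lin_fun c x K = (\<Sum>i\<in>J. c i * coordinate N i x K)"
    unfolding lin_fun_def by (rule sum.mono_neutral_right) (use assms in auto)
  also have "\<dots> = gr_lin J c (gr_const 1) K"
    unfolding gr_lin_def by (rule sum.cong) (simp_all add: coordinate_odd)
  finally show "lin_fun c x K = gr_lin J c (gr_const 1) K" .
qed

abbreviation lin_word :: "(nat \<Rightarrow> real) \<Rightarrow> ('a \<times> coord) list \<Rightarrow> grassmann"
  where "lin_word x ls \<equiv> gr_prod (map (\<lambda>l. lin_fun (cf l) x) ls)"

lemma gr_mul_lin_fun:
  assumes l: "l \<in> letters" and g: "gr_finitary g"
  shows "gr_mul (lin_fun (cf l) x) g = (if even (lp l) then (\<lambda>K. (\<Sum>i<N. cf l i * x i) * g K) else gr_lin J (cf l) g)"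
proof (cases "even (lp l)")
  case True
  then have "lin_fun (cf l) x = gr_const (\<Sum>i<N. cf l i * x i)"
    using cf_parity(2)[OF l] by (intro lin_fun_even)
  then show ?thesis using True g by (simp add: gr_mul_const_left)
next
  case False
  then have "lin_fun (cf l) x = gr_lin J (cf l) (gr_const 1)"
    using cf_parity(1)[OF l] by (intro lin_fun_odd)
  then show ?thesis using False g by (simp add: gr_mul_lin gr_mul_const_left)
qed

lemma gr_prod_Cons: "gr_prod (g # gs) = gr_mul g (gr_prod gs)"
  by (simp add: gr_prod_def)

text \<open>Even factors are scalars in the Grassmann algebra and move out of the product, while the
  odd ones keep their order and act by left multiplication.\<close>

lemma lin_word_mul:
  assumes "set ls \<subseteq> letters" "gr_finitary g"
  shows "gr_mul (lin_word x ls) g = (\<lambda>K. prod_list (map (\<lambda>c. \<Sum>i<N. c i * x i) (map cf (filter (\<lambda>l. even (lp l)) ls))) *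
    foldr (gr_lin J) (map cf (filter (\<lambda>l. odd (lp l)) ls)) g K)"
  using assms(1)
proof (induction ls)
  case Nil
  show ?case using assms(2) by (simp add: gr_prod_def gr_mul_const_left)
next
  case (Cons l ls)
  then show ?case
    by (simp add: gr_prod_Cons gr_mul_lin_fun gr_prod_finitary gr_mul_scale_left gr_mul_lin gr_lin_scale mult.assoc)
qed

lemma lin_word_append:
  assumes "set u \<subseteq> letters"
  shows "gr_mul (lin_word x u) (lin_word x v) = lin_word x (u @ v)"
  using assms
proof (induction u)
  case Nil
  show ?case by (simp add: gr_prod_def gr_mul_const_left gr_prod_finitary[unfolded gr_prod_def])
next
  case (Cons l u)
  have "gr_mul (gr_mul (lin_fun (cf l) x) (lin_word x u)) (lin_word x v) = gr_mul (lin_fun (cf l) x) (gr_mul (lin_word x u) (lin_word x v))"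
    using Cons.prems by (simp add: gr_mul_lin_fun gr_prod_finitary gr_mul_scale_left gr_mul_lin)
  then show ?case using Cons by (simp add: gr_prod_Cons)
qed

lemma lin_word_expand:
  "lin_word x ls K = (\<Sum>w\<in>words {..<N + M} (length ls). prod_list (map2 cf ls w) * gr_prod (map (\<lambda>i. coordinate N i x) w) K)"
proof (induction ls arbitrary: K)
  case (Cons l ls)
  have ext: "lin_word x ls = (\<lambda>K. \<Sum>w\<in>words {..<N + M} (length ls). prod_list (map2 cf ls w) * gr_prod (map (\<lambda>i. coordinate N i x) w) K)"
    by (rule ext) (rule Cons.IH)
  have "lin_word x (l # ls) = gr_mul (lin_fun (cf l) x)
      (\<lambda>K. \<Sum>w\<in>words {..<N + M} (length ls). prod_list (map2 cf ls w) * gr_prod (map (\<lambda>i. coordinate N i x) w) K)"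
    unfolding list.map gr_prod_Cons ext ..
  also have "\<dots> = (\<lambda>K. \<Sum>i<N + M. cf l i * (\<Sum>w\<in>words {..<N + M} (length ls). prod_list (map2 cf ls w) *
      gr_mul (coordinate N i x) (gr_prod (map (\<lambda>i. coordinate N i x) w)) K))"
    unfolding lin_fun_def gr_mul_sum_left gr_mul_sum_right ..
  finally show ?case
    by (simp add: sum_words_Suc gr_prod_Cons sum_distrib_left mult.assoc)
qed (simp add: gr_prod_def)

text \<open>Each argument of the vertex tensor is expanded in \<open>E\<close>. The coordinates that
  arise are the coefficients of the linear superfunctions, and the parity operators inside
  \<open>psi\<close> combine to \<open>psi_sign\<close>.\<close>

lemma tensor_superfun_psi:
  assumes h: "2 \<le> length h"
  shows "tensor_superfun N M b (length h) (psi A h) x = (\<lambda>K. \<Sum>es\<in>words E (length h).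
    (psi_sign A es h * m_tilde A es) * lin_word x (zip es h) K)"
proof
  fix K
  let ?r = "length h"
  let ?g = "\<lambda>w. gr_prod (map (\<lambda>i. coordinate N i x) w) K"
  have psi: "psi A h (map b w) = (\<Sum>es\<in>words E ?r. (psi_sign A es h * m_tilde A es) * prod_list (map2 cf (zip es h) w))"
    if w: "w \<in> words {..<N + M} ?r" for w
  proof -
    let ?a = "\<lambda>j. Poly_Mapping.lookup (b (w ! j)) (h ! j)"
    let ?f = "\<lambda>j e. (-1) ^ (wpar cpar (take j h) * ep e) * co e (?a j)"
    have wl: "length w = ?r" and wj: "\<And>j. j < ?r \<Longrightarrow> w ! j < N + M"
      using w by (auto simp: words_def subset_iff)
    have L: "?a j \<in> L" if "j < ?r" for j using LV_lookup[OF b_LV[OF wj[OF that]]] .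
    have arg: "par_sign A (wpar cpar (take j h)) (?a j) = (\<Sum>e\<in>E. ?f j e *\<^sub>R e)" if "j < ?r" for j
      using co_expand[OF par_sign_L[OF L[OF that]], of "wpar cpar (take j h)"]
      by (simp add: co_par_sign[OF L[OF that]] cong: sum.cong)
    \<comment> \<open>The empty prefix is the initial case of
      \<open>m_tilde_multilinear\<close>.\<close>
    have "psi A h (map b w) = m_tilde A ([] @ map (\<lambda>l. \<Sum>e\<in>E. l e *\<^sub>R e) (map ?f [0..<?r]))"
      unfolding psi_def using wl by (auto simp: arg intro!: arg_cong[of _ _ "m_tilde A"])
    also have "\<dots> = multilinear_ext E (m_tilde A) (map ?f [0..<?r])"
      by (subst m_tilde_multilinear) (use h in simp_all)
    also have "\<dots> = (\<Sum>es\<in>words E ?r. prod_list (map2 (\<lambda>l i. l i) (map ?f [0..<?r]) es) * m_tilde A es)"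
      by (simp add: multilinear_ext_words)
    also have "\<dots> = (\<Sum>es\<in>words E ?r. (psi_sign A es h * m_tilde A es) * prod_list (map2 cf (zip es h) w))"
    proof (rule sum.cong[OF refl])
      fix es assume es: "es \<in> words E ?r"
      then have el: "length es = ?r" by (simp add: words_def)
      have "prod_list (map2 (\<lambda>l i. l i) (map ?f [0..<?r]) es) = (\<Prod>j<?r. ?f j (es ! j))"
        using el by (simp add: prod.list_conv_set_nth lessThan_atLeast0)
      also have "\<dots> = psi_sign A es h * (\<Prod>j<?r. co (es ! j) (?a j))"
        unfolding prod.distrib psi_sign_nth[OF el] ..
      also have "(\<Prod>j<?r. co (es ! j) (?a j)) = prod_list (map2 cf (zip es h) w)"
        using el wl by (simp add: prod.list_conv_set_nth lessThan_atLeast0 cf_def lf_def)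
      finally show "prod_list (map2 (\<lambda>l i. l i) (map ?f [0..<?r]) es) * m_tilde A es
          = (psi_sign A es h * m_tilde A es) * prod_list (map2 cf (zip es h) w)"
        by (simp add: mult_ac)
    qed
    finally show ?thesis .
  qed
  have "tensor_superfun N M b ?r (psi A h) x K = (\<Sum>w\<in>words {..<N + M} ?r. psi A h (map b w) * ?g w)"
    by (simp add: tensor_superfun_def words_def)
  also have "\<dots> = (\<Sum>w\<in>words {..<N + M} ?r. \<Sum>es\<in>words E ?r. (psi_sign A es h * m_tilde A es) * (prod_list (map2 cf (zip es h) w) * ?g w))"
    by (rule sum.cong) (simp_all add: psi sum_distrib_right mult.assoc)
  also have "\<dots> = (\<Sum>es\<in>words E ?r. (psi_sign A es h * m_tilde A es) * (\<Sum>w\<in>words {..<N + M} ?r. prod_list (map2 cf (zip es h) w) * ?g w))"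
    by (subst sum.swap) (simp add: sum_distrib_left)
  also have "\<dots> = (\<Sum>es\<in>words E ?r. (psi_sign A es h * m_tilde A es) * lin_word x (zip es h) K)"
    by (rule sum.cong) (simp_all add: lin_word_expand words_def)
  finally show "tensor_superfun N M b ?r (psi A h) x K = (\<Sum>es\<in>words E ?r. (psi_sign A es h * m_tilde A es) * lin_word x (zip es h) K)" .
qed

lemma zip_letters: "es \<in> words E r \<Longrightarrow> set h \<subseteq> coords n m \<Longrightarrow> set (zip es h) \<subseteq> letters"
  by (auto simp: words_def dest: set_zip_leftD set_zip_rightD)

lemma psi_product_eq:
  assumes "\<forall>h\<in>set hs. 2 \<le> length h \<and> set h \<subseteq> coords n m"
  shows "psi_product A (N, M, k, b) hs x = (\<lambda>K. \<Sum>es\<in>words E (length (concat hs)). psi_coeff hs es * lin_word x (zip es (concat hs)) K)"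
  using assms
proof (induction hs)
  case (Cons h hs)
  let ?c = "concat hs"
  have h: "2 \<le> length h" "set h \<subseteq> coords n m" using Cons.prems by auto
  have IH: "psi_product A (N, M, k, b) hs x = (\<lambda>K. \<Sum>es\<in>words E (length ?c). psi_coeff hs es * lin_word x (zip es ?c) K)"
    using Cons by simp
  have "psi_product A (N, M, k, b) (h # hs) x = gr_mul (tensor_superfun N M b (length h) (psi A h) x) (psi_product A (N, M, k, b) hs x)"
    by (simp add: psi_product_def gr_prod_Cons)
  also have "\<dots> = (\<lambda>K. \<Sum>v\<in>words E (length h). (psi_sign A v h * m_tilde A v) *
      (\<Sum>w\<in>words E (length ?c). psi_coeff hs w * gr_mul (lin_word x (zip v h)) (lin_word x (zip w ?c)) K))"
    unfolding IH tensor_superfun_psi[OF h(1)] gr_mul_sum_left gr_mul_sum_right ..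
  also have "\<dots> = (\<lambda>K. \<Sum>v\<in>words E (length h). \<Sum>w\<in>words E (length ?c). psi_coeff (h # hs) (v @ w) * lin_word x (zip (v @ w) (h @ ?c)) K)"
  proof
    fix K
    show "(\<Sum>v\<in>words E (length h). (psi_sign A v h * m_tilde A v) *
      (\<Sum>w\<in>words E (length ?c). psi_coeff hs w * gr_mul (lin_word x (zip v h)) (lin_word x (zip w ?c)) K))
      = (\<Sum>v\<in>words E (length h). \<Sum>w\<in>words E (length ?c). psi_coeff (h # hs) (v @ w) * lin_word x (zip (v @ w) (h @ ?c)) K)"
      unfolding sum_distrib_left
    proof (intro sum.cong refl)
      fix v w assume v: "v \<in> words E (length h)" and w: "w \<in> words E (length ?c)"
      have g: "gr_mul (lin_word x (zip v h)) (lin_word x (zip w ?c)) = lin_word x (zip v h @ zip w ?c)"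
        by (rule lin_word_append) (rule zip_letters[OF v h(2)])
      have "length v = length h" using v by (simp add: words_def)
      then have z: "zip (v @ w) (h @ ?c) = zip v h @ zip w ?c"
        and c: "psi_coeff (h # hs) (v @ w) = psi_sign A v h * m_tilde A v * psi_coeff hs w"
        by simp_all
      show "(psi_sign A v h * m_tilde A v) * (psi_coeff hs w * gr_mul (lin_word x (zip v h)) (lin_word x (zip w ?c)) K)
          = psi_coeff (h # hs) (v @ w) * lin_word x (zip (v @ w) (h @ ?c)) K"
        unfolding g z c by (simp only: mult.assoc)
    qed
  qed
  also have "\<dots> = (\<lambda>K. \<Sum>es\<in>words E (length (concat (h # hs))). psi_coeff (h # hs) es * lin_word x (zip es (concat (h # hs))) K)"
    unfolding concat.simps length_append sum_words_add ..
  finally show ?case .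
qed (simp add: psi_product_def gr_prod_def)

text \<open>The odd part of the exponential is independent of \<open>x\<close>, so for every word
  the integrand is a number, a Berezin integral, times a polynomial in the even coordinates. The
  factor common to all words is the integral of 1.\<close>

lemma gauss_integral_eq:
  assumes S: "finite S" "\<And>s. s \<in> S \<Longrightarrow> set (ls s) \<subseteq> letters"
    and f: "\<And>x. f x = (\<lambda>K. \<Sum>s\<in>S. c s * lin_word x (ls s) K)"
  shows "gauss_integral A n m (N, M, k, b) f
    = complex_of_real (\<Sum>s\<in>S. c s * expect (ls s)) * (wick_norm N k * complex_of_real (berezin J ee []))"
proof -
  let ?ev = "\<lambda>s. map cf (filter (\<lambda>l. even (lp l)) (ls s))" and ?od = "\<lambda>s. map cf (filter (\<lambda>l. odd (lp l)) (ls s))"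
  let ?P = "\<lambda>s x. prod_list (map (\<lambda>c. \<Sum>i<N. c i * x i) (?ev s))"
  let ?V = "\<lambda>s. multilinear_ext {..<N} (wick_moment N k) (?ev s)"
  have fin: "gr_finitary ee" unfolding ee_def by (rule gr_exp_quadratic_finitary)
  have eq: "gr_mul (f x) ee J = (\<Sum>s\<in>S. (c s * berezin J ee (?od s)) * ?P s x)" for x
    unfolding f gr_mul_sum_left
    by (rule sum.cong) (simp_all add: lin_word_mul[OF S(2) fin] berezin_def)
  have wick: "has_wick N k (?P s) (wick_norm N k * complex_of_real (?V s))" for s
  proof -
    have "has_wick N k (\<lambda>x. multilinear_ext {..<N} (\<lambda>w. prod_list (map x w)) (?ev s)) (wick_norm N k * complex_of_real (?V s))"
      by (rule has_wick_multilinear_ext) (simp_all add: has_wick_word kN)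
    then show ?thesis using multilinear_ext_prod[of "{..<N}" 1] by simp
  qed
  have "gauss_integral A n m (N, M, k, b) f = wick_integral N k (\<lambda>x. gr_mul (f x) ee J)"
    unfolding gauss_integral_def case_prod_conv ee_eq ..
  also have "\<dots> = (\<Sum>s\<in>S. complex_of_real (c s * berezin J ee (?od s)) * (wick_norm N k * complex_of_real (?V s)))"
    unfolding eq by (intro wick_integral_eq has_wick_sum S(1) wick)
  also have "\<dots> = (\<Sum>s\<in>S. complex_of_real (c s * expect (ls s)) * (wick_norm N k * complex_of_real (berezin J ee [])))"
    using berezin_nonzero by (intro sum.cong refl) (simp add: expect_def)
  finally show ?thesis by (simp add: sum_distrib_right)
qed

lemma gauss_ratio:
  assumes hs: "hs \<in> chain_words n m"
  shows "(-1) ^ (\<Sum>i<length hs. (length hs - Suc i) * wpar cpar (hs ! i)) *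
      (gauss_integral A n m (N, M, k, b) (psi_product A (N, M, k, b) hs) / gauss_integral A n m (N, M, k, b) (\<lambda>x. gr_const 1))
    = complex_of_real (\<Sum>es\<in>words E (length (concat hs)). psi_sign A es (concat hs) * m_tilde_tensor A (map length hs) es * expect (zip es (concat hs)))"
proof -
  let ?r = "length (concat hs)" and ?Z = "wick_norm N k * complex_of_real (berezin J ee [])"
  let ?p = "\<Sum>i<length hs. (length hs - Suc i) * wpar cpar (hs ! i)"
  have len: "\<forall>h\<in>set hs. 3 \<le> length h" and co: "\<forall>h\<in>set hs. set h \<subseteq> coords n m"
    using hs by (auto simp: chain_words_def)
  have Z: "?Z \<noteq> 0" using berezin_nonzero wick_norm_nonzero by simp
  \<comment> \<open>The constant function is the empty word over a one-element index set.\<close>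
  have "gauss_integral A n m (N, M, k, b) (\<lambda>x. gr_const 1) = complex_of_real (\<Sum>s\<in>{()}. 1 * expect []) * ?Z"
    by (rule gauss_integral_eq) (simp_all add: gr_prod_def)
  then have one: "gauss_integral A n m (N, M, k, b) (\<lambda>x. gr_const 1) = ?Z"
    by (simp add: expect_Nil)
  have psi: "gauss_integral A n m (N, M, k, b) (psi_product A (N, M, k, b) hs)
     = complex_of_real (\<Sum>es\<in>words E ?r. psi_coeff hs es * expect (zip es (concat hs))) * ?Z"
  proof (rule gauss_integral_eq)
    show "finite (words E ?r)" by (rule finite_words[OF finite_E])
    show "set (zip es (concat hs)) \<subseteq> letters" if "es \<in> words E ?r" for es
      by (rule zip_letters[OF that]) (use co in auto)
    show "psi_product A (N, M, k, b) hs x = (\<lambda>K. \<Sum>es\<in>words E ?r. psi_coeff hs es * lin_word x (zip es (concat hs)) K)" for x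
      using len co by (intro psi_product_eq) (auto dest: bspec)
  qed
  have sum: "(-1) ^ ?p * (\<Sum>es\<in>words E ?r. psi_coeff hs es * expect (zip es (concat hs)))
      = (\<Sum>es\<in>words E ?r. psi_sign A es (concat hs) * m_tilde_tensor A (map length hs) es * expect (zip es (concat hs)))"
    unfolding sum_distrib_left
    by (rule sum.cong[OF refl]) (simp only: mult.assoc[symmetric] psi_coeff_eq[OF _ len])
  have "(-1 :: complex) ^ ?p = complex_of_real ((-1) ^ ?p)" by simp
  then show ?thesis
    unfolding one psi nonzero_mult_div_cancel_right[OF Z] by (simp only: of_real_mult[symmetric] sum)
qed

text \<open>Wick's theorem expands the integral over matchings, and each term factors into one for
  \<open>L\<close> and one for V because the covariance is a tensor product.\<close>

lemma expect_eq_sum: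
  assumes es: "es \<in> words E r" and ys: "length ys = r" "set ys \<subseteq> coords n m"
  shows "expect (zip es ys) = (\<Sum>c\<in>matchings {..<r}. psi_sign A es ys *
    (wick_term ep CL (\<lambda>i. es ! i) {..<r} c * wick_term cpar (form_V_dual n m) (\<lambda>i. ys ! i) {..<r} c))"
proof -
  let ?x = "\<lambda>h. (es ! h, ys ! h)" and ?H = "{..<r}"
  let ?C = "\<lambda>(e, y) (f, z). (-1) ^ (cpar y * ep f) * (CL e f * form_V_dual n m y z)"
  have el: "length es = r" "\<And>h. h < r \<Longrightarrow> es ! h \<in> E" "\<And>h. h < r \<Longrightarrow> ys ! h \<in> coords n m"
    using es ys by (auto simp: words_def subset_iff)
  have sort: "sorted_list_of_set ?H = [0..<r]" by (simp add: lessThan_atLeast0)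
  have zip: "zip es ys = map ?x [0..<r]"
    using el ys by (intro nth_equalityI) auto
  have "expect (zip es ys) = (\<Sum>c\<in>matchings ?H. wick_term lp (\<lambda>l l'. lf l' (du l)) ?x ?H c)"
    unfolding zip sort[symmetric]
  proof (rule wick_theorem[where U = letters])
    show "expect (a # as) = contract (\<lambda>l'. lf l' (du a)) (\<lambda>l'. (-1) ^ (lp a * lp l')) expect as"
      if "a \<in> letters" "set as \<subseteq> letters" for a as using that by (rule expect_Cons)
    show "even (lp a + lp a')" if "a \<in> letters" "a' \<in> letters" "lf a' (du a) \<noteq> 0" for a a'
      using that by (rule lf_du_parity)
  qed (use el expect_Nil in auto)
  also have "\<dots> = (\<Sum>c\<in>matchings ?H. wick_term (\<lambda>(e, y). ep e + cpar y) ?C ?x ?H c)"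
    unfolding lp_def[symmetric]
    by (intro sum.cong refl wick_term_cong) (auto simp: lf_du el)
  also have "\<dots> = (\<Sum>c\<in>matchings ?H. psi_sign A es ys *
      (wick_term ep CL (\<lambda>i. es ! i) ?H c * wick_term cpar (form_V_dual n m) (\<lambda>i. ys ! i) ?H c))"
  proof (rule sum.cong[OF refl])
    fix c assume c: "c \<in> matchings ?H"
    have "wick_term (\<lambda>(e, y). ep e + cpar y) ?C ?x ?H c
       = cross_sign (\<lambda>h. cpar (ys ! h)) (\<lambda>h. ep (es ! h)) (sorted_list_of_set ?H) *
         wick_term ep CL (\<lambda>i. es ! i) ?H c * wick_term cpar (form_V_dual n m) (\<lambda>i. ys ! i) ?H c"
      by (rule wick_term_tensor) (use c el CL_even in auto)
    moreover have "cross_sign (\<lambda>h. cpar (ys ! h)) (\<lambda>h. ep (es ! h)) (sorted_list_of_set ?H) = psi_sign A es ys"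
      unfolding psi_sign_def zip sort by (simp add: cross_sign_map)
    ultimately show "wick_term (\<lambda>(e, y). ep e + cpar y) ?C ?x ?H c = psi_sign A es ys *
      (wick_term ep CL (\<lambda>i. es ! i) ?H c * wick_term cpar (form_V_dual n m) (\<lambda>i. ys ! i) ?H c)"
      by (simp add: mult.assoc)
  qed
  finally show ?thesis .
qed

end

context frobenius_lagrangian
begin

text \<open>The sign \<open>psi_sign\<close> occurs twice, from the vertex tensors and from
  factoring the Wick terms, and cancels. Exchanging the two sums leaves the coefficients of
  \<open>I_word\<close> times the values of the graphs.\<close>

lemma S_word_eq:
  assumes hs: "hs \<in> chain_words n m"
  shows "S_word A L n m hs = (SOME \<phi>. F_functional A L \<phi>) (I_word n m hs)"
proof -
  define \<phi> where "\<phi> = (SOME \<phi>. F_functional A L \<phi>)"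
  have \<phi>: "F_functional A L \<phi>" unfolding \<phi>_def by (rule F_functional_exists)
  then interpret \<phi>: linear \<phi> by (simp add: F_functional_def)
  obtain N M k b where z: "(SOME z. adapted_coordinates A L n m z) = (N, M, k, b)"
    by (metis prod_cases4)
  have "adapted_coordinates A L n m (N, M, k, b)"
    unfolding z[symmetric] by (rule someI_ex[OF adapted_coordinates_exist])
  then interpret gaussian A L n m N M k b by unfold_locales
  let ?ys = "concat hs" and ?r = "length (concat hs)" and ?T = "m_tilde_tensor A (map length hs)"
  have ys: "set ?ys \<subseteq> coords n m" using hs by (auto simp: chain_words_def)
  have "S_word A L n m hs = (\<Sum>es\<in>words E ?r. psi_sign A es ?ys * ?T es * expect (zip es ?ys))"
    unfolding S_word_def Let_def z gauss_ratio[OF hs] of_real_eq_iff by (rule the_eq_trivial)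
  also have "\<dots> = (\<Sum>es\<in>words E ?r. \<Sum>c\<in>matchings {..<?r}.
      wick_term cpar (form_V_dual n m) (\<lambda>i. ?ys ! i) {..<?r} c * (?T es * wick_term ep CL (\<lambda>i. es ! i) {..<?r} c))"
  proof (rule sum.cong[OF refl])
    fix es assume es: "es \<in> words E ?r"
    have sq: "psi_sign A es ?ys * psi_sign A es ?ys = 1"
      unfolding psi_sign_def by (rule cross_sign_square)
    have rearrange: "psi_sign A es ?ys * ?T es * (psi_sign A es ?ys * (u * v)) = v * (?T es * u)" for u v
    proof -
      have "psi_sign A es ?ys * ?T es * (psi_sign A es ?ys * (u * v))
          = (psi_sign A es ?ys * psi_sign A es ?ys) * (v * (?T es * u))" by (simp only: mult_ac)
      then show ?thesis using sq by simp
    qed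
    show "psi_sign A es ?ys * ?T es * expect (zip es ?ys) = (\<Sum>c\<in>matchings {..<?r}.
      wick_term cpar (form_V_dual n m) (\<lambda>i. ?ys ! i) {..<?r} c * (?T es * wick_term ep CL (\<lambda>i. es ! i) {..<?r} c))"
      unfolding expect_eq_sum[OF es refl ys] sum_distrib_left by (rule sum.cong[OF refl]) (rule rearrange)
  qed
  also have "\<dots> = (\<Sum>c\<in>matchings {..<?r}. wick_term cpar (form_V_dual n m) (\<lambda>i. ?ys ! i) {..<?r} c *
      (\<Sum>es\<in>words E ?r. ?T es * wick_term ep CL (\<lambda>i. es ! i) {..<?r} c))"
    by (subst sum.swap) (simp add: sum_distrib_left)
  also have "\<dots> = \<phi> (I_word n m hs)"
  proof (cases "even ?r")
    case False
    \<comment> \<open>For an odd number of letters there is nothing to sum over, in agreement with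
      the zero in \<open>I_word\<close>.\<close>
    then have "matchings {..<?r} = {}" using matchings_card[of "{..<?r}"] by auto
    then show ?thesis using False by (simp add: I_word_def \<phi>.zero)
  next
    case True
    then obtain k where k: "?r = 2 * k" by (elim evenE)
    have ks: "(\<forall>i\<in>set (map length hs). 3 \<le> i) \<and> sum_list (map length hs) = 2 * k"
      using hs k by (auto simp: chain_words_def length_concat)
    have "\<phi> (I_word n m hs) = (\<Sum>c\<in>chord_diagrams k. beta c cpar (form_V_dual n m) ?ys * \<phi> (gen (chord_graph (map length hs) c)))"
      using True k by (simp add: I_word_def \<phi>.sum \<phi>.scale)
    also have "\<dots> = (\<Sum>c\<in>matchings {..<?r}. wick_term cpar (form_V_dual n m) (\<lambda>i. ?ys ! i) {..<?r} c *
      (\<Sum>es\<in>words E ?r. ?T es * wick_term ep CL (\<lambda>i. es ! i) {..<?r} c))"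
      unfolding k chord_diagrams_eq_matchings[symmetric]
    proof (intro sum.cong refl arg_cong2[of _ _ _ _ "(*)"])
      fix c assume c: "c \<in> chord_diagrams k"
      show "beta c cpar (form_V_dual n m) ?ys = wick_term cpar (form_V_dual n m) (\<lambda>i. ?ys ! i) {..<2 * k} c"
        using c k by (rule beta_eq_wick_term)
      have "\<phi> (gen (chord_graph (map length hs) c)) = beta_L_dual A L c (2 * k) ?T"
        using \<phi> ks c unfolding F_functional_def by blast
      also have "\<dots> = (\<Sum>es\<in>words E (2 * k). ?T es * beta c ep CL es)"
        using c by (rule beta_L_dual_eq)
      also have "\<dots> = (\<Sum>es\<in>words E (2 * k). ?T es * wick_term ep CL (\<lambda>i. es ! i) {..<2 * k} c)"
        by (intro sum.cong refl arg_cong2[of _ _ _ _ "(*)"] beta_eq_wick_term c) (simp add: words_def)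
      finally show "\<phi> (gen (chord_graph (map length hs) c)) = (\<Sum>es\<in>words E (2 * k). ?T es * wick_term ep CL (\<lambda>i. es ! i) {..<2 * k} c)" .
    qed
    finally show ?thesis ..
  qed
  finally show ?thesis unfolding \<phi>_def .
qed

end

section \<open>Words occurring in the chain relations\<close>

definition supported :: "'b set \<Rightarrow> ('b \<Rightarrow>\<^sub>0 real) set"
  where "supported S = {v. Poly_Mapping.keys v \<subseteq> S}"

lemma supported_lookup: "v \<in> supported S \<longleftrightarrow> (\<forall>b. b \<notin> S \<longrightarrow> Poly_Mapping.lookup v b = 0)"
  by (auto simp: supported_def in_keys_iff)

lemma subspace_supported: "subspace (supported S)"
  by (auto simp: subspace_def supported_lookup lookup_add)

lemma supported_gen: "b \<in> S \<Longrightarrow> gen b \<in> supported S"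
  by (auto simp: supported_def)

lemma supported_lin_ext:
  assumes "\<And>b. b \<in> Poly_Mapping.keys v \<Longrightarrow> f b \<in> supported S"
  shows "lin_ext f v \<in> supported S"
  unfolding lin_ext_def
  by (intro subspace_sum subspace_supported subspace_scale) (rule assms)

lemma supported_word_deriv:
  assumes "\<And>i u. i < length w \<Longrightarrow> u \<in> Poly_Mapping.keys (\<delta> (w ! i)) \<Longrightarrow> take i w @ u @ drop (Suc i) w \<in> S"
  shows "word_deriv par e \<delta> w \<in> supported S"
  unfolding word_deriv_def
  by (intro subspace_sum subspace_supported subspace_scale supported_lin_ext supported_gen assms) auto

lemma lookup_lin_ext_gen:
  "Poly_Mapping.lookup (lin_ext (\<lambda>u. gen (g u)) v) w = (\<Sum>u\<in>Poly_Mapping.keys v. if g u = w then Poly_Mapping.lookup v u else 0)"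
  unfolding lin_ext_def lookup_sum by (intro sum.cong refl) (simp add: lookup_single when_def)

lemma lookup_lin_ext_gen_eq:
  assumes "\<And>u. g u = w \<longleftrightarrow> u = u0"
  shows "Poly_Mapping.lookup (lin_ext (\<lambda>u. gen (g u)) v) w = Poly_Mapping.lookup v u0"
  unfolding lookup_lin_ext_gen assms by (simp add: in_keys_iff)

lemma lookup_lin_ext_gen_0:
  assumes "\<And>u. g u \<noteq> w"
  shows "Poly_Mapping.lookup (lin_ext (\<lambda>u. gen (g u)) v) w = 0"
  unfolding lookup_lin_ext_gen using assms by simp

text \<open>
  The coefficient of \<open>dz\<close> in \<open>i\<^sub>\<alpha>(\<omega>) - da\<close> is the constant term of \<open>\<alpha>\<close> on the partner of \<open>z\<close>, up to sign,
  because \<open>da\<close> and the relations involve no words of length one.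
\<close>

lemma hamiltonian_field_no_constant:
  assumes ham: "hamiltonian_field n m p a \<alpha>" and a: "\<forall>w\<in>Poly_Mapping.keys a. length w = 2" and y: "y \<in> coords n m"
  shows "[] \<notin> Poly_Mapping.keys (\<alpha> y)"
proof -
  let ?S = "{w :: form_letter list. 2 \<le> length w}"
  let ?\<delta> = "\<lambda>l. case l of Fn y \<Rightarrow> 0 | Df y \<Rightarrow> fn_form (\<alpha> y)"
  let ?D = "word_deriv fpar (p + 1) ?\<delta>"
  \<comment> \<open>The relations exchange two neighbouring letters, so all their words have length
    at least two.\<close>
  have "sym_rels fpar \<subseteq> supported ?S"
    unfolding sym_rels_def
    by (auto intro!: subspace_diff[OF subspace_supported] subspace_scale[OF subspace_supported] supported_gen)
  then have "span (sym_rels fpar) \<subseteq> supported ?S"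
    by (rule span_minimal) (rule subspace_supported)
  then have rel: "contraction p \<alpha> (omega n m) - de_rham (fn_form a) \<in> supported ?S"
    using ham by (auto simp: hamiltonian_field_def)
  have fn: "fn_form a \<in> supported {w. length w = 2}"
    unfolding fn_form_def by (rule supported_lin_ext) (use a in \<open>auto intro!: supported_gen\<close>)
  have dr: "de_rham (fn_form a) \<in> supported ?S"
    unfolding de_rham_def derivation_def
  proof (rule supported_lin_ext, rule supported_word_deriv)
    fix w i u
    assume "w \<in> Poly_Mapping.keys (fn_form a)" "i < length w"
      "u \<in> Poly_Mapping.keys (case w ! i of Fn y \<Rightarrow> gen [Df y] | Df y \<Rightarrow> 0)"
    then have "length w = 2" "length u = 1" using fn by (auto simp: supported_def split: form_letter.splits)
    then show "take i w @ u @ drop (Suc i) w \<in> ?S" using \<open>i < length w\<close> by simp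
  qed
  have "contraction p \<alpha> (omega n m) \<in> supported ?S"
    using subspace_add[OF subspace_supported rel dr] by simp
  then have zero: "Poly_Mapping.lookup (contraction p \<alpha> (omega n m)) [Df z] = 0" for z
    by (simp add: supported_lookup)
  have fn0: "Poly_Mapping.lookup (fn_form v) [] = Poly_Mapping.lookup v []" for v
    unfolding fn_form_def by (rule lookup_lin_ext_gen_eq) simp
  have D: "Poly_Mapping.lookup (?D [Df y1, Df y2]) [Df z]
      = (if z = y2 then Poly_Mapping.lookup (\<alpha> y1) [] else 0)
      + (-1) ^ ((p + 1) * (cpar y1 + 1)) * (if z = y1 then Poly_Mapping.lookup (\<alpha> y2) [] else 0)" for y1 y2 z
  proof -
    define s :: real where "s = (-1) ^ ((p + 1) * (cpar y1 + 1))"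
    have D: "?D [Df y1, Df y2] = lin_ext (\<lambda>u. gen (u @ [Df y2])) (fn_form (\<alpha> y1))
        + s *\<^sub>R lin_ext (\<lambda>u. gen (Df y1 # u)) (fn_form (\<alpha> y2))"
      by (simp add: word_deriv_def numeral_2_eq_2 s_def add_ac)
    have "Poly_Mapping.lookup (lin_ext (\<lambda>u. gen (u @ [Df y2])) v) [Df z] = (if z = y2 then Poly_Mapping.lookup v [] else 0)" for v
      using lookup_lin_ext_gen_eq[of "\<lambda>u. u @ [Df y2]" "[Df z]" "[]" v] lookup_lin_ext_gen_0[of "\<lambda>u. u @ [Df y2]" "[Df z]" v]
      by (auto simp: append_eq_Cons_conv)
    moreover have "Poly_Mapping.lookup (lin_ext (\<lambda>u. gen (Df y1 # u)) v) [Df z] = (if z = y1 then Poly_Mapping.lookup v [] else 0)" for v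
      using lookup_lin_ext_gen_eq[of "\<lambda>u. Df y1 # u" "[Df z]" "[]" v] lookup_lin_ext_gen_0[of "\<lambda>u. Df y1 # u" "[Df z]" v]
      by auto
    ultimately show ?thesis
      unfolding D s_def[symmetric] lookup_add lookup_scaleR by (simp add: fn0)
  qed
  interpret lin: linear "lin_ext ?D" by (rule linear_lin_ext)
  have "Poly_Mapping.lookup (contraction p \<alpha> (omega n m)) [Df z]
      = (\<Sum>i<n. Poly_Mapping.lookup (?D [Df (P i), Df (Q i)]) [Df z])
      + (1 / 2) * (\<Sum>i<m. Poly_Mapping.lookup (?D [Df (X i), Df (X i)]) [Df z])" for z
    unfolding contraction_def derivation_def omega_def
    by (simp only: lin.add lin.scale lin.sum lin_ext_gen lookup_add lookup_scaleR lookup_sum real_scaleR_def)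
  \<comment> \<open>For an odd coordinate the two terms from dx dx agree, the exponent of the sign
    being even, and the factor 1/2 leaves a single one.\<close>
  then have L: "(\<Sum>i<n. (if z = Q i then Poly_Mapping.lookup (\<alpha> (P i)) [] else 0)
        + (-1) ^ (p + 1) * (if z = P i then Poly_Mapping.lookup (\<alpha> (Q i)) [] else 0))
      + (\<Sum>i<m. if z = X i then Poly_Mapping.lookup (\<alpha> (X i)) [] else 0) = 0" for z
    using zero[of z] unfolding D
    by (simp add: sum_distrib_left mult.commute power_mult cong: if_cong)
  have "Poly_Mapping.lookup (\<alpha> y) [] = 0"
  proof (cases y)
    case (P i)
    then show ?thesis using L[of "Q i"] y by (auto simp: coords_def)
  next
    case (Q i)
    have "(-1) ^ (p + 1) * (\<Sum>j<n. if i = j then Poly_Mapping.lookup (\<alpha> (Q j)) [] else 0) = 0"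
      using L[of "P i"] unfolding sum_distrib_left by simp
    then show ?thesis using Q y by (auto simp: coords_def)
  next
    case (X i)
    then show ?thesis using L[of "X i"] y by (auto simp: coords_def)
  qed
  then show ?thesis by (simp add: in_keys_iff)
qed

text \<open>Exchanging letters or factors keeps words admissible. The adjoint action replaces a
  letter by a word from the vector field; such a word is nonempty, so no factor becomes
  shorter.\<close>

lemma chain_rels_supported: "chain_rels n m \<subseteq> supported (chain_words n m)"
proof
  fix r assume "r \<in> chain_rels n m"
  then consider
    (1) hs u c d v hs' where "r = gen (hs @ [u @ [c, d] @ v] @ hs') - (-1) ^ (cpar c * cpar d) *\<^sub>R gen (hs @ [u @ [d, c] @ v] @ hs')"
      "hs @ [u @ [c, d] @ v] @ hs' \<in> chain_words n m"
  | (2) hs g h hs' where "r = gen (hs @ [g, h] @ hs') + (-1) ^ (wpar cpar g * wpar cpar h) *\<^sub>R gen (hs @ [h, g] @ hs')"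
      "hs @ [g, h] @ hs' \<in> chain_words n m"
  | (3) p a \<alpha> hs where "r = adj_action p \<alpha> hs" "homog n m p a" "\<forall>w\<in>Poly_Mapping.keys a. length w = 2"
      "hamiltonian_field n m p a \<alpha>" "hs \<in> chain_words n m"
    unfolding chain_rels_def by blast
  then show "r \<in> supported (chain_words n m)"
  proof cases
    case 1
    then have "hs @ [u @ [d, c] @ v] @ hs' \<in> chain_words n m"
      by (auto simp: chain_words_def)
    then show ?thesis
      unfolding 1(1) using 1(2)
      by (intro subspace_diff[OF subspace_supported] subspace_scale[OF subspace_supported] supported_gen)
  next
    case 2
    then have "hs @ [h, g] @ hs' \<in> chain_words n m"
      by (auto simp: chain_words_def)
    then show ?thesis
      unfolding 2(1) using 2(2)
      by (intro subspace_add[OF subspace_supported] subspace_scale[OF subspace_supported] supported_gen)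
  next
    case 3
    let ?W = "{u. 3 \<le> length u \<and> set u \<subseteq> coords n m}"
    have der: "(-1) ^ p *\<^sub>R derivation cpar p \<alpha> (gen h) \<in> supported ?W" if h: "h \<in> ?W" for h
      unfolding derivation_def lin_ext_gen
    proof (rule subspace_scale[OF subspace_supported], rule supported_word_deriv)
      fix i u assume i: "i < length h" and u: "u \<in> Poly_Mapping.keys (\<alpha> (h ! i))"
      have hi: "h ! i \<in> coords n m" using h nth_mem[OF i] by auto
      have "u \<noteq> []" using hamiltonian_field_no_constant[OF 3(4,3) hi] u by auto
      then have "1 \<le> length u" by (cases u) auto
      moreover have "set u \<subseteq> coords n m"
        using 3(4) hi u unfolding hamiltonian_field_def homog_def by blast
      ultimately show "take i h @ u @ drop (Suc i) h \<in> ?W"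
        using h i by (auto dest: in_set_takeD in_set_dropD)
    qed
    show ?thesis
      unfolding 3(1) adj_action_def
    proof (intro subspace_sum subspace_supported subspace_scale supported_lin_ext supported_gen)
      fix i u assume i: "i \<in> {..<length hs}" and u: "u \<in> Poly_Mapping.keys ((-1) ^ p *\<^sub>R derivation cpar p \<alpha> (gen (hs ! i)))"
      have hs: "\<forall>h\<in>set hs. h \<in> ?W" using 3(5) by (auto simp: chain_words_def)
      then have "hs ! i \<in> ?W" using i by auto
      then have "u \<in> ?W" using der u by (auto simp: supported_def)
      then show "take i hs @ [u] @ drop (Suc i) hs \<in> chain_words n m"
        using hs by (auto simp: chain_words_def dest: in_set_takeD in_set_dropD)
    qed
  qed
qed

text \<open>A functional vanishing on the relations is constant on each coset, so passing to all
  representatives adds no new values.\<close>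

lemma the_elem_image_cosets:
  assumes lin: "linear (\<phi> :: 'v::real_vector \<Rightarrow> real)" and zero: "\<And>r. r \<in> R \<Longrightarrow> \<phi> r = 0"
  shows "\<phi> ` (\<Union>x\<in>C. coset (span R) (g x)) = (\<lambda>x. \<phi> (g x)) ` C"
proof -
  have "span R \<subseteq> {r. \<phi> r = 0}"
    using zero by (intro span_minimal) (auto simp: subspace_def linear_0[OF lin] linear_add[OF lin] linear_scale[OF lin])
  then have eq: "\<phi> z = \<phi> w" if "z \<in> coset (span R) w" for z w
    using that by (auto simp: coset_def linear_diff[OF lin] dest!: subsetD)
  have mem: "w \<in> coset (span R) w" for w
    by (simp add: coset_def span_zero)
  show ?thesis
  proof (intro equalityI subsetI)
    fix y assume "y \<in> \<phi> ` (\<Union>x\<in>C. coset (span R) (g x))"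
    then obtain x z where "x \<in> C" "z \<in> coset (span R) (g x)" "y = \<phi> z" by blast
    then show "y \<in> (\<lambda>x. \<phi> (g x)) ` C" using eq by blast
  next
    fix y assume "y \<in> (\<lambda>x. \<phi> (g x)) ` C"
    then show "y \<in> \<phi> ` (\<Union>x\<in>C. coset (span R) (g x))" using mem by blast
  qed
qed

theorem theorem6p20:
  fixes A :: "'a::real_vector dg_alg" and L :: "'a set" and n m :: nat
  assumes "dg_comm_frobenius A"
    and "sp_odd A" and "sp_symmetric A" and "sp_nondegenerate A"
    and "contractible_alg A"
    and "maximally_isotropic A L"
    and "complements_boundaries A L"
  shows "\<forall>C \<in> chain_space n m. S_map A L n m C = F_map A L (I_map n m C)"
proof
  interpret frobenius_lagrangian A L
    using assms by unfold_locales
  fix C assume "C \<in> chain_space n m"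
  then obtain x where C: "C = coset (span (chain_rels n m)) x" and x: "x \<in> supported (chain_words n m)"
    by (auto simp: chain_space_def supported_def)
  have "span (chain_rels n m) \<subseteq> supported (chain_words n m)"
    by (rule span_minimal[OF chain_rels_supported subspace_supported])
  \<comment> \<open>Each \<open>y\<close> in the class is \<open>x\<close> plus an element of the
    span of the relations, both supported on admissible words.\<close>
  then have supp: "y \<in> supported (chain_words n m)" if "y \<in> C" for y
    using that subspace_add[OF subspace_supported _ x, of "y - x"] by (auto simp: C coset_def)
  define \<phi> where "\<phi> = (SOME \<phi>. F_functional A L \<phi>)"
  have \<phi>: "F_functional A L \<phi>" unfolding \<phi>_def by (rule F_functional_exists)
  then have lin: "linear \<phi>" by (simp add: F_functional_def)
  have "lin_ext (S_word A L n m) y = \<phi> (lin_ext (I_word n m) y)" if "y \<in> C" for y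
  proof -
    have "lin_ext (S_word A L n m) y = (\<Sum>hs\<in>Poly_Mapping.keys y. Poly_Mapping.lookup y hs *\<^sub>R \<phi> (I_word n m hs))"
      unfolding lin_ext_def \<phi>_def
      by (intro sum.cong refl) (use supp[OF that] S_word_eq in \<open>auto simp: supported_def\<close>)
    then show ?thesis
      by (simp add: lin_ext_def linear_sum[OF lin] linear_scale[OF lin])
  qed
  then have "lin_ext (S_word A L n m) ` C = (\<lambda>y. \<phi> (lin_ext (I_word n m) y)) ` C"
    by (rule image_cong[OF refl])
  also have "\<dots> = \<phi> ` I_map n m C"
    unfolding I_map_def
    by (rule the_elem_image_cosets[OF lin, symmetric]) (use \<phi> in \<open>simp add: F_functional_def\<close>)
  \<comment> \<open>Both maps take the element of this common set of values.\<close>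
  finally show "S_map A L n m C = F_map A L (I_map n m C)"
    by (simp add: S_map_def F_map_def \<phi>_def)
qed

end
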